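(* For every $0<\epsilon<1$ there exist $T>0$ and smooth, divergence-free, mean-free initial data $(v_0,b_0)$ on $\mathbb T^3$ for which the ideal MHD system has infinitely many weak solutions $(v,b)\in L^1([0,T];C^{1-\epsilon}(\mathbb T^3))$ on $[0,T]\times\mathbb T^3$, all with the same initial data $(v_0,b_0)$.
   Context: $\mathbb T^3=\mathbb R^3/\mathbb Z^3$. The ideal MHD system for a velocity field $v$, a magnetic field $b$ (both $\mathbb R^3$-valued) and a scalar pressure $p$ is $$\partial_t v+\operatorname{div}(v\otimes v)+\nabla p=\operatorname{div}(b\otimes b),\quad \partial_t b+\operatorname{div}(v\otimes b)=\operatorname{div}(b\otimes v),\quad \operatorname{div}v=\operatorname{div}b=0,$$ where $(v\otimes b)_{ij}=v_ib_j$ and $(\operatorname{div}M)_i=\sum_j\partial_jM_{ji}$. The notation $(f,g)\in X$ means $f\in X$ and $g\in X$. Mean-free means zero spatial mean. Weak solution: $(v,b)\in L^2([0,T]\times\mathbb T^3)$ is a weak solution of the ideal MHD system with initial data $(v_0,b_0)$ if $v(\cdot,t),b(\cdot,t)$ are divergence-free in the sense of distributions for a.e. $t\in[0,T]$ and, for all divergence-free vector-valued test functions $\phi\in C_0^\infty([0,T)\times\mathbb T^3)$, $$\int_0^T\!\!\int_{\mathbb T^3}\Big[v\cdot\partial_t\phi+\sum_{i,j}\partial_j\phi_i\,(v_jv_i-b_jb_i)\Big]dx\,dt=-\int_{\mathbb T^3}v_0\cdot\phi(0,x)\,dx,$$ $$\int_0^T\!\!\int_{\mathbb T^3}\Big[b\cdot\partial_t\phi+\sum_{i,j}\partial_j\phi_i\,(v_jb_i-b_jv_i)\Big]dx\,dt=-\int_{\mathbb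 T^3}b_0\cdot\phi(0,x)\,dx.$$ *)

theory Defs
  imports "HOL-Analysis.Analysis"
begin

text \<open>
  Functions on the torus \<open>\<real>\<^sup>3 / \<int>\<^sup>3\<close> are functions on \<open>\<real>\<^sup>3\<close> that are \<open>\<int>\<^sup>3\<close>-periodic; integrals and
  null sets on the torus are taken over the unit cell.
\<close>

definition torus_periodic :: "(real^3 \<Rightarrow> 'b) \<Rightarrow> bool" where
  "torus_periodic f \<longleftrightarrow> (\<forall>x k. (\<forall>i. k $ i \<in> \<int>) \<longrightarrow> f (x + k) = f x)"

definition torus_cell :: "(real^3) set" where
  "torus_cell = {x. \<forall>i. 0 \<le> x $ i \<and> x $ i < 1}"

text \<open>
  Derivatives are taken within \<open>S\<close>, hence one-sided at boundary points in \<open>S\<close>. This is meant for sets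
  in which they are unique, here the whole space and \<open>[0,T) \<times> \<real>\<^sup>3\<close>.
\<close>

fun Ck_on :: "nat \<Rightarrow> 'a::euclidean_space set \<Rightarrow> ('a \<Rightarrow> 'b::real_normed_vector) \<Rightarrow> bool" where
  "Ck_on 0 S f \<longleftrightarrow> continuous_on S f"
| "Ck_on (Suc n) S f \<longleftrightarrow> f differentiable_on S \<and>
     (\<forall>h. Ck_on n S (\<lambda>x. frechet_derivative f (at x within S) h))"

definition smooth_on :: "'a::euclidean_space set \<Rightarrow> ('a \<Rightarrow> 'b::real_normed_vector) \<Rightarrow> bool" where
  "smooth_on S f \<longleftrightarrow> (\<forall>n. Ck_on n S f)"

definition partial :: "3 \<Rightarrow> (real^3 \<Rightarrow> 'b::real_normed_vector) \<Rightarrow> real^3 \<Rightarrow> 'b" where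
  "partial j f x = frechet_derivative f (at x) (axis j 1)"

definition divergence :: "(real^3 \<Rightarrow> real^3) \<Rightarrow> real^3 \<Rightarrow> real" where
  "divergence f x = (\<Sum>j\<in>UNIV. partial j f x $ j)"

definition torus_smooth :: "(real^3 \<Rightarrow> 'b::real_normed_vector) \<Rightarrow> bool" where
  "torus_smooth f \<longleftrightarrow> torus_periodic f \<and> smooth_on UNIV f"

definition mean_free :: "(real^3 \<Rightarrow> real^3) \<Rightarrow> bool" where
  "mean_free f \<longleftrightarrow> integral\<^sup>L (lebesgue_on torus_cell) f = 0"

definition weakly_div_free :: "(real^3 \<Rightarrow> real^3) \<Rightarrow> bool" where
  "weakly_div_free f \<longleftrightarrow> (\<forall>\<psi> :: real^3 \<Rightarrow> real. torus_smooth \<psi> \<longrightarrow>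
     integral\<^sup>L (lebesgue_on torus_cell) (\<lambda>x. \<Sum>j\<in>UNIV. f x $ j * partial j \<psi> x) = 0)"

abbreviation spacetime :: "real \<Rightarrow> (real \<times> (real^3)) measure" where
  "spacetime T \<equiv> lebesgue_on ({0..T} \<times> torus_cell)"

definition L2_spacetime :: "real \<Rightarrow> (real \<Rightarrow> real^3 \<Rightarrow> real^3) \<Rightarrow> bool" where
  "L2_spacetime T f \<longleftrightarrow> (\<forall>t\<in>{0..T}. torus_periodic (f t)) \<and>
     (\<lambda>(t, x). f t x) \<in> borel_measurable (spacetime T) \<and>
     integrable (spacetime T) (\<lambda>(t, x). (norm (f t x))\<^sup>2)"

text \<open>
  Divergence-free elements of \<open>C\<^sub>0\<^sup>\<infinity>([0,T) \<times> \<real>\<^sup>3 / \<int>\<^sup>3)\<close>: the support is compact in \<open>[0,T) \<times> \<real>\<^sup>3 / \<int>\<^sup>3\<close>,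
  so \<open>\<phi>\<close> vanishes near \<open>t = T\<close> but not necessarily at \<open>t = 0\<close>.
\<close>

definition mhd_test_function :: "real \<Rightarrow> (real \<Rightarrow> real^3 \<Rightarrow> real^3) \<Rightarrow> bool" where
  "mhd_test_function T \<phi> \<longleftrightarrow>
     (\<forall>t\<in>{0..<T}. torus_periodic (\<phi> t)) \<and>
     smooth_on ({0..<T} \<times> UNIV) (\<lambda>(t, x). \<phi> t x) \<and>
     (\<exists>T'<T. \<forall>t\<in>{0..<T}. T' \<le> t \<longrightarrow> (\<forall>x. \<phi> t x = 0)) \<and>
     (\<forall>t\<in>{0..<T}. \<forall>x. divergence (\<phi> t) x = 0)"

definition time_deriv :: "real \<Rightarrow> (real \<Rightarrow> real^3 \<Rightarrow> real^3) \<Rightarrow> real \<Rightarrow> real^3 \<Rightarrow> real^3" where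
  "time_deriv T \<phi> t x = vector_derivative (\<lambda>s. \<phi> s x) (at t within {0..<T})"

definition mhd_weak_solution ::
  "real \<Rightarrow> (real^3 \<Rightarrow> real^3) \<Rightarrow> (real^3 \<Rightarrow> real^3) \<Rightarrow>
   (real \<Rightarrow> real^3 \<Rightarrow> real^3) \<Rightarrow> (real \<Rightarrow> real^3 \<Rightarrow> real^3) \<Rightarrow> bool" where
  "mhd_weak_solution T v0 b0 v b \<longleftrightarrow>
     L2_spacetime T v \<and> L2_spacetime T b \<and>
     (AE t in lebesgue_on {0..T}. weakly_div_free (v t) \<and> weakly_div_free (b t)) \<and>
     (\<forall>\<phi>. mhd_test_function T \<phi> \<longrightarrow>
        integral\<^sup>L (spacetime T)
          (\<lambda>(t, x). v t x \<bullet> time_deriv T \<phi> t x +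
             (\<Sum>i\<in>UNIV. \<Sum>j\<in>UNIV. partial j (\<phi> t) x $ i *
                (v t x $ j * v t x $ i - b t x $ j * b t x $ i)))
          = - integral\<^sup>L (lebesgue_on torus_cell) (\<lambda>x. v0 x \<bullet> \<phi> 0 x) \<and>
        integral\<^sup>L (spacetime T)
          (\<lambda>(t, x). b t x \<bullet> time_deriv T \<phi> t x +
             (\<Sum>i\<in>UNIV. \<Sum>j\<in>UNIV. partial j (\<phi> t) x $ i *
                (v t x $ j * b t x $ i - b t x $ j * v t x $ i)))
          = - integral\<^sup>L (lebesgue_on torus_cell) (\<lambda>x. b0 x \<bullet> \<phi> 0 x))"

text \<open>
  For a periodic function the Hoelder seminorm over \<open>\<real>\<^sup>3\<close> coincides with the one for the quotient
  distance on the torus, as that distance is attained by suitable lifts.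
\<close>

definition torus_holder :: "real \<Rightarrow> (real^3 \<Rightarrow> real^3) set" where
  "torus_holder \<alpha> = {f. torus_periodic f \<and> bounded (range f) \<and>
     (\<exists>C. \<forall>x y. norm (f x - f y) \<le> C * dist x y powr \<alpha>)}"

definition holder_norm :: "real \<Rightarrow> (real^3 \<Rightarrow> real^3) \<Rightarrow> real" where
  "holder_norm \<alpha> f = (SUP x. norm (f x)) +
     (SUP (x, y) \<in> {(x, y). x \<noteq> y}. norm (f x - f y) / dist x y powr \<alpha>)"

text \<open>
  The Bochner space \<open>L\<^sup>1([0,T]; C\<^sup>\<alpha>)\<close>: strong measurability, that is a.e. approximation in the Hoelder
  norm by simple functions with values in \<open>C\<^sup>\<alpha>\<close>, and integrability of the norm. (The library's
  Bochner integral is for second-countable spaces, and \<open>C\<^sup>\<alpha>\<close> is not separable.)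
\<close>

definition L1_holder :: "real \<Rightarrow> real \<Rightarrow> (real \<Rightarrow> real^3 \<Rightarrow> real^3) \<Rightarrow> bool" where
  "L1_holder \<alpha> T f \<longleftrightarrow>
     (AE t in lebesgue_on {0..T}. f t \<in> torus_holder \<alpha>) \<and>
     (\<exists>s. (\<forall>n::nat. simple_function (lebesgue_on {0..T}) (s n) \<and>
                 (\<forall>t\<in>{0..T}. s n t \<in> torus_holder \<alpha>)) \<and>
          (AE t in lebesgue_on {0..T}.
             (\<lambda>n. holder_norm \<alpha> (\<lambda>x. f t x - s n t x)) \<longlonglongrightarrow> 0)) \<and>
     integrable (lebesgue_on {0..T}) (\<lambda>t. holder_norm \<alpha> (f t))"

text \<open>
  Equality a.e. on \<open>[0,T] \<times> \<real>\<^sup>3 / \<int>\<^sup>3\<close>: solutions are elements of \<open>L\<^sup>2\<close>, so they are counted modulo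
  this relation.
\<close>

definition ae_equal ::
  "real \<Rightarrow> (((real \<Rightarrow> real^3 \<Rightarrow> real^3) \<times> (real \<Rightarrow> real^3 \<Rightarrow> real^3)) \<times>
            ((real \<Rightarrow> real^3 \<Rightarrow> real^3) \<times> (real \<Rightarrow> real^3 \<Rightarrow> real^3))) set" where
  "ae_equal T = {((v, b), (v', b')).
     AE (t, x) in spacetime T. v t x = v' t x \<and> b t x = b' t x}"

lemma equiv_ae_equal: "equiv UNIV (ae_equal T)"
proof (rule equivI)
  show "ae_equal T \<subseteq> UNIV \<times> UNIV" by simp
  show "refl_on UNIV (ae_equal T)" by (auto simp: refl_on_def ae_equal_def)
  show "sym (ae_equal T)"
    by (rule symI) (auto simp: ae_equal_def elim!: eventually_mono)
  show "trans (ae_equal T)"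
  proof (rule transI)
    fix p q r
    assume "(p, q) \<in> ae_equal T" and "(q, r) \<in> ae_equal T"
    then show "(p, r) \<in> ae_equal T"
      unfolding ae_equal_def by (cases p; cases q; cases r) (auto elim: eventually_elim2)
  qed
qed

end

theory Submission
  imports Defs
begin

text \<open>
  A smooth field with data zero can be deformed, by ever faster oscillations, into weak solutions of the
  ideal MHD system; since the deformation is small in \<open>L\<^sup>1\<close>, different fields give different solutions.
  This is convex integration with intermittency in time, carried out with plane waves only.

  In the Elsasser variables \<open>X = v + b\<close> and \<open>Y = v - b\<close> the system reads
  \<open>X' + Y \<bullet> \<nabla>X + \<nabla>p = 0\<close>, \<open>Y' + X \<bullet> \<nabla>Y + \<nabla>p = 0\<close>: each field is transported by the other and
  does not interact with itself. All fields are finite sums of plane waves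
  \<open>f(t) cos (2\<pi> k \<bullet> x + p) c\<close> with \<open>c \<bottom> k\<close>, and an approximate solution solves the system up to error
  forces of the same form (\<open>approx_solution\<close>). To remove one wave \<open>f(t) cos (2\<pi> k \<bullet> x + p) c\<close> of the error
  in the first equation, take \<open>q = n (k \<times> c)\<close> with \<open>n\<close> large and add to \<open>X\<close> a wave along \<open>c\<close> of frequency
  \<open>q\<close>, to \<open>Y\<close> a wave of frequency \<open>k + q\<close> along the component \<open>d\<close> of \<open>k\<close> orthogonal to \<open>k + q\<close>. The
  product of these two waves has a slow part, which is a multiple of the wave to be removed, and a part of
  frequency \<open>k + 2q\<close>; in the second equation they do not interact at all, since \<open>c \<bottom> k + q\<close>
  (\<open>cancel_one_mode\<close>).

  The amplitudes of the two waves are trains of short pulses whose product has the right mean on short time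
  intervals (\<open>pulse_factorization\<close>). Pulses of length \<open>\<mu>\<^sup>-\<^sup>2\<close> and height \<open>\<mu>\<close> have an \<open>L\<^sup>2\<close> norm controlled by
  the error, but an \<open>L\<^sup>1\<close> norm of order \<open>1/\<mu>\<close>. So the interaction with everything slow is negligible, the
  norm in \<open>L\<^sup>1 C\<^sup>\<alpha>\<close> is of order \<open>n\<^sup>\<alpha> / \<mu>\<close>, and the time derivative contributes \<open>\<mu> / n\<close> to the new error,
  measured with one spatial derivative less. For \<open>\<alpha> < 1\<close> both tend to zero if \<open>\<mu>\<close> is the power
  \<open>(1 + \<alpha>) / 2\<close> of \<open>n\<close>; at \<open>\<alpha> = 1\<close> they cannot.

  Removing the waves of the error one after the other, and repeating, gives a sequence whose errors tend to
  zero and whose increments are summable in \<open>L\<^sup>1 C\<^sup>\<alpha>\<close> and, with weights, in \<open>L\<^sup>2\<close>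
  (\<open>approximating_sequence\<close>). Its limit is a weak solution with data zero (\<open>weak_limit\<close>) that is as close
  as desired in \<open>L\<^sup>1\<close> to the field from which the sequence starts. Starting from
  \<open>X = m t cos (2\<pi> x\<^sub>2) e\<^sub>1\<close> and \<open>Y = 0\<close> for \<open>m = 0, 1, 2, \<dots>\<close> gives infinitely many of them.
\<close>

section \<open>Integer wave vectors\<close>

definition integer_vec :: "real^3 \<Rightarrow> bool" where
  "integer_vec k \<longleftrightarrow> (\<forall>i. k $ i \<in> \<int>)"

lemma integer_vec_add [intro]: "integer_vec k \<Longrightarrow> integer_vec l \<Longrightarrow> integer_vec (k + l)"
  and integer_vec_diff [intro]: "integer_vec k \<Longrightarrow> integer_vec l \<Longrightarrow> integer_vec (k - l)"
  and integer_vec_scale [intro]: "a \<in> \<int> \<Longrightarrow> integer_vec k \<Longrightarrow> integer_vec (a *\<^sub>R k)"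
  and integer_vec_cross [intro]: "integer_vec k \<Longrightarrow> integer_vec l \<Longrightarrow> integer_vec (cross3 k l)"
  and integer_vec_axis [simp, intro]: "integer_vec (axis i 1)"
  by (auto simp: integer_vec_def cross3_def axis_def forall_3)

lemma inner_integer_vec [intro]: "integer_vec k \<Longrightarrow> integer_vec l \<Longrightarrow> k \<bullet> l \<in> \<int>"
  by (auto simp: integer_vec_def inner_vec_def sum_3)

lemma norm_integer_vec_ge_1:
  assumes "integer_vec k" "k \<noteq> 0"
  shows "1 \<le> norm k"
proof -
  obtain i where i: "k $ i \<noteq> 0"
    using assms(2) by (auto simp: vec_eq_iff)
  have "k $ i \<in> \<int>" using assms by (auto simp: integer_vec_def)
  then have "1 \<le> \<bar>k $ i\<bar>" using i by (meson Ints_nonzero_abs_ge1)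
  also have "\<dots> \<le> norm k" by (rule component_le_norm_cart)
  finally show ?thesis .
qed

lemma integer_orthogonal_basis:
  assumes "integer_vec k" "k \<noteq> 0"
  obtains c c' where "integer_vec c" "integer_vec c'" "c \<noteq> 0" "c' \<noteq> 0"
    "c \<bullet> k = 0" "c' \<bullet> k = 0"
    "\<And>v w. w \<bullet> k = 0 \<Longrightarrow>
       v \<bullet> w = (v \<bullet> c / (c \<bullet> c)) * (c \<bullet> w) + (v \<bullet> c' / (c' \<bullet> c')) * (c' \<bullet> w)"
proof -
  (* Rotate the horizontal part of k by a right angle; any horizontal vector serves if that part is zero. *)
  define c :: "real^3" where
    "c = (if k$1 = 0 \<and> k$2 = 0 then axis 1 1 else (\<chi> i. if i = 1 then - k$2 else if i = 2 then k$1 else 0))"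
  define c' where "c' = cross3 k c"
  have ic: "integer_vec c"
    using assms by (auto simp: integer_vec_def c_def axis_def)
  have c0: "c \<noteq> 0"
    using assms by (auto simp: c_def vec_eq_iff forall_3 axis_def split: if_splits)
  have ck: "c \<bullet> k = 0"
    by (auto simp: c_def inner_vec_def sum_3 axis_def)
  have c'k: "c' \<bullet> k = 0" "c' \<bullet> c = 0" by (auto simp: c'_def dot_cross_self)
  have "(norm c')\<^sup>2 = (norm k * norm c)\<^sup>2"
    using norm_cross_dot[of k c] ck by (simp add: c'_def inner_commute)
  then have c'0: "c' \<noteq> 0" using c0 assms by auto
  have ex: "v \<bullet> w = (v \<bullet> c / (c \<bullet> c)) * (c \<bullet> w) + (v \<bullet> c' / (c' \<bullet> c')) * (c' \<bullet> w)"
    if "w \<bullet> k = 0" for v w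
  proof -
    define u where "u = w - (c \<bullet> w / (c \<bullet> c)) *\<^sub>R c - (c' \<bullet> w / (c' \<bullet> c')) *\<^sub>R c'"
    have uk: "u \<bullet> k = 0" "u \<bullet> c = 0" "u \<bullet> c' = 0"
      using that ck c'k c0 c'0
      by (auto simp: u_def inner_diff_left inner_commute[of w] inner_commute[of c c'])
    have "u = 0"
    proof (rule ccontr)
      assume u0: "u \<noteq> 0"
      have ne: "u \<noteq> k" "u \<noteq> c" "u \<noteq> c'" "k \<noteq> c" "k \<noteq> c'" "c \<noteq> c'"
        using uk ck c'k u0 c0 c'0 assms by (auto simp: inner_commute)
      have "pairwise orthogonal {u, k, c, c'}"
        using uk ck c'k by (auto simp: pairwise_def orthogonal_def inner_commute)
      moreover have "0 \<notin> {u, k, c, c'}" using u0 c0 c'0 assms by auto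
      ultimately have "independent {u, k, c, c'}" by (rule pairwise_orthogonal_independent)
      then have "card {u, k, c, c'} \<le> DIM(real^3)" using independent_bound by blast
      moreover have "card {u, k, c, c'} = 4" using ne by simp
      ultimately show False by simp
    qed
    then have "w = (c \<bullet> w / (c \<bullet> c)) *\<^sub>R c + (c' \<bullet> w / (c' \<bullet> c')) *\<^sub>R c'"
      by (simp add: u_def algebra_simps)
    then have "v \<bullet> w = v \<bullet> ((c \<bullet> w / (c \<bullet> c)) *\<^sub>R c + (c' \<bullet> w / (c' \<bullet> c')) *\<^sub>R c')" by simp
    then show ?thesis by (simp add: inner_add_right mult.commute)
  qed
  show thesis
    by (rule that[OF ic _ c0 c'0 ck c'k(1) ex]) (use ic assms in \<open>auto simp: c'_def\<close>)
qed

section \<open>Plane waves and their sizes\<close>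

text \<open>
  The wave \<open>amp t * cos (2\<pi> (freq \<bullet> x) + phase)\<close> along \<open>dir\<close>. Fields are lists of waves, without any
  normal form: the sizes below depend on the list and only bound the norms of the field.
\<close>

datatype mode = Mode (amp: "real \<Rightarrow> real") (dir: "real^3") (freq: "real^3") (phase: real)

definition size_at :: "mode list \<Rightarrow> real \<Rightarrow> real" where
  "size_at X t = (\<Sum>m\<leftarrow>X. \<bar>amp m t\<bar> * norm (dir m))"

text \<open>
  A wave of frequency \<open>k\<close> is the divergence of a tensor wave that is smaller by the factor \<open>2\<pi> |k|\<close>. So
  this is, up to that constant, a bound for the tensor whose divergence is the force \<open>X\<close>, and it is the norm
  in which errors are small.
\<close>

definition stress_at :: "mode list \<Rightarrow> real \<Rightarrow> real" where
  "stress_at X t = (\<Sum>m\<leftarrow>X. \<bar>amp m t\<bar> * norm (dir m) / norm (freq m))"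

text \<open>
  Majorant of the full norm of \<open>C\<^sup>\<alpha>\<close>: the summand 1 accounts for the supremum, the rest for the seminorm
  (see \<open>wave_holder\<close>).
\<close>

definition holder_at :: "real \<Rightarrow> mode list \<Rightarrow> real \<Rightarrow> real" where
  "holder_at \<alpha> X t = (\<Sum>m\<leftarrow>X. \<bar>amp m t\<bar> * norm (dir m) * (1 + 2 * (2 * pi * norm (freq m)) powr \<alpha>))"

lemma size_at_simps [simp]:
  "size_at [] t = 0" "size_at (m # X) t = \<bar>amp m t\<bar> * norm (dir m) + size_at X t"
  "size_at (X @ Y) t = size_at X t + size_at Y t"
  by (auto simp: size_at_def)

lemma stress_at_simps [simp]:
  "stress_at [] t = 0"
  "stress_at (m # X) t = \<bar>amp m t\<bar> * norm (dir m) / norm (freq m) + stress_at X t"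
  "stress_at (X @ Y) t = stress_at X t + stress_at Y t"
  by (auto simp: stress_at_def)

lemma holder_at_simps [simp]:
  "holder_at \<alpha> [] t = 0"
  "holder_at \<alpha> (m # X) t =
     \<bar>amp m t\<bar> * norm (dir m) * (1 + 2 * (2 * pi * norm (freq m)) powr \<alpha>) + holder_at \<alpha> X t"
  "holder_at \<alpha> (X @ Y) t = holder_at \<alpha> X t + holder_at \<alpha> Y t"
  by (auto simp: holder_at_def)

lemma size_at_nonneg [simp]: "0 \<le> size_at X t"
  and stress_at_nonneg [simp]: "0 \<le> stress_at X t"
  and holder_at_nonneg [simp]: "0 \<le> holder_at \<alpha> X t"
  by (induction X) auto

lemma size_le_holder: "size_at X t \<le> holder_at \<alpha> X t"
proof (induction X)
  case (Cons m X)
  have "\<bar>amp m t\<bar> * norm (dir m) * 1 \<le>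
      \<bar>amp m t\<bar> * norm (dir m) * (1 + 2 * (2 * pi * norm (freq m)) powr \<alpha>)"
    by (intro mult_left_mono) auto
  then show ?case using Cons by simp
qed simp

definition C1 :: "(real \<Rightarrow> real) \<Rightarrow> bool" where
  "C1 f \<longleftrightarrow> (\<forall>t. f differentiable (at t)) \<and> continuous_on UNIV (deriv f)"

lemma C1_I:
  assumes "\<And>t. (f has_real_derivative f' t) (at t)" "continuous_on UNIV f'"
  shows "C1 f" "deriv f = f'"
proof -
  show d: "deriv f = f'" using assms(1) by (auto intro!: ext DERIV_imp_deriv)
  show "C1 f" using assms unfolding C1_def d by (auto simp: real_differentiable_def)
qed

lemma C1_deriv: "C1 f \<Longrightarrow> (f has_real_derivative deriv f t) (at t)"
  by (simp add: C1_def DERIV_deriv_iff_real_differentiable)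

lemma C1_continuous: "C1 f \<Longrightarrow> continuous_on A f"
  by (meson C1_deriv DERIV_isCont continuous_at_imp_continuous_on)

lemma C1_cmult: "C1 f \<Longrightarrow> C1 (\<lambda>t. c * f t)" "C1 f \<Longrightarrow> deriv (\<lambda>t. c * f t) t = c * deriv f t"
proof -
  assume f: "C1 f"
  have 1: "((\<lambda>t. c * f t) has_real_derivative c * deriv f t) (at t)" for t
    using C1_deriv[OF f] by (rule DERIV_cmult)
  have 2: "continuous_on UNIV (\<lambda>t. c * deriv f t)"
    using f unfolding C1_def by (intro continuous_intros) auto
  show "C1 (\<lambda>t. c * f t)" by (rule C1_I[OF 1 2])
  show "deriv (\<lambda>t. c * f t) t = c * deriv f t" using C1_I(2)[OF 1 2] by metis
qed

text \<open>
  The condition at time 0 keeps the initial data equal to zero throughout the construction.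
\<close>

definition velocity_modes :: "mode list \<Rightarrow> bool" where
  "velocity_modes X \<longleftrightarrow> (\<forall>m\<in>set X. C1 (amp m) \<and> amp m 0 = 0 \<and> integer_vec (freq m) \<and> dir m \<bullet> freq m = 0)"

text \<open>
  The directions of the error waves are integer vectors, because a carrier frequency orthogonal to both the
  frequency and the direction is needed on the torus, and the cross product then provides one.
\<close>

definition error_modes :: "mode list \<Rightarrow> bool" where
  "error_modes X \<longleftrightarrow> (\<forall>m\<in>set X. continuous_on UNIV (amp m) \<and> integer_vec (freq m) \<and> freq m \<noteq> 0
     \<and> integer_vec (dir m) \<and> dir m \<noteq> 0 \<and> dir m \<bullet> freq m = 0)"

lemma velocity_modes_append [simp]: "velocity_modes (X @ Y) \<longleftrightarrow> velocity_modes X \<and> velocity_modes Y"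
  and velocity_modes_Nil [simp]: "velocity_modes []"
  and velocity_modes_Cons: "velocity_modes (m # X) \<longleftrightarrow> C1 (amp m) \<and> amp m 0 = 0 \<and> integer_vec (freq m)
     \<and> dir m \<bullet> freq m = 0 \<and> velocity_modes X"
  by (auto simp: velocity_modes_def)

lemma error_modes_append [simp]: "error_modes (X @ Y) \<longleftrightarrow> error_modes X \<and> error_modes Y"
  and error_modes_Nil [simp]: "error_modes []"
  and error_modes_Cons: "error_modes (m # X) \<longleftrightarrow> continuous_on UNIV (amp m) \<and> integer_vec (freq m) \<and> freq m \<noteq> 0
     \<and> integer_vec (dir m) \<and> dir m \<noteq> 0 \<and> dir m \<bullet> freq m = 0 \<and> error_modes X"
  by (auto simp: error_modes_def)

definition continuous_modes :: "mode list \<Rightarrow> bool" where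
  "continuous_modes X \<longleftrightarrow> (\<forall>m\<in>set X. continuous_on UNIV (amp m))"

lemma velocity_modes_continuous: "velocity_modes X \<Longrightarrow> continuous_modes X"
  by (auto simp: velocity_modes_def continuous_modes_def C1_continuous)

lemma error_modes_continuous: "error_modes X \<Longrightarrow> continuous_modes X"
  by (auto simp: error_modes_def continuous_modes_def)

lemma continuous_sum_list:
  fixes f :: "'a \<Rightarrow> real \<Rightarrow> real"
  shows "(\<And>m. m \<in> set X \<Longrightarrow> continuous_on A (f m)) \<Longrightarrow> continuous_on A (\<lambda>t. \<Sum>m\<leftarrow>X. f m t)"
  by (induction X) (auto intro!: continuous_intros)

lemma continuous_on_sizes [continuous_intros]:
  assumes "continuous_modes X"
  shows "continuous_on A (size_at X)" "continuous_on A (stress_at X)" "continuous_on A (holder_at \<alpha> X)"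
  unfolding size_at_def stress_at_def holder_at_def divide_inverse
  using assms by (auto intro!: continuous_sum_list continuous_intros
      simp: continuous_modes_def intro: continuous_on_subset)

section \<open>Testing against divergence-free fields\<close>

text \<open>
  \<open>\<Phi> k p\<close> stands for the integral of a divergence-free test field against \<open>cos (2\<pi> (k \<bullet> x) + p)\<close>, which is
  orthogonal to \<open>k\<close>. Two forces with equal pairings for all solenoidal \<open>\<Phi>\<close> differ by a gradient, so this is
  how the pressure is eliminated.
\<close>

definition solenoidal :: "(real^3 \<Rightarrow> real \<Rightarrow> real^3) \<Rightarrow> bool" where
  "solenoidal \<Phi> \<longleftrightarrow> (\<forall>k p. integer_vec k \<longrightarrow> \<Phi> k p \<bullet> k = 0)"

definition pairing :: "(real^3 \<Rightarrow> real \<Rightarrow> real^3) \<Rightarrow> mode list \<Rightarrow> real \<Rightarrow> real" where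
  "pairing \<Phi> X t = (\<Sum>m\<leftarrow>X. amp m t * (dir m \<bullet> \<Phi> (freq m) (phase m)))"

lemma pairing_simps [simp]:
  "pairing \<Phi> [] t = 0"
  "pairing \<Phi> (m # X) t = amp m t * (dir m \<bullet> \<Phi> (freq m) (phase m)) + pairing \<Phi> X t"
  "pairing \<Phi> (X @ Y) t = pairing \<Phi> X t + pairing \<Phi> Y t"
  by (auto simp: pairing_def)

definition dt :: "mode list \<Rightarrow> mode list" where
  "dt X = map (\<lambda>m. Mode (deriv (amp m)) (dir m) (freq m) (phase m)) X"

lemma dt_simps [simp]:
  "dt [] = []" "dt (m # X) = Mode (deriv (amp m)) (dir m) (freq m) (phase m) # dt X"
  "dt (X @ Y) = dt X @ dt Y"
  by (auto simp: dt_def)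

text \<open>
  The term \<open>u \<bullet> \<nabla>w\<close> for two waves \<open>u\<close> and \<open>w\<close>, by the product formula for cosine and sine; the phase
  \<open>- \<pi>/2\<close> turns a cosine into a sine.
\<close>

definition advect1 :: "mode \<Rightarrow> mode \<Rightarrow> mode list" where
  "advect1 m m' =
    [Mode (\<lambda>t. - pi * (dir m \<bullet> freq m') * amp m t * amp m' t) (dir m')
       (freq m + freq m') (phase m + phase m' - pi/2),
     Mode (\<lambda>t. pi * (dir m \<bullet> freq m') * amp m t * amp m' t) (dir m')
       (freq m - freq m') (phase m - phase m' - pi/2)]"

definition advect :: "mode list \<Rightarrow> mode list \<Rightarrow> mode list" where
  "advect X Y = concat (map (\<lambda>m. concat (map (advect1 m) Y)) X)"

lemma advect_simps [simp]:
  "advect [] Y = []" "advect X [] = []"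
  "advect (m # X) Y = concat (map (advect1 m) Y) @ advect X Y"
  "advect (X @ X') Y = advect X Y @ advect X' Y"
  by (auto simp: advect_def)

lemma pairing_advect_append:
  "pairing \<Phi> (advect X (Y @ Y')) t = pairing \<Phi> (advect X Y) t + pairing \<Phi> (advect X Y') t"
  by (induction X) auto

text \<open>
  As \<open>u\<close> is transversal to its own frequency \<open>k\<close>, its component along \<open>l\<close> is, up to sign, its component
  along \<open>k + l\<close> or \<open>k - l\<close>. This makes up for the derivative in \<open>u \<bullet> \<nabla>w\<close>.
\<close>

lemma stress_advect1:
  assumes "dir m \<bullet> freq m = 0"
  shows "stress_at (advect1 m m') t \<le> 2 * pi * (\<bar>amp m t\<bar> * norm (dir m)) * (\<bar>amp m' t\<bar> * norm (dir m'))"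
proof -
  define B where "B = pi * (\<bar>amp m t\<bar> * norm (dir m)) * (\<bar>amp m' t\<bar> * norm (dir m'))"
  have B: "B \<ge> 0" by (auto simp: B_def)
  have *: "pi * \<bar>dir m \<bullet> freq m'\<bar> * \<bar>amp m t\<bar> * \<bar>amp m' t\<bar> * norm (dir m') / norm q \<le> B"
    if "\<bar>dir m \<bullet> freq m'\<bar> = \<bar>dir m \<bullet> q\<bar>" for q
  proof (cases "q = 0")
    case True then show ?thesis using B by simp
  next
    case False
    have "\<bar>dir m \<bullet> q\<bar> / norm q \<le> norm (dir m)"
      using Cauchy_Schwarz_ineq2[of "dir m" q] False by (simp add: field_simps)
    then have "pi * \<bar>amp m t\<bar> * \<bar>amp m' t\<bar> * norm (dir m') * (\<bar>dir m \<bullet> q\<bar> / norm q)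
      \<le> pi * \<bar>amp m t\<bar> * \<bar>amp m' t\<bar> * norm (dir m') * norm (dir m)"
      by (intro mult_left_mono) auto
    then show ?thesis by (simp add: that B_def mult_ac)
  qed
  have "stress_at (advect1 m m') t \<le> B + B"
    using *[of "freq m + freq m'"] *[of "freq m - freq m'"] assms
    by (auto simp: advect1_def abs_mult inner_add_right inner_diff_right intro!: add_mono)
  then show ?thesis unfolding B_def by linarith
qed

lemma stress_advect:
  assumes "velocity_modes X"
  shows "stress_at (advect X Y) t \<le> 2 * pi * size_at X t * size_at Y t"
  using assms
proof (induction X)
  case (Cons m X)
  have "stress_at (concat (map (advect1 m) Y)) t \<le> 2 * pi * (\<bar>amp m t\<bar> * norm (dir m)) * size_at Y t"
  proof (induction Y)
    case (Cons m' Y)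
    have "stress_at (advect1 m m') t
        \<le> 2 * pi * (\<bar>amp m t\<bar> * norm (dir m)) * (\<bar>amp m' t\<bar> * norm (dir m'))"
      using Cons.prems \<open>velocity_modes (m # X)\<close> by (intro stress_advect1) (auto simp: velocity_modes_Cons)
    then show ?case using Cons by (auto simp: algebra_simps)
  qed simp
  moreover have "stress_at (advect X Y) t \<le> 2 * pi * size_at X t * size_at Y t"
    using Cons by (auto simp: velocity_modes_Cons)
  ultimately show ?case by (auto simp: algebra_simps)
qed simp

text \<open>
  A constant force would change the mean, and no tensor has it as its divergence; it must not occur.
\<close>

definition force_modes :: "mode list \<Rightarrow> bool" where
  "force_modes X \<longleftrightarrow> (\<forall>m\<in>set X. continuous_on UNIV (amp m) \<and> integer_vec (freq m) \<and>
      (freq m = 0 \<longrightarrow> (\<forall>t. amp m t = 0 \<or> dir m = 0)))"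

lemma force_modes_simps [simp]: "force_modes (X @ Y) \<longleftrightarrow> force_modes X \<and> force_modes Y"
  "force_modes []"
  "force_modes (m # X) \<longleftrightarrow> continuous_on UNIV (amp m) \<and> integer_vec (freq m) \<and>
      (freq m = 0 \<longrightarrow> (\<forall>t. amp m t = 0 \<or> dir m = 0)) \<and> force_modes X"
  by (auto simp: force_modes_def)

lemma force_modes_advect:
  assumes "velocity_modes X" "velocity_modes Y"
  shows "force_modes (advect X Y)"
proof -
  have "force_modes (advect1 m m')" if "m \<in> set X" "m' \<in> set Y" for m m'
  proof -
    have v: "C1 (amp m)" "C1 (amp m')" "integer_vec (freq m)" "integer_vec (freq m')" "dir m \<bullet> freq m = 0"
      using assms that by (auto simp: velocity_modes_def)
    have "dir m \<bullet> freq m' = 0" if "freq m + freq m' = 0 \<or> freq m - freq m' = 0"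
    proof -
      have "freq m' = freq m \<or> freq m' = - freq m" using that by (auto simp: add_eq_0_iff)
      then show ?thesis using v by auto
    qed
    then show ?thesis using v C1_continuous
      by (auto simp: advect1_def intro!: continuous_intros)
  qed
  then show ?thesis unfolding force_modes_def advect_def by fastforce
qed

text \<open>
  The component of a force along its frequency is a gradient and may be dropped; the other two components
  are taken with respect to an integer basis.
\<close>

lemma resolve_force:
  assumes "force_modes X"
  shows "\<exists>E. error_modes E \<and> (\<forall>\<Phi> t. solenoidal \<Phi> \<longrightarrow> pairing \<Phi> E t = pairing \<Phi> X t) \<and>
    (\<forall>t. stress_at E t \<le> 2 * stress_at X t)"
  using assms
proof (induction X)
  case Nil then show ?case by (intro exI[of _ "[]"]) auto
next
  case (Cons m X)
  then obtain E where E: "error_modes E" "\<And>\<Phi> t. solenoidal \<Phi> \<Longrightarrow> pairing \<Phi> E t = pairing \<Phi> X t"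
    "\<And>t. stress_at E t \<le> 2 * stress_at X t" by auto
  show ?case
  proof (cases "freq m = 0")
    case True
    then have "\<forall>t. amp m t = 0 \<or> dir m = 0" using Cons.prems by auto
    then have "amp m t * (dir m \<bullet> u) = 0" for t u by (metis inner_zero_left mult_zero_left mult_zero_right)
    then show ?thesis using True E by (intro exI[of _ E]) (auto simp: solenoidal_def)
  next
    case False
    have m: "integer_vec (freq m)" "continuous_on UNIV (amp m)" using Cons.prems by auto
    obtain c c' where c: "integer_vec c" "integer_vec c'" "c \<noteq> 0" "c' \<noteq> 0"
        "c \<bullet> freq m = 0" "c' \<bullet> freq m = 0"
      and ex: "\<And>v w. w \<bullet> freq m = 0 \<Longrightarrow>
       v \<bullet> w = (v \<bullet> c / (c \<bullet> c)) * (c \<bullet> w) + (v \<bullet> c' / (c' \<bullet> c')) * (c' \<bullet> w)"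
      using integer_orthogonal_basis[OF m(1) False] by metis
    define F where "F = [Mode (\<lambda>t. amp m t * (dir m \<bullet> c / (c \<bullet> c))) c (freq m) (phase m),
      Mode (\<lambda>t. amp m t * (dir m \<bullet> c' / (c' \<bullet> c'))) c' (freq m) (phase m)]"
    have "error_modes F" using c m False
      by (auto simp: F_def error_modes_Cons intro!: continuous_intros)
    moreover have "pairing \<Phi> F t = amp m t * (dir m \<bullet> \<Phi> (freq m) (phase m))" if "solenoidal \<Phi>" for \<Phi> t
      using ex[of "\<Phi> (freq m) (phase m)" "dir m"] that m(1)
      by (simp add: F_def solenoidal_def algebra_simps)
    moreover have "stress_at F t \<le> 2 * (\<bar>amp m t\<bar> * norm (dir m) / norm (freq m))" for t
    proof -
      have *: "\<bar>amp m t * (dir m \<bullet> b / (b \<bullet> b))\<bar> * norm b / norm (freq m) \<le> \<bar>amp m t\<bar> * norm (dir m) / norm (freq m)"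
        if "b \<noteq> 0" for b
      proof -
        have "\<bar>dir m \<bullet> b\<bar> * norm b \<le> norm (dir m) * (b \<bullet> b)"
          using mult_right_mono[OF Cauchy_Schwarz_ineq2[of "dir m" b], of "norm b"]
          by (simp add: dot_square_norm power2_eq_square mult_ac)
        then have "\<bar>dir m \<bullet> b / (b \<bullet> b)\<bar> * norm b \<le> norm (dir m)"
          using that by (simp add: divide_simps abs_mult)
        then have "\<bar>amp m t\<bar> * (\<bar>dir m \<bullet> b / (b \<bullet> b)\<bar> * norm b) \<le> \<bar>amp m t\<bar> * norm (dir m)"
          by (intro mult_left_mono) auto
        then show ?thesis by (intro divide_right_mono) (auto simp: abs_mult mult_ac)
      qed
      show ?thesis using *[OF c(3)] *[OF c(4)] by (simp add: F_def)
    qed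
    ultimately show ?thesis using E
      by (intro exI[of _ "F @ E"]) (simp add: add_mono distrib_left)
  qed
qed

text \<open>
  \<open>E\<close> and \<open>F\<close> are what is left, up to gradients, when \<open>X\<close> and \<open>Y\<close> are inserted into the two equations in
  Elsasser variables.
\<close>

definition approx_solution :: "mode list \<Rightarrow> mode list \<Rightarrow> mode list \<Rightarrow> mode list \<Rightarrow> bool" where
  "approx_solution X Y E F \<longleftrightarrow> velocity_modes X \<and> velocity_modes Y \<and> error_modes E \<and> error_modes F \<and>
     (\<forall>\<Phi> t. solenoidal \<Phi> \<longrightarrow> pairing \<Phi> (dt X @ advect Y X) t = pairing \<Phi> E t
                     \<and> pairing \<Phi> (dt Y @ advect X Y) t = pairing \<Phi> F t)"

lemma approx_solution_sym: "approx_solution X Y E F \<Longrightarrow> approx_solution Y X F E"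
  by (auto simp: approx_solution_def)

section \<open>Pulses concentrated in time\<close>

lemma pos_part_square_deriv: "((\<lambda>u::real. (max 0 u)\<^sup>2) has_real_derivative 2 * max 0 u) (at u)"
proof -
  consider "u > 0" | "u < 0" | "u = 0" by linarith
  then show ?thesis
  proof cases
    case 1
    have "((\<lambda>u::real. u\<^sup>2) has_real_derivative 2 * u) (at u)"
      by (auto intro!: derivative_eq_intros)
    then have "((\<lambda>u::real. (max 0 u)\<^sup>2) has_real_derivative 2 * u) (at u)"
      by (rule DERIV_cong_ev[OF refl _ refl, THEN iffD1, rotated])
         (use 1 in \<open>auto intro!: eventually_mono[OF eventually_nhds_in_open[of "{0<..}"]]\<close>)
    then show ?thesis using 1 by simp
  next
    case 2
    have "((\<lambda>u::real. 0) has_real_derivative 0) (at u)" by simp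
    then have "((\<lambda>u::real. (max 0 u)\<^sup>2) has_real_derivative 0) (at u)"
      by (rule DERIV_cong_ev[OF refl _ refl, THEN iffD1, rotated])
         (use 2 in \<open>auto intro!: eventually_mono[OF eventually_nhds_in_open[of "{..<0}"]]\<close>)
    then show ?thesis using 2 by simp
  next
    case 3
    have "(\<lambda>h::real. (max 0 h)\<^sup>2 / h) \<midarrow>0\<rightarrow> 0"
    proof (rule Lim_null_comparison[of _ "\<lambda>h. \<bar>h\<bar>"])
      show "\<forall>\<^sub>F h in at (0::real). norm ((max 0 h)\<^sup>2 / h) \<le> \<bar>h\<bar>"
        by (auto intro!: always_eventually simp: max_def power2_eq_square)
      show "((\<lambda>h::real. \<bar>h\<bar>) \<longlongrightarrow> 0) (at 0)" by (auto intro!: tendsto_eq_intros)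
    qed
    then show ?thesis using 3 by (simp add: DERIV_def)
  qed
qed

lemma bump_exists:
  obtains B B' :: "real \<Rightarrow> real" where
    "\<And>u. (B has_real_derivative B' u) (at u)" "continuous_on UNIV B'"
    "\<And>u. 1 \<le> \<bar>u\<bar> \<Longrightarrow> B u = 0 \<and> B' u = 0" "\<And>u. 0 \<le> B u" "integral {-1..1} (\<lambda>u. (B u)\<^sup>2) = 1"
proof -
  define q where "q = (\<lambda>u::real. (max 0 (1 - u\<^sup>2))\<^sup>2)"
  define q' where "q' = (\<lambda>u::real. 2 * max 0 (1 - u\<^sup>2) * (- 2 * u))"
  have q: "(q has_real_derivative q' u) (at u)" for u
    unfolding q_def q'_def
    by (rule DERIV_chain2[OF pos_part_square_deriv]) (auto intro!: derivative_eq_intros)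
  have q0: "q u = 0 \<and> q' u = 0" if "1 \<le> \<bar>u\<bar>" for u
  proof -
    have "1 \<le> u\<^sup>2" using that by (simp add: abs_le_square_iff[of 1 u, simplified])
    then show ?thesis by (simp add: q_def q'_def)
  qed
  have cq: "continuous_on A q" for A
    by (meson q DERIV_isCont continuous_at_imp_continuous_on)
  define \<beta> where "\<beta> = integral {-1..1} (\<lambda>u. (q u)\<^sup>2)"
  have "\<beta> \<noteq> 0"
  proof
    assume "\<beta> = 0"
    then have "((\<lambda>u. (q u)\<^sup>2) has_integral 0) (cbox (-1) 1)"
      unfolding \<beta>_def using integrable_integral[OF integrable_continuous_interval[of "-1" 1 "\<lambda>u. (q u)\<^sup>2"]]
      by (auto intro!: continuous_intros cq)
    then have "(q 0)\<^sup>2 = 0"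
      by (rule has_integral_0_cbox_imp_0[rotated 2]) (auto intro!: continuous_intros cq)
    then show False by (simp add: q_def)
  qed
  moreover have "\<beta> \<ge> 0" unfolding \<beta>_def
    by (rule integral_nonneg) (auto intro!: integrable_continuous_interval continuous_intros cq)
  ultimately have b: "\<beta> > 0" by simp
  show thesis
  proof (rule that[of "\<lambda>u. q u / sqrt \<beta>" "\<lambda>u. q' u / sqrt \<beta>"])
    show "((\<lambda>u. q u / sqrt \<beta>) has_real_derivative q' u / sqrt \<beta>) (at u)" for u
      by (rule DERIV_cdivide[OF q])
    show "continuous_on UNIV (\<lambda>u. q' u / sqrt \<beta>)"
      unfolding q'_def using b by (intro continuous_intros) auto
    show "integral {-1..1} (\<lambda>u. (q u / sqrt \<beta>)\<^sup>2) = 1"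
      using b by (simp add: power_divide flip: \<beta>_def)
    show "q u / sqrt \<beta> = 0 \<and> q' u / sqrt \<beta> = 0" if "1 \<le> \<bar>u\<bar>" for u
      using q0[OF that] by simp
    show "0 \<le> q u / sqrt \<beta>" for u using b by (simp add: q_def)
  qed
qed

lemma integral_rescaled_bump:
  fixes \<phi> :: "real \<Rightarrow> real"
  assumes "continuous_on UNIV \<phi>" "\<And>u. 1 \<le> \<bar>u\<bar> \<Longrightarrow> \<phi> u = 0" "0 < l"
    and "l * (u - \<tau>) \<le> -1" "1 \<le> l * (v - \<tau>)"
  shows "integral {u..v} (\<lambda>t. \<phi> (l * (t - \<tau>))) = integral {-1..1} \<phi> / l"
proof -
  have "(\<phi> has_integral integral {-1..1} \<phi>) {-1..1}"
    by (intro integrable_integral integrable_continuous_interval continuous_on_subset[OF assms(1)]) auto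
  then have "(\<phi> has_integral integral {-1..1} \<phi>) (cbox (l * (u - \<tau>)) (l * (v - \<tau>)))"
    by (rule has_integral_on_superset) (use assms in auto)
  then have "((\<lambda>t. \<phi> (l *\<^sub>R t + (- l * \<tau>))) has_integral (1 / \<bar>l\<bar>^DIM(real)) *\<^sub>R integral {-1..1} \<phi>)
     ((\<lambda>x. (1 / l) *\<^sub>R x + - ((1 / l) *\<^sub>R (- l * \<tau>))) ` cbox (l * (u - \<tau>)) (l * (v - \<tau>)))"
    using assms(3) by (intro has_integral_affinity) auto
  moreover have "(\<lambda>x. (1 / l) *\<^sub>R x + - ((1 / l) *\<^sub>R (- l * \<tau>))) ` cbox (l * (u - \<tau>)) (l * (v - \<tau>)) = {u..v}"
  proof -
    have uv: "l * (u - \<tau>) \<le> l * (v - \<tau>)" using assms by linarith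
    have "(\<lambda>x. (1 / l) *\<^sub>R x + - ((1 / l) *\<^sub>R (- l * \<tau>))) = (\<lambda>x. (1/l) * x + \<tau>)"
      using assms(3) by auto
    moreover have "(\<lambda>x. (1/l) * x + \<tau>) ` cbox (l * (u - \<tau>)) (l * (v - \<tau>)) = {u..v}"
      using image_affinity_atLeastAtMost[of "1/l" \<tau> "l * (u - \<tau>)" "l * (v - \<tau>)"] uv assms(3) by simp
    ultimately show ?thesis using assms(3) by simp
  qed
  ultimately have "((\<lambda>t. \<phi> (l * (t - \<tau>))) has_integral integral {-1..1} \<phi> / l) {u..v}"
    using assms(3) by (simp add: algebra_simps)
  then show ?thesis by (rule integral_unique)
qed

lemma integral_pieces:
  fixes g :: "real \<Rightarrow> real"
  assumes "continuous_on UNIV g" "0 < N"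
  shows "integral {0..real M / N} g = (\<Sum>m<M. integral {real m / N..real (Suc m) / N} g)"
proof (induction M)
  case (Suc M)
  have "integral {0..real M / N} g + integral {real M / N..real (Suc M) / N} g = integral {0..real (Suc M) / N} g"
    using assms by (intro Henstock_Kurzweil_Integration.integral_combine integrable_continuous_interval
        continuous_on_subset[OF assms(1)]) (auto simp: divide_right_mono)
  then show ?case using Suc by simp
qed simp

lemma integral_abs_le_continuous:
  fixes g h :: "real \<Rightarrow> real"
  assumes "continuous_on {u..v} g" "continuous_on {u..v} h" "\<And>t. t \<in> {u..v} \<Longrightarrow> \<bar>g t\<bar> \<le> h t"
  shows "\<bar>integral {u..v} g\<bar> \<le> integral {u..v} h"
  using integral_norm_bound_integral[of g "{u..v}" h] assms by (auto intro: integrable_continuous_interval)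

text \<open>
  The product of \<open>a\<close> and \<open>b\<close> agrees with \<open>f\<close> in the mean, up to \<open>\<eta>\<close>. Their squares are controlled by
  \<open>f\<close> alone, while \<open>\<mu>\<close> measures how far they are concentrated.
\<close>

definition pulse_pair ::
  "(real \<Rightarrow> real) \<Rightarrow> real \<Rightarrow> real \<Rightarrow> real \<Rightarrow> (real \<Rightarrow> real) \<Rightarrow> (real \<Rightarrow> real) \<Rightarrow> bool" where
  "pulse_pair f \<eta> C \<mu> a b \<longleftrightarrow>
       C1 a \<and> C1 b \<and> a 0 = 0 \<and> b 0 = 0 \<and>
       (\<forall>t\<in>{0..1}. \<bar>a t\<bar> = \<bar>b t\<bar>) \<and>
       (\<forall>t\<in>{0..1}. \<bar>integral {0..t} (\<lambda>s. a s * b s - f s)\<bar> \<le> \<eta>) \<and>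
       integral {0..1} (\<lambda>t. (a t)\<^sup>2) \<le> integral {0..1} (\<lambda>t. \<bar>f t\<bar>) \<and>
       integral {0..1} (\<lambda>t. \<bar>a t\<bar>) \<le> C / \<mu> \<and>
       integral {0..1} (\<lambda>t. \<bar>deriv a t\<bar>) \<le> C * \<mu> \<and> integral {0..1} (\<lambda>t. \<bar>deriv b t\<bar>) \<le> C * \<mu>"

text \<open>
  The interval is cut into short pieces; on each of them \<open>a\<close> and \<open>b\<close> are multiples of the same bump, and the
  sign of \<open>b\<close> and the common height are chosen such that \<open>a * b\<close> has the same integral as \<open>f\<close> over the piece.
  The number of pieces depends on \<open>f\<close> and \<open>\<eta>\<close> only, so \<open>C\<close> does not depend on \<open>\<mu>\<close>.
\<close>

lemma pulse_factorization:
  fixes f :: "real \<Rightarrow> real"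
  assumes f: "continuous_on UNIV f" and \<eta>: "0 < \<eta>"
  obtains C \<mu>0 where "0 < C" "0 < \<mu>0"
    "\<And>\<mu>. \<mu>0 \<le> \<mu> \<Longrightarrow> \<exists>a b. pulse_pair f \<eta> C \<mu> a b"
proof -
  obtain B B' :: "real \<Rightarrow> real" where
    B: "\<And>u. (B has_real_derivative B' u) (at u)" and cB': "continuous_on UNIV B'" and
    B0: "\<And>u. 1 \<le> \<bar>u\<bar> \<Longrightarrow> B u = 0 \<and> B' u = 0" and Bpos: "\<And>u. 0 \<le> B u" and
    B1: "integral {-1..1} (\<lambda>u. (B u)\<^sup>2) = 1" using bump_exists by blast
  have cB: "continuous_on A B" for A by (meson B DERIV_isCont continuous_at_imp_continuous_on)
  have cf: "continuous_on A f" for A using f continuous_on_subset by blast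
  define K where "K = integral {-1..1} B"
  define K' where "K' = integral {-1..1} (\<lambda>u. \<bar>B' u\<bar>)"
  have K: "K \<ge> 0" unfolding K_def by (intro integral_nonneg integrable_continuous_interval cB Bpos)
  have K': "K' \<ge> 0" unfolding K'_def
    by (intro integral_nonneg integrable_continuous_interval continuous_intros continuous_on_subset[OF cB']) auto
  obtain M where M: "\<And>t. t \<in> {0..1} \<Longrightarrow> \<bar>f t\<bar> \<le> M" "M > 0"
  proof -
    have "bounded (f ` {0..1})" by (intro compact_imp_bounded compact_continuous_image cf) auto
    then obtain M where "\<forall>t\<in>{0..1}. \<bar>f t\<bar> \<le> M" by (auto simp: bounded_iff)
    then show thesis by (intro that[of "max M 1"]) force+
  qed
  obtain N :: nat where N: "2 * M / \<eta> < real N" using reals_Archimedean2 by blast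
  have N0: "0 < real N" using N M \<eta> by (meson divide_pos_pos less_trans mult_pos_pos zero_less_numeral)
  (* Cut [0,1] into N pieces so short that |f| has integral at most eta/2 over each, and put one
     pulse with the right mean in the middle of each piece. *)
  define u where "u = (\<lambda>m::nat. real m / real N)"
  have u_le: "u m \<le> u (Suc m)" for m using N0 by (simp add: u_def divide_right_mono)
  define \<tau> where "\<tau> = (\<lambda>m::nat. (real m + 1/2) / real N)"
  define F where "F = (\<lambda>m. integral {u m..u (Suc m)} f)"
  define r where "r = (\<lambda>m. sqrt \<bar>F m\<bar>)"
  have piece_int: "integral {u m..u (Suc m)} (\<lambda>t. \<bar>f t\<bar>) \<le> M / N" if "m < N" for m
  proof -
    have "real (Suc m) \<le> real N" using that by simp
    then have "u (Suc m) \<le> 1" "0 \<le> u m" using N0 by (auto simp: u_def)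
    then have sub: "{u m..u (Suc m)} \<subseteq> {0..1}" by auto
    have "integral {u m..u (Suc m)} (\<lambda>t. \<bar>f t\<bar>) \<le> integral {u m..u (Suc m)} (\<lambda>t. M)"
      using sub M by (intro integral_le integrable_continuous_interval continuous_intros cf) auto
    also have "\<dots> = M / N" using u_le[of m] N0 by (simp add: u_def field_simps)
    finally show ?thesis .
  qed
  have F_le: "\<bar>F m\<bar> \<le> integral {u m..u (Suc m)} (\<lambda>t. \<bar>f t\<bar>)" for m
    unfolding F_def by (intro integral_abs_le_continuous continuous_intros cf) auto
  have r_le: "r m \<le> sqrt M" if "m < N" for m
  proof -
    have "\<bar>F m\<bar> \<le> M / N" using F_le[of m] piece_int[OF that] by linarith
    also have "\<dots> \<le> M / 1" using that M by (intro divide_left_mono) auto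
    finally show ?thesis by (simp add: r_def)
  qed
  have r0: "r m \<ge> 0" for m by (simp add: r_def)
  define C where "C = real N * sqrt M * (K + K' + 1)"
  have C0: "C > 0" unfolding C_def using N0 M K K' by (intro mult_pos_pos) auto
  show thesis
  proof (rule that[of C "sqrt (2 * N)"])
    show "0 < C" by fact
    show "0 < sqrt (2 * N)" using N0 by simp
  next
    fix \<mu> assume \<mu>: "sqrt (2 * N) \<le> \<mu>"
    have "0 < sqrt (2 * N)" using N0 by simp
    then have \<mu>0: "\<mu> > 0" using \<mu> by linarith
    (* The factor mu = sqrt l keeps the square integral of a pulse of length 2 / l equal to one. *)
    define l where "l = \<mu>\<^sup>2"
    have l0: "l > 0" using \<mu>0 by (simp add: l_def)
    have lN: "2 * N \<le> l" using \<mu> unfolding l_def by (rule sqrt_le_D)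
    define G where "G = (\<lambda>m t. \<mu> * B (l * (t - \<tau> m)))"
    define G' where "G' = (\<lambda>m t. \<mu> * (l * B' (l * (t - \<tau> m))))"
    have G: "(G m has_real_derivative G' m t) (at t)" for m t
      unfolding G_def G'_def
      by (rule DERIV_cmult, rule DERIV_chain2[OF B, THEN DERIV_cong])
         (auto intro!: derivative_eq_intros)
    have cG': "continuous_on A (G' m)" for m A
      unfolding G'_def by (intro continuous_intros continuous_on_compose2[OF cB']) auto
    have cG: "continuous_on A (G m)" for m A
      by (meson G DERIV_isCont continuous_at_imp_continuous_on)
    have edge: "l * (u m - \<tau> m) \<le> -1" "1 \<le> l * (u (Suc m) - \<tau> m)" for m
      using lN N0 by (auto simp: u_def \<tau>_def field_simps)
    have far: "G m t = 0 \<and> G' m t = 0" if "t \<le> u m \<or> u (Suc m) \<le> t" for m t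
    proof -
      have "l * (t - \<tau> m) \<le> -1 \<or> 1 \<le> l * (t - \<tau> m)"
        using that edge[of m] l0 by (smt (verit) mult_left_mono)
      then show ?thesis using B0[of "l * (t - \<tau> m)"] by (auto simp: G_def G'_def)
    qed
    have off: "G j t = 0 \<and> G' j t = 0" if "t \<in> {u m..u (Suc m)}" "j \<noteq> m" for j m t
    proof (cases "j < m")
      case True
      then have "u (Suc j) \<le> u m" using N0 by (simp add: u_def divide_right_mono)
      then show ?thesis using that far[of t j] by auto
    next
      case False
      then have "u (Suc m) \<le> u j" using N0 that by (simp add: u_def divide_right_mono)
      then show ?thesis using that far[of t j] by auto
    qed
    define a where "a = (\<lambda>t. \<Sum>m<N. r m * G m t)"
    define b where "b = (\<lambda>t. \<Sum>m<N. sgn (F m) * r m * G m t)"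
    define a' where "a' = (\<lambda>t. \<Sum>m<N. r m * G' m t)"
    define b' where "b' = (\<lambda>t. \<Sum>m<N. sgn (F m) * r m * G' m t)"
    have da: "(a has_real_derivative a' t) (at t)" for t
      unfolding a_def a'_def by (intro DERIV_sum DERIV_cmult G)
    have db: "(b has_real_derivative b' t) (at t)" for t
      unfolding b_def b'_def by (intro DERIV_sum DERIV_cmult G)
    have ca': "continuous_on UNIV a'" "continuous_on UNIV b'"
      unfolding a'_def b'_def by (intro continuous_intros cG')+
    have a: "C1 a" "deriv a = a'" using C1_I[OF da ca'(1)] by auto
    have b: "C1 b" "deriv b = b'" using C1_I[OF db ca'(2)] by auto
    have pick: "a t = r m * G m t" "a' t = r m * G' m t"
      "b t = sgn (F m) * r m * G m t" "b' t = sgn (F m) * r m * G' m t"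
      if t: "t \<in> {u m..u (Suc m)}" and m: "m < N" for m t
    proof -
      have *: "(\<Sum>j<N. h j) = h m" if "\<And>j. j \<noteq> m \<Longrightarrow> h j = (0::real)" for h
        using m that by (subst sum.remove[of _ m]) auto
      show "a t = r m * G m t" "a' t = r m * G' m t"
        "b t = sgn (F m) * r m * G m t" "b' t = sgn (F m) * r m * G' m t"
        unfolding a_def a'_def b_def b'_def using off[OF t] by (subst *; simp)+
    qed
    have uN: "u N = 1" using N0 by (simp add: u_def)
    have u0: "u 0 = 0" by (simp add: u_def)
    have split: "integral {0..u k} g = (\<Sum>m<k. integral {u m..u (Suc m)} g)" if "continuous_on UNIV g" for g :: "real \<Rightarrow> real" and k
      using integral_pieces[OF that N0] by (simp add: u_def)
    have locate: "\<exists>m<N. t \<in> {u m..u (Suc m)}" if "t \<in> {0..1}" for t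
    proof (cases "t = 1")
      case True
      show ?thesis using N0 True by (intro exI[of _ "N - 1"]) (auto simp: u_def divide_simps)
    next
      case False
      then have t: "0 \<le> t" "t < 1" using that by auto
      obtain m where m: "real m \<le> t * N" "t * N < real m + 1"
      proof
        have "0 \<le> t * N" using t N0 by simp
        then show "real (nat \<lfloor>t * N\<rfloor>) \<le> t * N" "t * N < real (nat \<lfloor>t * N\<rfloor>) + 1"
          by linarith+
      qed
      have "t * real N < 1 * real N" using t N0 by (intro mult_strict_right_mono) auto
      then have "m < N" using m by linarith
      moreover have "u m \<le> t" "t \<le> u (Suc m)"
        using m N0 by (auto simp: u_def pos_divide_le_eq pos_le_divide_eq)
      ultimately show ?thesis by auto
    qed
    have ab_sgn: "sgn (F m) * r m * (r m) = F m" for m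
      by (simp add: r_def sgn_mult_abs mult.assoc)
    have intG2: "integral {u m..u (Suc m)} (\<lambda>t. (G m t)\<^sup>2) = 1" for m
    proof -
      have "integral {u m..u (Suc m)} (\<lambda>t. (B (l * (t - \<tau> m)))\<^sup>2) = integral {-1..1} (\<lambda>u. (B u)\<^sup>2) / l"
        using B0 l0 edge[of m]
        by (intro integral_rescaled_bump[where \<phi> = "\<lambda>u. (B u)\<^sup>2"]) (auto intro!: continuous_intros cB)
      then show ?thesis using \<mu>0 by (simp add: G_def power_mult_distrib B1 l_def)
    qed
    have intG: "integral {u m..u (Suc m)} (\<lambda>t. \<bar>G m t\<bar>) = K / \<mu>" for m
    proof -
      have "integral {u m..u (Suc m)} (\<lambda>t. B (l * (t - \<tau> m))) = K / l"
        unfolding K_def using B0 l0 edge[of m]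
        by (intro integral_rescaled_bump[where \<phi> = "\<lambda>u. B u"]) (auto intro!: continuous_intros cB)
      then show ?thesis using \<mu>0 Bpos by (simp add: G_def abs_mult l_def power2_eq_square)
    qed
    have intG': "integral {u m..u (Suc m)} (\<lambda>t. \<bar>G' m t\<bar>) = K' * \<mu>" for m
    proof -
      have "integral {u m..u (Suc m)} (\<lambda>t. \<bar>B' (l * (t - \<tau> m))\<bar>) = K' / l"
        unfolding K'_def using B0 l0 edge[of m]
        by (intro integral_rescaled_bump[where \<phi> = "\<lambda>u. \<bar>B' u\<bar>"]) (auto intro!: continuous_intros cB')
      then show ?thesis using \<mu>0 l0 by (simp add: G'_def abs_mult mult.assoc[symmetric])
    qed
    have ab_eq: "a s * b s = F m * (G m s)\<^sup>2" if "s \<in> {u m..u (Suc m)}" "m < N" for m s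
    proof -
      have "a s * b s = (sgn (F m) * r m * r m) * (G m s)\<^sup>2"
        by (simp add: pick(1,3)[OF that] power2_eq_square)
      then show ?thesis by (simp only: ab_sgn)
    qed
    have intab: "integral {u m..u (Suc m)} (\<lambda>s. a s * b s) = F m" if "m < N" for m
    proof -
      have "integral {u m..u (Suc m)} (\<lambda>s. a s * b s) = integral {u m..u (Suc m)} (\<lambda>s. F m * (G m s)\<^sup>2)"
        by (rule integral_cong) (rule ab_eq[OF _ that])
      then show ?thesis by (simp add: intG2)
    qed
    have cab: "continuous_on A a" "continuous_on A b" for A
      using a b C1_continuous by auto
    have prim: "\<bar>integral {0..t} (\<lambda>s. a s * b s - f s)\<bar> \<le> \<eta>" if "t \<in> {0..1}" for t
    proof -
      obtain m where m: "m < N" "t \<in> {u m..u (Suc m)}" using locate[OF \<open>t \<in> {0..1}\<close>] by auto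
      have um: "0 \<le> u m" by (simp add: u_def)
      have c: "continuous_on A (\<lambda>s. a s * b s - f s)" for A by (intro continuous_intros cab cf)
      have "integral {0..t} (\<lambda>s. a s * b s - f s) =
         integral {0..u m} (\<lambda>s. a s * b s - f s) + integral {u m..t} (\<lambda>s. a s * b s - f s)"
        using um m by (intro Henstock_Kurzweil_Integration.integral_combine[symmetric]
           integrable_continuous_interval c) auto
      also have "integral {0..u m} (\<lambda>s. a s * b s - f s) = 0"
      proof -
        have "integral {u j..u (Suc j)} (\<lambda>s. a s * b s - f s) = 0" if "j < m" for j
        proof -
          have "integral {u j..u (Suc j)} (\<lambda>s. a s * b s - f s) =
             integral {u j..u (Suc j)} (\<lambda>s. a s * b s) - integral {u j..u (Suc j)} f"
            by (intro Henstock_Kurzweil_Integration.integral_diff integrable_continuous_interval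
                continuous_intros cab cf)
          then show ?thesis using intab[of j] that m by (simp add: F_def)
        qed
        then show ?thesis using split[OF c, of m] by simp
      qed
      also have "\<bar>0 + integral {u m..t} (\<lambda>s. a s * b s - f s)\<bar> \<le> integral {u m..t} (\<lambda>s. \<bar>a s * b s\<bar> + \<bar>f s\<bar>)"
        using abs_triangle_ineq4 by (auto intro!: integral_abs_le_continuous continuous_intros cab cf)
      also have "\<dots> \<le> integral {u m..u (Suc m)} (\<lambda>s. \<bar>a s * b s\<bar> + \<bar>f s\<bar>)"
        using m by (intro integral_subset_le integrable_continuous_interval continuous_intros cab cf) auto
      also have "\<dots> = integral {u m..u (Suc m)} (\<lambda>s. \<bar>a s * b s\<bar>) + integral {u m..u (Suc m)} (\<lambda>s. \<bar>f s\<bar>)"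
        by (intro Henstock_Kurzweil_Integration.integral_add integrable_continuous_interval
                continuous_intros cab cf)
      also have "integral {u m..u (Suc m)} (\<lambda>s. \<bar>a s * b s\<bar>) = \<bar>F m\<bar>"
      proof -
        have *: "\<bar>a s * b s\<bar> = \<bar>F m\<bar> * (G m s)\<^sup>2" if "s \<in> {u m..u (Suc m)}" for s
        proof -
          show ?thesis by (simp add: ab_eq[OF that m(1)] abs_mult)
        qed
        have "integral {u m..u (Suc m)} (\<lambda>s. \<bar>a s * b s\<bar>) = integral {u m..u (Suc m)} (\<lambda>s. \<bar>F m\<bar> * (G m s)\<^sup>2)"
          by (rule integral_cong) (rule *)
        then show ?thesis by (simp add: intG2)
      qed
      also have "\<bar>F m\<bar> + integral {u m..u (Suc m)} (\<lambda>s. \<bar>f s\<bar>) \<le> 2 * (M / N)"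
        using F_le[of m] piece_int[OF m(1)] by linarith
      also have "\<dots> \<le> \<eta>" using N N0 \<eta> by (simp add: field_simps)
      finally show ?thesis .
    qed
    have sum_pieces: "integral {0..1} g = (\<Sum>m<N. integral {u m..u (Suc m)} g)" if "continuous_on UNIV g" for g :: "real \<Rightarrow> real"
      using split[OF that, of N] uN by simp
    have "integral {0..1} (\<lambda>t. (a t)\<^sup>2) = (\<Sum>m<N. integral {u m..u (Suc m)} (\<lambda>t. (a t)\<^sup>2))"
      by (intro sum_pieces continuous_intros cab)
    also have "\<dots> = (\<Sum>m<N. \<bar>F m\<bar>)"
    proof (rule sum.cong)
      fix m assume m: "m \<in> {..<N}"
      have "integral {u m..u (Suc m)} (\<lambda>t. (a t)\<^sup>2) = integral {u m..u (Suc m)} (\<lambda>t. \<bar>F m\<bar> * (G m t)\<^sup>2)"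
        using m by (intro integral_cong) (simp add: pick power_mult_distrib r_def)
      then show "integral {u m..u (Suc m)} (\<lambda>t. (a t)\<^sup>2) = \<bar>F m\<bar>" by (simp add: intG2)
    qed simp
    also have "\<dots> \<le> (\<Sum>m<N. integral {u m..u (Suc m)} (\<lambda>t. \<bar>f t\<bar>))" by (intro sum_mono F_le)
    also have "\<dots> = integral {0..1} (\<lambda>t. \<bar>f t\<bar>)" by (intro sum_pieces[symmetric] continuous_intros cf)
    finally have L2: "integral {0..1} (\<lambda>t. (a t)\<^sup>2) \<le> integral {0..1} (\<lambda>t. \<bar>f t\<bar>)" .
    have L1: "integral {0..1} (\<lambda>t. \<bar>g t\<bar>) \<le> real N * sqrt M * Q"
      if "continuous_on UNIV g" "\<And>m t. m < N \<Longrightarrow> t \<in> {u m..u (Suc m)} \<Longrightarrow> \<bar>g t\<bar> \<le> r m * \<bar>H m t\<bar>"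
        "\<And>m. continuous_on UNIV (H m)"
        "\<And>m. integral {u m..u (Suc m)} (\<lambda>t. \<bar>H m t\<bar>) = Q" for g H Q
    proof -
      have cH: "continuous_on A (H m)" for A m using that(3) continuous_on_subset by blast
      have cg: "continuous_on A g" for A using that(1) continuous_on_subset by blast
      have "integral {u 0..u (Suc 0)} (\<lambda>t. \<bar>H 0 t\<bar>) \<ge> 0"
        by (intro integral_nonneg integrable_continuous_interval continuous_intros cH) auto
      then have Q: "Q \<ge> 0" using that(4)[of 0] by simp
      have "integral {0..1} (\<lambda>t. \<bar>g t\<bar>) = (\<Sum>m<N. integral {u m..u (Suc m)} (\<lambda>t. \<bar>g t\<bar>))"
        by (intro sum_pieces continuous_intros cg)
      also have "\<dots> \<le> (\<Sum>m<N. sqrt M * Q)"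
      proof (rule sum_mono)
        fix m assume m: "m \<in> {..<N}"
        have "integral {u m..u (Suc m)} (\<lambda>t. \<bar>g t\<bar>) \<le> integral {u m..u (Suc m)} (\<lambda>t. r m * \<bar>H m t\<bar>)"
          using m that(2) by (intro integral_le integrable_continuous_interval continuous_intros cg cH) auto
        also have "\<dots> = r m * Q" by (simp add: that(4))
        also have "\<dots> \<le> sqrt M * Q" using r_le m Q by (intro mult_right_mono) auto
        finally show "integral {u m..u (Suc m)} (\<lambda>t. \<bar>g t\<bar>) \<le> sqrt M * Q" .
      qed
      finally show ?thesis by (simp add: mult_ac)
    qed
    have La: "integral {0..1} (\<lambda>t. \<bar>a t\<bar>) \<le> real N * sqrt M * (K / \<mu>)"
      using r0 by (intro L1[of _ G] cab cG intG) (auto simp: pick abs_mult)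
    have La': "integral {0..1} (\<lambda>t. \<bar>a' t\<bar>) \<le> real N * sqrt M * (K' * \<mu>)"
      using r0 ca' by (intro L1[of _ G'] cab cG' intG') (auto simp: pick abs_mult)
    have Lb': "integral {0..1} (\<lambda>t. \<bar>b' t\<bar>) \<le> real N * sqrt M * (K' * \<mu>)"
      using r0 ca' by (intro L1[of _ G'] cab cG' intG')
        (auto simp: pick abs_mult sgn_if)
    have CK: "real N * sqrt M * (K / \<mu>) \<le> C / \<mu>" "real N * sqrt M * (K' * \<mu>) \<le> C * \<mu>"
      using M K K' \<mu>0 N0 by (auto simp: C_def divide_right_mono mult_left_mono)
    have eqab: "\<bar>a t\<bar> = \<bar>b t\<bar>" if t: "t \<in> {0..1}" for t
    proof -
      obtain m where m: "m < N" "t \<in> {u m..u (Suc m)}" using locate[OF t] by auto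
      show ?thesis by (simp add: pick[OF m(2,1)] abs_mult sgn_if r_def)
    qed
    have "G m 0 = 0" for m using far[of 0 m] by (simp add: u_def)
    then have zero: "a 0 = 0" "b 0 = 0" by (simp_all add: a_def b_def)
    show "\<exists>a b. pulse_pair f \<eta> C \<mu> a b"
      unfolding pulse_pair_def
      by (intro exI[of _ a] exI[of _ b] conjI ballI a(1) b(1) zero eqab prim L2
          order.trans[OF La CK(1)] order.trans[OF La'[folded a(2)] CK(2)] order.trans[OF Lb'[folded b(2)] CK(2)])
  qed
qed

section \<open>Removing one wave of the error\<close>

lemma C1_primitive:
  fixes h :: "real \<Rightarrow> real"
  assumes h: "continuous_on UNIV h"
  obtains H where "C1 H" "deriv H = h" "H 0 = 0" "\<And>t. 0 \<le> t \<Longrightarrow> H t = integral {0..t} h"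
proof -
  define H where "H = (\<lambda>t. if 0 \<le> t then integral {0..t} h else - integral {t..0} h)"
  have ch: "continuous_on A h" for A using h continuous_on_subset by blast
  have eq: "H t = integral {-A..t} h - integral {-A..0} h" if "-A < t" "0 < A" for t A
  proof (cases "0 \<le> t")
    case True
    then have "integral {-A..0} h + integral {0..t} h = integral {-A..t} h"
      using that by (intro Henstock_Kurzweil_Integration.integral_combine integrable_continuous_interval ch) auto
    then show ?thesis using True by (simp add: H_def)
  next
    case False
    then have "integral {-A..t} h + integral {t..0} h = integral {-A..0} h"
      using that by (intro Henstock_Kurzweil_Integration.integral_combine integrable_continuous_interval ch) auto
    then show ?thesis using False by (simp add: H_def)
  qed
  have D: "(H has_real_derivative h t) (at t)" for t
  proof -
    define A where "A = \<bar>t\<bar> + 1"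
    have t: "t \<in> {-A<..<A}" by (auto simp: A_def)
    have "((\<lambda>x. integral {-A..x} h) has_real_derivative h t) (at t within {-A..A})"
      using t by (intro integral_has_real_derivative ch) auto
    then have "((\<lambda>x. integral {-A..x} h) has_real_derivative h t) (at t)"
      using t by (simp add: at_within_Icc_at)
    then have "((\<lambda>x. integral {-A..x} h - integral {-A..0} h) has_real_derivative h t) (at t)"
      by (auto intro!: derivative_eq_intros)
    moreover have "\<forall>\<^sub>F x in nhds t. H x = integral {-A..x} h - integral {-A..0} h"
      using eventually_nhds_in_open[of "{-A<..<A}" t] t
      by (auto elim!: eventually_mono intro!: eq)
    ultimately show ?thesis by (simp add: DERIV_cong_ev[OF refl _ refl])
  qed
  show thesis
    by (rule that[of H]) (use C1_I[OF D h] in \<open>auto simp: H_def\<close>)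
qed

lemma C1_cdivide:
  assumes "C1 f"
  shows "C1 (\<lambda>t. f t / c)" "deriv (\<lambda>t. f t / c) = (\<lambda>t. deriv f t / c)"
  using C1_cmult[OF assms, of "1 / c"] by (auto simp: fun_eq_iff)

lemma continuous_modes_bound:
  assumes "continuous_modes X"
  obtains S where "0 < S" "\<And>t. t \<in> {0..1} \<Longrightarrow> size_at X t \<le> S"
proof -
  have "bounded (size_at X ` {0..1})"
    using assms by (intro compact_imp_bounded compact_continuous_image continuous_on_sizes) auto
  then obtain S where S: "\<forall>t\<in>{0..1}. \<bar>size_at X t\<bar> \<le> S" by (auto simp: bounded_iff)
  show thesis by (rule that[of "max S 1"]) (use S in force)+
qed

lemma integral_linear_combination:
  fixes f1 f2 f3 f4 :: "real \<Rightarrow> real"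
  assumes "continuous_on {0..1} f1" "continuous_on {0..1} f2" "continuous_on {0..1} f3" "continuous_on {0..1} f4"
  shows "integral {0..1} (\<lambda>t. p * f1 t + q * f2 t + r * f3 t + s * f4 t + w) =
    p * integral {0..1} f1 + q * integral {0..1} f2 + r * integral {0..1} f3 + s * integral {0..1} f4 + w"
proof -
  have c: "((\<lambda>t::real. w) has_integral w) {0..1}" using has_integral_const_real[of w 0 1] by simp
  show ?thesis
    by (rule integral_unique)
      (intro has_integral_add has_integral_mult_right integrable_integral integrable_continuous_interval assms c)
qed

text \<open>
  The increments \<open>U\<close>, \<open>V\<close> and the new errors \<open>G\<close>, \<open>H\<close> are small in \<open>L\<^sup>1\<close>-type norms. The increments are
  not small in \<open>L\<^sup>2\<close>, where they have to balance the removed error, of size \<open>I\<close>.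
\<close>

definition correction ::
  "real \<Rightarrow> real \<Rightarrow> real \<Rightarrow> mode list \<Rightarrow> mode list \<Rightarrow> mode list \<Rightarrow> mode list \<Rightarrow> bool" where
  "correction \<alpha> \<eta> I U V G H \<longleftrightarrow>
    integral {0..1} (\<lambda>t. stress_at G t + stress_at H t) \<le> \<eta> \<and>
    integral {0..1} (\<lambda>t. holder_at \<alpha> U t + holder_at \<alpha> V t) \<le> \<eta> \<and>
    integral {0..1} (\<lambda>t. (size_at U t + size_at V t)\<^sup>2) \<le> 6 * I + \<eta>"

lemma correction_sym: "correction \<alpha> \<eta> I U V G H \<Longrightarrow> correction \<alpha> \<eta> I V U H G"
  by (simp add: correction_def add.commute)

text \<open>
  The heart of the construction. With \<open>q = n (k \<times> c)\<close>, the waves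
  \<open>a(t) cos (2\<pi> (k + q) \<bullet> x + p + \<pi>/2) d / |k|\<close> and \<open>b(t) cos (2\<pi> q \<bullet> x) c / |c|\<close> produce the force
  \<open>- \<pi> (|k| / |c|) a b cos (2\<pi> k \<bullet> x + p) c\<close> and a force of frequency \<open>k + 2q\<close>, whose stress is of order
  \<open>1/n\<close>. If \<open>a b\<close> agrees in the mean with a multiple of the amplitude of \<open>e\<close>, a small slow wave of the same
  form as \<open>e\<close> takes care of the difference. All remaining interactions are linear in the pulse and thus
  small because its \<open>L\<^sup>1\<close> norm is.
\<close>

lemma cancel_one_mode:
  assumes ap: "approx_solution X Y (e # E) F" and \<eta>: "0 < \<eta>" and \<alpha>: "0 < \<alpha>" "\<alpha> < 1"
  shows "\<exists>U V G H. approx_solution (X @ U) (Y @ V) (E @ G) (F @ H) \<and>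
    correction \<alpha> \<eta> (integral {0..1} (stress_at [e])) U V G H"
proof -
  define c k \<psi> where "c = dir e" and "k = freq e" and "\<psi> = phase e"
  (* The carrier of the pulse oscillates along l, which is orthogonal to both k and c. *)
  define l where "l = cross3 k c"
  have X: "velocity_modes X" and Y: "velocity_modes Y"
    and e: "continuous_on UNIV (amp e)" "integer_vec k" "k \<noteq> 0" "integer_vec c" "c \<noteq> 0" "c \<bullet> k = 0"
    and E: "error_modes E" and F: "error_modes F"
    using ap by (auto simp: approx_solution_def error_modes_Cons c_def k_def)
  have res: "pairing \<Phi> (dt X @ advect Y X) t = amp e t * (c \<bullet> \<Phi> k \<psi>) + pairing \<Phi> E t"
    "pairing \<Phi> (dt Y @ advect X Y) t = pairing \<Phi> F t" if "solenoidal \<Phi>" for \<Phi> t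
    using ap that by (auto simp: approx_solution_def c_def k_def \<psi>_def)
  have lk: "l \<bullet> k = 0" "l \<bullet> c = 0" by (auto simp: l_def dot_cross_self)
  have il: "integer_vec l" unfolding l_def using e by blast
  have "(norm l)\<^sup>2 = (norm k * norm c)\<^sup>2"
    using norm_cross_dot[of k c] e by (simp add: l_def inner_commute)
  then have l0: "l \<noteq> 0" using e by auto
  have n1: "1 \<le> norm k" "1 \<le> norm c" "1 \<le> norm l"
    using norm_integer_vec_ge_1 e il l0 by auto
  (* The product of the two normalised amplitudes a and b below has to average to g. *)
  define g where "g = (\<lambda>t. norm c / (pi * norm k) * amp e t)"
  have cg: "continuous_on A g" for A
    unfolding g_def using e(1) by (intro continuous_intros continuous_on_subset[OF e(1)]) auto
  obtain S1 where S1: "0 < S1" "\<And>t. t \<in> {0..1} \<Longrightarrow> size_at X t \<le> S1"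
    using continuous_modes_bound[OF velocity_modes_continuous[OF X]] by metis
  obtain S2 where S2: "0 < S2" "\<And>t. t \<in> {0..1} \<Longrightarrow> size_at Y t \<le> S2"
    using continuous_modes_bound[OF velocity_modes_continuous[OF Y]] by metis
  define S where "S = S1 + S2"
  have S: "0 < S" "\<And>t. t \<in> {0..1} \<Longrightarrow> size_at X t \<le> S" "\<And>t. t \<in> {0..1} \<Longrightarrow> size_at Y t \<le> S"
    using S1 S2 unfolding S_def by (auto intro: add_increasing add_increasing2 less_imp_le)
  define L where "L = norm k + norm l"
  define Q where "Q = 1 + 2 * (2 * pi * L) powr \<alpha>"
  have Q: "Q \<ge> 1" by (simp add: Q_def)
  (* eta2 bounds the slow corrector theta; the four entries serve the Hoelder bound, the interaction with
     the given fields, the interaction with the pulse, and the square norm. *)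
  define \<eta>2 where "\<eta>2 = Min {\<eta> / (2 * Q), \<eta> / (4 * (4 * pi * S)), 1, \<eta> / 2}"
  have \<eta>2: "0 < \<eta>2" "\<eta>2 * Q \<le> \<eta> / 2" "4 * pi * S * \<eta>2 \<le> \<eta> / 4" "\<eta>2 \<le> 1" "\<eta>2 \<le> \<eta> / 2"
  proof -
    show "0 < \<eta>2" using \<eta> Q S(1) by (simp add: \<eta>2_def)
    have "\<eta>2 \<le> \<eta> / (2 * Q)" "\<eta>2 \<le> \<eta> / (4 * (4 * pi * S))" by (auto simp: \<eta>2_def)
    then show "\<eta>2 * Q \<le> \<eta> / 2" "4 * pi * S * \<eta>2 \<le> \<eta> / 4"
      using Q S(1) by (simp_all add: pos_le_divide_eq mult_ac)
    show "\<eta>2 \<le> 1" "\<eta>2 \<le> \<eta> / 2" by (auto simp: \<eta>2_def)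
  qed
  define \<eta>1 where "\<eta>1 = \<eta>2 / (pi * norm k)"
  have \<eta>1: "0 < \<eta>1" unfolding \<eta>1_def using \<eta>2 e by auto
  obtain C \<mu>0 where C: "0 < C" "0 < \<mu>0" and
    pulse: "\<And>\<mu>. \<mu>0 \<le> \<mu> \<Longrightarrow> \<exists>a b. pulse_pair g \<eta>1 C \<mu> a b"
    by (rule pulse_factorization[OF cg \<eta>1]) (rule that; assumption)
  define R where "R = integral {0..1} (\<lambda>t. \<bar>g t\<bar>)"
  have R: "R \<ge> 0" unfolding R_def
    by (intro integral_nonneg integrable_continuous_interval continuous_intros cg) auto
  (* With mu = n powr ((1 + alpha) / 2) both critical quantities equal n powr (-gamma): the Hoelder size
     (n powr alpha) / mu of the pulse and the size mu / n of the stress of its time derivative. D collects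
     the constants in front, which do not depend on n. *)
  define \<gamma> where "\<gamma> = (1 - \<alpha>) / 2"
  define D where "D = 4 * (12 * C + 24 * pi * S * C + 2 * pi * norm k * R + 8 * pi * C + 3 * C * Q)"
  have \<gamma>: "\<gamma> > 0" using \<alpha> by (simp add: \<gamma>_def)
  have D: "D \<ge> 0" unfolding D_def using C S(1) R Q by (intro mult_nonneg_nonneg add_nonneg_nonneg) auto
  obtain n :: nat where n: "1 \<le> n" "norm k \<le> n" "\<mu>0 \<le> real n powr (1 - \<gamma>)" "D * real n powr (-\<gamma>) \<le> \<eta>"
  proof -
    have "(\<lambda>n. D * real n powr (-\<gamma>)) \<longlonglongrightarrow> D * 0"
      using \<gamma> by (intro tendsto_mult tendsto_const tendsto_neg_powr filterlim_real_sequentially) auto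
    then have "\<forall>\<^sub>F n in sequentially. D * real n powr (-\<gamma>) < \<eta>"
      using \<eta> by (intro order_tendstoD(2)) auto
    moreover have "\<forall>\<^sub>F n in sequentially. \<mu>0 * real n powr (-(1 - \<gamma>)) < 1"
    proof -
      have "(\<lambda>n. \<mu>0 * real n powr (-(1 - \<gamma>))) \<longlonglongrightarrow> \<mu>0 * 0"
        using \<alpha> by (intro tendsto_mult tendsto_const tendsto_neg_powr filterlim_real_sequentially) (auto simp: \<gamma>_def)
      then show ?thesis by (intro order_tendstoD(2)) auto
    qed
    moreover have "\<forall>\<^sub>F n in sequentially. norm k \<le> real n"
      using filterlim_real_sequentially by (auto simp: filterlim_at_top)
    moreover have "\<forall>\<^sub>F n in sequentially. 1 \<le> (n::nat)" by (rule eventually_ge_at_top)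
    ultimately have "\<forall>\<^sub>F n in sequentially. 1 \<le> n \<and> norm k \<le> n \<and> \<mu>0 \<le> real n powr (1 - \<gamma>) \<and> D * real n powr (-\<gamma>) \<le> \<eta>"
    proof eventually_elim
      case (elim n)
      then have "\<mu>0 \<le> real n powr (1 - \<gamma>)"
        by (simp only: powr_minus) (simp add: divide_simps flip: divide_inverse)
      then show ?case using elim by simp
    qed
    then show thesis using that by (auto simp: eventually_sequentially)
  qed
  define \<mu> where "\<mu> = real n powr (1 - \<gamma>)"
  define \<rho> where "\<rho> = real n powr (-\<gamma>)"
  have nr: "1 \<le> real n" using n by simp
  have \<rho>: "0 < \<rho>" "1 / \<mu> \<le> \<rho>" "1 / n \<le> \<rho>" "real n powr \<alpha> / \<mu> = \<rho>" "\<mu> / n = \<rho>" "0 < \<mu>" "\<rho> \<le> 1"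
  proof -
    show "0 < \<rho>" "0 < \<mu>" using nr by (auto simp: \<rho>_def \<mu>_def)
    have "\<alpha> - (1 - \<gamma>) = - \<gamma>" by (simp add: \<gamma>_def field_simps)
    then show eq: "real n powr \<alpha> / \<mu> = \<rho>" by (simp only: \<mu>_def \<rho>_def powr_diff[symmetric])
    show "\<mu> / n = \<rho>" using nr by (simp add: \<mu>_def \<rho>_def powr_diff powr_minus_divide)
    have "1 \<le> real n powr \<alpha>" using nr \<alpha> by (simp add: ge_one_powr_ge_zero)
    then show "1 / \<mu> \<le> \<rho>" unfolding eq[symmetric] using \<open>0 < \<mu>\<close> by (intro divide_right_mono) auto
    have "real n powr (-1) \<le> real n powr (-\<gamma>)" using nr \<alpha> by (intro powr_mono) (auto simp: \<gamma>_def)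
    then show "1 / n \<le> \<rho>" using nr by (simp add: \<rho>_def powr_minus_divide)
    have "real n powr (-\<gamma>) \<le> real n powr 0" using nr \<gamma> by (intro powr_mono) auto
    then show "\<rho> \<le> 1" using nr by (simp add: \<rho>_def)
  qed
  have D\<rho>: "D * \<rho> \<le> \<eta>" using n by (simp add: \<rho>_def)
  obtain a b where "pulse_pair g \<eta>1 C \<mu> a b"
    using pulse[OF n(3)] unfolding \<mu>_def by blast
  then have ab: "C1 a" "C1 b" "a 0 = 0" "b 0 = 0"
    and abs_ab: "\<And>t. t\<in>{0..1} \<Longrightarrow> \<bar>b t\<bar> = \<bar>a t\<bar>"
    and prim: "\<And>t. t\<in>{0..1} \<Longrightarrow> \<bar>integral {0..t} (\<lambda>s. a s * b s - g s)\<bar> \<le> \<eta>1"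
    and L2: "integral {0..1} (\<lambda>t. (a t)\<^sup>2) \<le> R"
    and L1: "integral {0..1} (\<lambda>t. \<bar>a t\<bar>) \<le> C / \<mu>"
      "integral {0..1} (\<lambda>t. \<bar>deriv a t\<bar>) \<le> C * \<mu>" "integral {0..1} (\<lambda>t. \<bar>deriv b t\<bar>) \<le> C * \<mu>"
    by (auto simp: pulse_pair_def R_def)
  have cab: "continuous_on A a" "continuous_on A b" for A using ab C1_continuous by auto
  have cab': "continuous_on A (deriv a)" "continuous_on A (deriv b)" for A
    using ab by (auto simp: C1_def intro: continuous_on_subset)
  have c\<theta>: "continuous_on UNIV (\<lambda>s. pi * norm k / norm c * (a s * b s - g s))"
    by (intro continuous_intros cab cg)
  (* theta absorbs the part of the forcing that the pulses do not cancel at each single time; it is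
     small because the primitive of a * b - g is. *)
  obtain \<theta> where \<theta>: "C1 \<theta>"
      "deriv \<theta> = (\<lambda>s. pi * norm k / norm c * (a s * b s - g s))" "\<theta> 0 = 0"
      "\<And>t. 0 \<le> t \<Longrightarrow> \<theta> t = integral {0..t} (\<lambda>s. pi * norm k / norm c * (a s * b s - g s))"
    by (rule C1_primitive[OF c\<theta>]) (rule that; assumption)
  have \<theta>_le: "\<bar>\<theta> t\<bar> * norm c \<le> \<eta>2" if "t \<in> {0..1}" for t
  proof -
    have "\<bar>\<theta> t\<bar> * norm c = pi * norm k * \<bar>integral {0..t} (\<lambda>s. a s * b s - g s)\<bar>"
      using that \<theta>(4)[of t] e by (simp add: abs_mult)
    also have "\<dots> \<le> pi * norm k * \<eta>1" using prim[OF that] by (intro mult_left_mono) auto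
    also have "\<dots> = \<eta>2" using e by (simp add: \<eta>1_def)
    finally show ?thesis .
  qed
  define q where "q = real n *\<^sub>R l"
  (* The component of k orthogonal to k + q, up to scale: this makes the wave wm solenoidal, and it
     leaves d . q = - |k|^2, of order one although q is large. *)
  define d where "d = k - ((norm k)\<^sup>2 / (norm q)\<^sup>2) *\<^sub>R q"
  have q: "integer_vec q" "q \<bullet> k = 0" "k \<bullet> q = 0" "c \<bullet> q = 0" "norm q = n * norm l" "q \<noteq> 0"
    using il lk l0 n(1) by (auto simp: q_def inner_commute)
  have dq: "d \<bullet> q = - (norm k)\<^sup>2"
    using q(3,6) by (simp add: d_def inner_diff_left dot_square_norm)
  have dkq: "d \<bullet> (k + q) = 0"
    using q(2,3,6) by (simp add: d_def inner_diff_left inner_add_right dot_square_norm)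
  have cq: "c \<bullet> (k + q) = 0" using q e by (simp add: inner_add_right)
  have nq: "real n \<le> norm q" using q n1 nr by (simp add: mult_le_cancel_left1)
  have nd: "norm d \<le> 2 * norm k"
  proof -
    have "norm d \<le> norm k + norm (((norm k)\<^sup>2 / (norm q)\<^sup>2) *\<^sub>R q)" unfolding d_def by (rule norm_triangle_ineq4)
    also have "norm (((norm k)\<^sup>2 / (norm q)\<^sup>2) *\<^sub>R q) = norm k * (norm k / norm q)"
      using q(6) by (simp add: power2_eq_square)
    also have "\<dots> \<le> norm k * 1"
    proof (intro mult_left_mono)
      show "norm k / norm q \<le> 1" using nq n(2) q(6) by (simp add: divide_le_eq)
    qed auto
    finally show ?thesis by simp
  qed
  have pyth: "real n \<le> norm (k + s *\<^sub>R q)" if "1 \<le> s" for s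
  proof -
    have "(real n)\<^sup>2 \<le> (norm q)\<^sup>2" using nq by (intro power_mono) auto
    also have "\<dots> \<le> s\<^sup>2 * (norm q)\<^sup>2" using that by (simp add: mult_le_cancel_right1 one_le_power)
    also have "\<dots> \<le> (norm (k + s *\<^sub>R q))\<^sup>2"
      using q(2,3) by (simp add: norm_add_Pythagorean orthogonal_def power_mult_distrib)
    finally show ?thesis by (rule power2_le_imp_le) simp
  qed
  (* wp and wm are the fast pulse, wt is the slow corrector, and hi is the by-product of the pulse at
     the frequency k + 2 q. *)
  define wp where "wp = Mode (\<lambda>t. b t / norm c) c q 0"
  define wt where "wt = Mode \<theta> c k \<psi>"
  define wm where "wm = Mode (\<lambda>t. a t / norm k) d (k + q) (\<psi> + pi/2)"
  define hi where "hi = Mode (\<lambda>t. pi * norm k / norm c * (a t * b t)) c (k + 2 *\<^sub>R q) \<psi>"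
  define U where "U = [wp, wt]"
  define V where "V = [wm]"
  have VU: "velocity_modes U" "velocity_modes V"
    unfolding U_def V_def wp_def wt_def wm_def using ab \<theta> q e dkq
    by (auto simp: velocity_modes_Cons C1_cdivide inner_commute)
  define P where "P = dt [wp] @ advect Y U @ advect V X @ [hi] @ advect1 wm wt"
  define M where "M = dt V @ advect X V @ advect U Y"
  have fd: "force_modes (dt [wp])" "force_modes (dt V)"
  proof -
    have "k + q \<noteq> 0" using pyth[of 1] nr by auto
    then show "force_modes (dt [wp])" "force_modes (dt V)"
      using q e by (auto simp: V_def wp_def wm_def C1_cdivide ab intro!: continuous_intros cab')
  qed
  have "k + 2 *\<^sub>R q \<noteq> 0" using pyth[of 2] nr by auto
  moreover have "integer_vec (k + 2 *\<^sub>R q)"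
    using e(2) q(1) by (intro integer_vec_add integer_vec_scale) auto
  ultimately have fhi: "force_modes [hi]" using cab e(5) by (auto simp: hi_def intro!: continuous_intros)
  have fth: "force_modes (advect1 wm wt)"
    using force_modes_advect[of "[wm]" "[wt]"] VU by (auto simp: U_def V_def velocity_modes_Cons)
  have fP: "force_modes P" and fM: "force_modes M"
    unfolding P_def M_def using fd fhi fth force_modes_advect VU X Y by auto
  obtain G where G: "error_modes G" "\<And>\<Phi> t. solenoidal \<Phi> \<Longrightarrow> pairing \<Phi> G t = pairing \<Phi> P t"
     "\<And>t. stress_at G t \<le> 2 * stress_at P t" using resolve_force[OF fP] by blast
  obtain H where H: "error_modes H" "\<And>\<Phi> t. solenoidal \<Phi> \<Longrightarrow> pairing \<Phi> H t = pairing \<Phi> M t"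
     "\<And>t. stress_at H t \<le> 2 * stress_at M t" using resolve_force[OF fM] by blast
  have approx: "approx_solution (X @ U) (Y @ V) (E @ G) (F @ H)"
    unfolding approx_solution_def
  proof (intro conjI allI impI)
    fix \<Phi> t assume sol: "solenoidal \<Phi>"
    (* The slow half of the product of wm and wp has exactly the direction, frequency and phase of e. *)
    have 1: "pairing \<Phi> (advect1 wm wp) t = amp hi t * (c \<bullet> \<Phi> (k + 2 *\<^sub>R q) \<psi>) - pi * norm k / norm c * (a t * b t) * (c \<bullet> \<Phi> k \<psi>)"
      using e by (simp add: advect1_def wm_def wp_def hi_def dq scaleR_2 add.assoc power2_eq_square)
    have 2: "deriv \<theta> t * (c \<bullet> \<Phi> k \<psi>) = pi * norm k / norm c * (a t * b t) * (c \<bullet> \<Phi> k \<psi>) - amp e t * (c \<bullet> \<Phi> k \<psi>)"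
      using e by (simp add: \<theta>(2) g_def algebra_simps)
    have "pairing \<Phi> (dt (X @ U) @ advect (Y @ V) (X @ U)) t =
       pairing \<Phi> (dt X @ advect Y X) t + pairing \<Phi> P t + deriv \<theta> t * (c \<bullet> \<Phi> k \<psi>)
        - amp hi t * (c \<bullet> \<Phi> (k + 2 *\<^sub>R q) \<psi>) + pairing \<Phi> (advect1 wm wp) t"
      by (simp add: P_def pairing_advect_append U_def V_def wt_def hi_def)
    then show "pairing \<Phi> (dt (X @ U) @ advect (Y @ V) (X @ U)) t = pairing \<Phi> (E @ G) t"
      using res(1)[OF sol, of t] G(2)[OF sol, of t] 1 2 by simp
    (* In the other equation the pulse does nothing, since c is orthogonal to k + q. *)
    have 3: "pairing \<Phi> (advect U V) t = 0"
      using cq by (simp add: U_def V_def advect1_def wp_def wt_def wm_def)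
    have "pairing \<Phi> (dt (Y @ V) @ advect (X @ U) (Y @ V)) t =
       pairing \<Phi> (dt Y @ advect X Y) t + pairing \<Phi> M t + pairing \<Phi> (advect U V) t"
      by (simp add: M_def pairing_advect_append)
    then show "pairing \<Phi> (dt (Y @ V) @ advect (X @ U) (Y @ V)) t = pairing \<Phi> (F @ H) t"
      using res(2)[OF sol, of t] H(2)[OF sol, of t] 3 by simp
  qed (use X Y VU E F G H in auto)

  have szU: "size_at U t \<le> \<bar>a t\<bar> + \<eta>2" and szV: "size_at V t \<le> 2 * \<bar>a t\<bar>" if t: "t \<in> {0..1}" for t
  proof -
    show "size_at U t \<le> \<bar>a t\<bar> + \<eta>2"
      using \<theta>_le[OF t] abs_ab[OF t] e by (simp add: U_def wp_def wt_def abs_mult)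
    have "\<bar>a t\<bar> * norm d / norm k \<le> \<bar>a t\<bar> * (2 * norm k) / norm k"
      using nd by (intro divide_right_mono mult_left_mono) auto
    then show "size_at V t \<le> 2 * \<bar>a t\<bar>" using e by (simp add: V_def wm_def abs_mult mult_ac)
  qed
  have sth: "size_at [wt] t \<le> \<eta>2" if "t \<in> {0..1}" for t using \<theta>_le[OF that] by (simp add: wt_def)

  have stress_dwp: "stress_at (dt [wp]) t \<le> \<bar>deriv b t\<bar> / n" for t
  proof -
    have "\<bar>deriv b t\<bar> / norm q \<le> \<bar>deriv b t\<bar> / n"
      using nq nr by (intro frac_le) auto
    then show ?thesis using e by (simp add: wp_def C1_cdivide ab)
  qed
  have stress_dwm: "stress_at (dt V) t \<le> 2 * \<bar>deriv a t\<bar> / n" for t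
  proof -
    have "\<bar>deriv a t\<bar> * norm d / norm k / norm (k + q) \<le> \<bar>deriv a t\<bar> * (2 * norm k) / norm k / norm (k + q)"
      using nd by (intro divide_right_mono mult_left_mono) auto
    also have "\<dots> \<le> 2 * \<bar>deriv a t\<bar> / n"
      using pyth[of 1] nr e(3) by (intro frac_le) auto
    finally show ?thesis by (simp add: V_def wm_def C1_cdivide ab mult_ac)
  qed
  have stress_hi: "stress_at [hi] t \<le> pi * norm k * (a t)\<^sup>2 / n" if t: "t \<in> {0..1}" for t
  proof -
    have "\<bar>a t * b t\<bar> = (a t)\<^sup>2" using abs_ab[OF t] by (simp add: abs_mult power2_eq_square)
    then have "stress_at [hi] t = pi * norm k * (a t)\<^sup>2 / norm (k + 2 *\<^sub>R q)"
      using e by (simp add: hi_def abs_mult)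
    also have "\<dots> \<le> pi * norm k * (a t)\<^sup>2 / n" using pyth[of 2] nr by (intro frac_le) auto
    finally show ?thesis .
  qed
  have stressGH: "stress_at G t + stress_at H t \<le>
     4 / n * \<bar>deriv a t\<bar> + 2 / n * \<bar>deriv b t\<bar> + (24 * pi * S + 8 * pi * \<eta>2) * \<bar>a t\<bar>
      + 2 * pi * norm k / n * (a t)\<^sup>2 + 8 * pi * S * \<eta>2" if t: "t \<in> {0..1}" for t
  proof -
    have bd: "stress_at (advect A B) t \<le> 2 * pi * p * r"
      if "velocity_modes A" "size_at A t \<le> p" "size_at B t \<le> r" for A B p r
    proof -
      have "2 * pi * size_at A t * size_at B t \<le> 2 * pi * p * r"
        using that(2,3) order.trans[OF size_at_nonneg that(2)] by (intro mult_mono) auto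
      then show ?thesis using stress_advect[OF that(1), of B t] by linarith
    qed
    have "stress_at (advect Y U) t \<le> 2 * pi * S * (\<bar>a t\<bar> + \<eta>2)"
      "stress_at (advect V X) t \<le> 2 * pi * (2 * \<bar>a t\<bar>) * S"
      "stress_at (advect X V) t \<le> 2 * pi * S * (2 * \<bar>a t\<bar>)"
      "stress_at (advect U Y) t \<le> 2 * pi * (\<bar>a t\<bar> + \<eta>2) * S"
      by - (intro bd X Y VU S(2,3)[OF t] szU[OF t] szV[OF t])+
    moreover have "stress_at (advect1 wm wt) t \<le> 2 * pi * (2 * \<bar>a t\<bar>) * \<eta>2"
      using bd[of V "2 * \<bar>a t\<bar>" "[wt]" \<eta>2] VU szV[OF t] sth[OF t] by (simp add: V_def)
    ultimately have "stress_at P t + stress_at M t \<le>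
      \<bar>deriv b t\<bar> / n + 2 * \<bar>deriv a t\<bar> / n + pi * norm k * (a t)\<^sup>2 / n
      + (2 * pi * S * (\<bar>a t\<bar> + \<eta>2) + 2 * pi * (2 * \<bar>a t\<bar>) * S + 2 * pi * S * (2 * \<bar>a t\<bar>) + 2 * pi * (\<bar>a t\<bar> + \<eta>2) * S
      + 2 * pi * (2 * \<bar>a t\<bar>) * \<eta>2)"
      unfolding P_def M_def stress_at_simps(3)
      using stress_dwp[of t] stress_dwm[of t] stress_hi[OF t] by linarith
    then have "2 * (stress_at P t + stress_at M t) \<le> 2 * (\<bar>deriv b t\<bar> / n + 2 * \<bar>deriv a t\<bar> / n + pi * norm k * (a t)\<^sup>2 / n
      + (2 * pi * S * (\<bar>a t\<bar> + \<eta>2) + 2 * pi * (2 * \<bar>a t\<bar>) * S + 2 * pi * S * (2 * \<bar>a t\<bar>) + 2 * pi * (\<bar>a t\<bar> + \<eta>2) * S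
      + 2 * pi * (2 * \<bar>a t\<bar>) * \<eta>2))"
      by (rule mult_left_mono) simp
    moreover have "stress_at G t + stress_at H t \<le> 2 * (stress_at P t + stress_at M t)"
      using add_mono[OF G(3)[of t] H(3)[of t]] by simp
    ultimately show ?thesis by (simp add: algebra_simps)
  qed
  have Ra: "0 \<le> integral {0..1} (\<lambda>t. \<bar>a t\<bar>)"
    by (intro integral_nonneg integrable_continuous_interval continuous_intros cab) auto
  have La: "integral {0..1} (\<lambda>t. \<bar>a t\<bar>) \<le> C * \<rho>"
    using L1(1) mult_left_mono[OF \<rho>(2), of C] C by simp
  have stress_bound: "integral {0..1} (\<lambda>t. stress_at G t + stress_at H t) \<le> \<eta>"
  proof -
    have "integral {0..1} (\<lambda>t. stress_at G t + stress_at H t) \<le> integral {0..1} (\<lambda>t.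
      4 / n * \<bar>deriv a t\<bar> + 2 / n * \<bar>deriv b t\<bar> + (24 * pi * S + 8 * pi * \<eta>2) * \<bar>a t\<bar>
      + 2 * pi * norm k / n * (a t)\<^sup>2 + 8 * pi * S * \<eta>2)"
      using stressGH G(1) H(1)
      by (intro integral_le integrable_continuous_interval continuous_intros cab cab')
         (auto simp: error_modes_continuous)
    also have "\<dots> = 4 / n * integral {0..1} (\<lambda>t. \<bar>deriv a t\<bar>) + 2 / n * integral {0..1} (\<lambda>t. \<bar>deriv b t\<bar>)
       + (24 * pi * S + 8 * pi * \<eta>2) * integral {0..1} (\<lambda>t. \<bar>a t\<bar>)
       + 2 * pi * norm k / n * integral {0..1} (\<lambda>t. (a t)\<^sup>2) + 8 * pi * S * \<eta>2"
      by (intro integral_linear_combination continuous_intros cab cab')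
    also have "\<dots> \<le> 4 / n * (C * \<mu>) + 2 / n * (C * \<mu>) + (24 * pi * S + 8 * pi) * (C * \<rho>)
       + 2 * pi * norm k / n * R + 8 * pi * S * \<eta>2"
    proof (intro add_mono order_refl)
      show "4 / n * integral {0..1} (\<lambda>t. \<bar>deriv a t\<bar>) \<le> 4 / n * (C * \<mu>)"
        "2 / n * integral {0..1} (\<lambda>t. \<bar>deriv b t\<bar>) \<le> 2 / n * (C * \<mu>)"
        "2 * pi * norm k / n * integral {0..1} (\<lambda>t. (a t)\<^sup>2) \<le> 2 * pi * norm k / n * R"
        using L1 L2 by (intro mult_left_mono; simp)+
      show "(24 * pi * S + 8 * pi * \<eta>2) * integral {0..1} (\<lambda>t. \<bar>a t\<bar>) \<le> (24 * pi * S + 8 * pi) * (C * \<rho>)"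
        using Ra La S(1) \<eta>2 by (intro mult_mono) auto
    qed
    also have "\<dots> = (6 * C + 24 * pi * S * C + 8 * pi * C) * \<rho> + 2 * pi * norm k * R * (1 / n) + 2 * (4 * pi * S * \<eta>2)"
      unfolding \<rho>(5)[symmetric] by (simp add: add_divide_distrib algebra_simps)
    also have "\<dots> \<le> (6 * C + 24 * pi * S * C + 8 * pi * C) * \<rho> + 2 * pi * norm k * R * \<rho> + 2 * (\<eta> / 4)"
      using \<rho>(3) \<eta>2(3) R C S(1) by (intro add_mono mult_left_mono) auto
    also have "\<dots> = (6 * C + 24 * pi * S * C + 8 * pi * C + 2 * pi * norm k * R) * \<rho> + \<eta> / 2"
      by (simp add: algebra_simps)
    also have "\<dots> \<le> (D / 4) * \<rho> + \<eta> / 2"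
      using C S(1) Q \<rho>(1) by (intro add_mono mult_right_mono) (auto simp: D_def)
    also have "\<dots> \<le> \<eta>" using D\<rho> \<eta> by simp
    finally show ?thesis .
  qed
  have weight: "1 + 2 * (2 * pi * norm p) powr \<alpha> \<le> Q * real n powr \<alpha>" if "norm p \<le> n * L" for p :: "real^3"
  proof -
    have "(2 * pi * norm p) powr \<alpha> \<le> (2 * pi * L * n) powr \<alpha>"
      using that \<alpha> by (intro powr_mono2) (auto simp: mult_ac)
    also have "\<dots> = (2 * pi * L) powr \<alpha> * real n powr \<alpha>"
      by (simp add: powr_mult L_def)
    moreover have "1 \<le> real n powr \<alpha>" using nr \<alpha> by (simp add: ge_one_powr_ge_zero)
    ultimately show ?thesis unfolding Q_def by (simp add: algebra_simps)
  qed
  have nL: "norm (k + q) \<le> n * L" "norm q \<le> n * L" "norm k \<le> L"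
  proof -
    have "norm k \<le> n * norm k" using nr by (simp add: mult_le_cancel_right1)
    moreover have "norm (k + q) \<le> norm k + n * norm l" using norm_triangle_ineq[of k q] q by simp
    ultimately show "norm (k + q) \<le> n * L" by (simp add: L_def distrib_left)
    show "norm q \<le> n * L" "norm k \<le> L" using q by (auto simp: L_def distrib_left)
  qed
  have holder_bound: "integral {0..1} (\<lambda>t. holder_at \<alpha> U t + holder_at \<alpha> V t) \<le> \<eta>"
  proof -
    have pt: "holder_at \<alpha> U t + holder_at \<alpha> V t \<le> 0 * 0 + 0 * 0 + 3 * Q * real n powr \<alpha> * \<bar>a t\<bar> + 0 * 0 + \<eta>2 * Q"
      if t: "t \<in> {0..1}" for t
    proof -
      have "holder_at \<alpha> [wp] t \<le> \<bar>a t\<bar> * (Q * real n powr \<alpha>)"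
        using abs_ab[OF t] e mult_left_mono[OF weight[OF nL(2)], of "\<bar>a t\<bar>"] by (simp add: wp_def abs_mult)
      moreover have "holder_at \<alpha> [wt] t \<le> \<eta>2 * Q"
      proof -
        have "1 + 2 * (2 * pi * norm k) powr \<alpha> \<le> Q"
          using nL(3) \<alpha> by (auto simp: Q_def intro!: powr_mono2)
        then show ?thesis using \<theta>_le[OF t] \<eta>2 by (auto simp: wt_def intro!: mult_mono)
      qed
      moreover have "holder_at \<alpha> V t \<le> 2 * \<bar>a t\<bar> * (Q * real n powr \<alpha>)"
      proof -
        have "holder_at \<alpha> V t = size_at V t * (1 + 2 * (2 * pi * norm (k + q)) powr \<alpha>)"
          by (simp add: V_def wm_def)
        also have "\<dots> \<le> 2 * \<bar>a t\<bar> * (Q * real n powr \<alpha>)"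
          by (intro mult_mono szV[OF t] weight[OF nL(1)]) auto
        finally show ?thesis .
      qed
      ultimately show ?thesis by (simp add: U_def algebra_simps)
    qed
    have "integral {0..1} (\<lambda>t. holder_at \<alpha> U t + holder_at \<alpha> V t) \<le> integral {0..1} (\<lambda>t.
       0 * 0 + 0 * 0 + 3 * Q * real n powr \<alpha> * \<bar>a t\<bar> + 0 * 0 + \<eta>2 * Q)"
      using pt VU by (intro integral_le integrable_continuous_interval continuous_intros cab)
         (auto simp: velocity_modes_continuous)
    also have "\<dots> = 0 * integral {0..1::real} (\<lambda>t. 0) + 0 * integral {0..1::real} (\<lambda>t. 0)
       + 3 * Q * real n powr \<alpha> * integral {0..1} (\<lambda>t. \<bar>a t\<bar>) + 0 * integral {0..1::real} (\<lambda>t. 0) + \<eta>2 * Q"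
      by (intro integral_linear_combination continuous_intros cab)
    also have "\<dots> \<le> 3 * Q * real n powr \<alpha> * (C / \<mu>) + \<eta>2 * Q"
      using mult_left_mono[OF L1(1), of "3 * Q * real n powr \<alpha>"] Q by simp
    also have "\<dots> = 3 * C * Q * \<rho> + \<eta>2 * Q" unfolding \<rho>(4)[symmetric] by simp
    also have "\<dots> \<le> D / 4 * \<rho> + \<eta> / 2"
      using C S(1) Q R \<rho>(1) \<eta>2(2) by (intro add_mono mult_right_mono) (auto simp: D_def)
    also have "\<dots> \<le> \<eta>" using D\<rho> \<eta> by simp
    finally show ?thesis .
  qed
  have L2_bound: "integral {0..1} (\<lambda>t. (size_at U t + size_at V t)\<^sup>2) \<le> 6 * integral {0..1} (stress_at [e]) + \<eta>"
  proof -
    have pt: "(size_at U t + size_at V t)\<^sup>2 \<le> 0 * 0 + 0 * 0 + 0 * 0 + 18 * (a t)\<^sup>2 + \<eta>"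
      if t: "t \<in> {0..1}" for t
    proof -
      have "(size_at U t + size_at V t)\<^sup>2 \<le> (3 * \<bar>a t\<bar> + \<eta>2)\<^sup>2"
        using szU[OF t] szV[OF t] by (intro power_mono) auto
      also have "\<dots> \<le> 18 * (a t)\<^sup>2 + 2 * \<eta>2\<^sup>2"
        using sum_squares_bound[of "3 * \<bar>a t\<bar>" \<eta>2] by (simp add: power2_sum power_mult_distrib)
      also have "\<eta>2\<^sup>2 \<le> \<eta> / 2" using \<eta>2 mult_mono[of \<eta>2 1 \<eta>2 "\<eta>/2"] by (simp add: power2_eq_square)
      finally show ?thesis by simp
    qed
    have "integral {0..1} (\<lambda>t. (size_at U t + size_at V t)\<^sup>2) \<le> integral {0..1} (\<lambda>t. 0 * 0 + 0 * 0 + 0 * 0 + 18 * (a t)\<^sup>2 + \<eta>)"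
      using pt VU by (intro integral_le integrable_continuous_interval continuous_intros cab)
         (auto simp: velocity_modes_continuous)
    also have "\<dots> = 0 * integral {0..1::real} (\<lambda>t. 0) + 0 * integral {0..1::real} (\<lambda>t. 0)
       + 0 * integral {0..1::real} (\<lambda>t. 0) + 18 * integral {0..1} (\<lambda>t. (a t)\<^sup>2) + \<eta>"
      by (intro integral_linear_combination continuous_intros cab)
    also have "\<dots> \<le> 18 * R + \<eta>" using L2 by simp
    also have "R = 1 / pi * integral {0..1} (stress_at [e])"
    proof -
      have "\<bar>g t\<bar> = 1 / pi * stress_at [e] t" for t
        by (simp add: g_def c_def k_def abs_mult)
      then have "R = integral {0..1} (\<lambda>t. 1 / pi * stress_at [e] t)" unfolding R_def by (rule arg_cong[OF ext])
      then show ?thesis by (simp only: integral_mult_right)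
    qed
    also have "18 * (1 / pi * integral {0..1} (stress_at [e])) \<le> 6 * integral {0..1} (stress_at [e])"
    proof -
      have "continuous_modes [e]" using e by (auto simp: continuous_modes_def)
      then have "0 \<le> integral {0..1} (stress_at [e])"
        by (intro integral_nonneg integrable_continuous_interval continuous_intros) (auto simp: stress_at_nonneg)
      moreover have "18 * (1 / pi) \<le> 6" using pi_gt3 by (simp add: divide_le_eq)
      ultimately have "18 * (1 / pi) * integral {0..1} (stress_at [e]) \<le> 6 * integral {0..1} (stress_at [e])"
        by (rule mult_right_mono[rotated])
      then show ?thesis by simp
    qed
    finally show ?thesis by simp
  qed
  show ?thesis using approx stress_bound holder_bound L2_bound by (auto simp: correction_def)
qed

section \<open>Removing the whole error, repeatedly\<close>

lemma continuous_pair_sizes: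
  "velocity_modes U \<Longrightarrow> velocity_modes V \<Longrightarrow> continuous_on A (\<lambda>t. (size_at U t + size_at V t)\<^sup>2)"
  "velocity_modes U \<Longrightarrow> velocity_modes V \<Longrightarrow> continuous_on A (\<lambda>t. holder_at \<alpha> U t + holder_at \<alpha> V t)"
  "error_modes G \<Longrightarrow> error_modes H \<Longrightarrow> continuous_on A (\<lambda>t. stress_at G t + stress_at H t)"
  "error_modes G \<Longrightarrow> continuous_on A (stress_at G)"
  by (auto intro!: continuous_intros simp: velocity_modes_continuous error_modes_continuous)

text \<open>
  Squares of successive increments simply add up: the mixed term is at most the maximum of the old increment
  times the \<open>L\<^sup>1\<close> norm of the new one, and the new one is chosen last. This is why many waves of the error
  cost no more in \<open>L\<^sup>2\<close> than their total size.
\<close>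

lemma L2_increment:
  assumes v: "velocity_modes U" "velocity_modes V" "velocity_modes U'" "velocity_modes V'"
    and S: "\<And>t. t \<in> {0..1} \<Longrightarrow> size_at U t + size_at V t \<le> S"
  shows "integral {0..1} (\<lambda>t. (size_at (U @ U') t + size_at (V @ V') t)\<^sup>2)
    \<le> integral {0..1} (\<lambda>t. (size_at U t + size_at V t)\<^sup>2)
      + 2 * S * integral {0..1} (\<lambda>t. holder_at \<alpha> U' t + holder_at \<alpha> V' t)
      + integral {0..1} (\<lambda>t. (size_at U' t + size_at V' t)\<^sup>2)"
proof -
  let ?s = "\<lambda>t. size_at U t + size_at V t" and ?s' = "\<lambda>t. size_at U' t + size_at V' t"
    and ?h = "\<lambda>t. holder_at \<alpha> U' t + holder_at \<alpha> V' t"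
  have pt: "(size_at (U @ U') t + size_at (V @ V') t)\<^sup>2 \<le> 1 * (?s t)\<^sup>2 + 2 * S * ?h t + 1 * (?s' t)\<^sup>2 + 0 * 0 + 0"
    if t: "t \<in> {0..1}" for t
  proof -
    have "?s t * ?s' t \<le> S * ?h t"
      using S[OF t] size_le_holder by (intro mult_mono add_mono) (auto intro: add_nonneg_nonneg order.trans[OF _ S[OF t]])
    moreover have "(?s t + ?s' t)\<^sup>2 = (?s t)\<^sup>2 + 2 * (?s t * ?s' t) + (?s' t)\<^sup>2"
      by (simp only: power2_sum mult.assoc)
    moreover have eq: "size_at (U @ U') t + size_at (V @ V') t = ?s t + ?s' t" by simp
    ultimately show ?thesis unfolding eq by linarith
  qed
  have v': "velocity_modes (U @ U')" "velocity_modes (V @ V')" using v by auto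
  have "integral {0..1} (\<lambda>t. (size_at (U @ U') t + size_at (V @ V') t)\<^sup>2) \<le>
     integral {0..1} (\<lambda>t. 1 * (?s t)\<^sup>2 + 2 * S * ?h t + 1 * (?s' t)\<^sup>2 + 0 * 0 + 0)"
    using pt by (intro integral_le integrable_continuous_interval continuous_pair_sizes(1)[OF v']
        continuous_intros) (auto simp: v velocity_modes_continuous)
  also have "\<dots> = 1 * integral {0..1} (\<lambda>t. (?s t)\<^sup>2) + 2 * S * integral {0..1} ?h
     + 1 * integral {0..1} (\<lambda>t. (?s' t)\<^sup>2) + 0 * integral {0..1::real} (\<lambda>t. 0) + 0"
    by (intro integral_linear_combination continuous_pair_sizes v continuous_intros)
  finally show ?thesis by simp
qed

lemma velocity_pair_bound:
  assumes "velocity_modes U" "velocity_modes V"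
  obtains S where "0 < S" "\<And>t. t \<in> {0..1} \<Longrightarrow> size_at U t + size_at V t \<le> S"
proof -
  obtain S where "0 < S" "\<And>t. t \<in> {0..1} \<Longrightarrow> size_at (U @ V) t \<le> S"
    using continuous_modes_bound[of "U @ V"] assms velocity_modes_continuous[of "U @ V"] by auto
  then show thesis by (intro that[of S]) auto
qed

lemma integral_stress_append:
  assumes "error_modes E" "error_modes F"
  shows "integral {0..1} (\<lambda>t. stress_at E t + stress_at F t) = integral {0..1} (stress_at E) + integral {0..1} (stress_at F)"
  by (intro Henstock_Kurzweil_Integration.integral_add integrable_continuous_interval continuous_pair_sizes assms)

lemma integral_add4:
  fixes f g f' g' :: "real \<Rightarrow> real"
  assumes "continuous_on {0..1} (\<lambda>t. f t + g t)" "continuous_on {0..1} (\<lambda>t. f' t + g' t)"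
  shows "integral {0..1} (\<lambda>t. (f t + f' t) + (g t + g' t)) =
    integral {0..1} (\<lambda>t. f t + g t) + integral {0..1} (\<lambda>t. f' t + g' t)"
proof -
  have "(\<lambda>t. (f t + f' t) + (g t + g' t)) = (\<lambda>t. (f t + g t) + (f' t + g' t))" by (auto simp: fun_eq_iff)
  then show ?thesis
    using assms by (simp add: Henstock_Kurzweil_Integration.integral_add integrable_continuous_interval)
qed

lemma correction_append:
  assumes v: "velocity_modes U" "velocity_modes V" "velocity_modes U'" "velocity_modes V'"
    and e: "error_modes G" "error_modes H" "error_modes G'" "error_modes H'"
    and S: "0 < S" "\<And>t. t \<in> {0..1} \<Longrightarrow> size_at U t + size_at V t \<le> S" and \<eta>: "0 < \<eta>"
    and 1: "correction \<alpha> (\<eta> / 4) I U V G H"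
    and 2: "correction \<alpha> (min (\<eta> / 4) (\<eta> / (8 * S))) I' U' V' G' H'"
  shows "correction \<alpha> \<eta> (I + I') (U @ U') (V @ V') (G @ G') (H @ H')"
proof -
  define \<eta>' where "\<eta>' = min (\<eta> / 4) (\<eta> / (8 * S))"
  have "\<eta>' \<le> \<eta> / 4" "\<eta>' \<le> \<eta> / (8 * S)" by (simp_all add: \<eta>'_def)
  then have \<eta>': "\<eta>' \<le> \<eta> / 4" "2 * S * \<eta>' \<le> \<eta> / 4" using S(1) by (simp_all add: pos_le_divide_eq mult_ac)
  note first = 1[unfolded correction_def] and second = 2[folded \<eta>'_def, unfolded correction_def]
  have "integral {0..1} (\<lambda>t. stress_at (G @ G') t + stress_at (H @ H') t) =
     integral {0..1} (\<lambda>t. stress_at G t + stress_at H t) + integral {0..1} (\<lambda>t. stress_at G' t + stress_at H' t)"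
    unfolding stress_at_simps by (intro integral_add4 continuous_pair_sizes e)
  moreover have "integral {0..1} (\<lambda>t. holder_at \<alpha> (U @ U') t + holder_at \<alpha> (V @ V') t) =
     integral {0..1} (\<lambda>t. holder_at \<alpha> U t + holder_at \<alpha> V t) + integral {0..1} (\<lambda>t. holder_at \<alpha> U' t + holder_at \<alpha> V' t)"
    unfolding holder_at_simps by (intro integral_add4 continuous_pair_sizes v)
  moreover have "integral {0..1} (\<lambda>t. (size_at (U @ U') t + size_at (V @ V') t)\<^sup>2)
    \<le> integral {0..1} (\<lambda>t. (size_at U t + size_at V t)\<^sup>2) + \<eta> / 4
      + integral {0..1} (\<lambda>t. (size_at U' t + size_at V' t)\<^sup>2)"
  proof -
    have "2 * S * integral {0..1} (\<lambda>t. holder_at \<alpha> U' t + holder_at \<alpha> V' t) \<le> 2 * S * \<eta>'"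
      using second S(1) by (intro mult_left_mono) auto
    then have "2 * S * integral {0..1} (\<lambda>t. holder_at \<alpha> U' t + holder_at \<alpha> V' t) \<le> \<eta> / 4"
      using \<eta>'(2) by (rule order.trans)
    then show ?thesis
      by (intro order.trans[OF L2_increment[OF v, of S \<alpha>]] add_mono order_refl) (auto simp: S(2))
  qed
  moreover have "6 * (I + I') = 6 * I + 6 * I'" by simp
  ultimately show ?thesis
    unfolding correction_def using first second \<eta>' \<eta> by (intro conjI) linarith+
qed

text \<open>
  Each step creates new error waves, which are collected at the end of the list and left alone.
\<close>

lemma cancel_modes:
  assumes \<alpha>: "0 < \<alpha>" "\<alpha> < 1"
  shows "approx_solution X Y (E @ E') F \<Longrightarrow> 0 < \<eta> \<Longrightarrow>
   \<exists>U V G H. approx_solution (X @ U) (Y @ V) (E' @ G) (F @ H) \<and>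
    correction \<alpha> \<eta> (integral {0..1} (stress_at E)) U V G H"
proof (induction E arbitrary: X Y E' F \<eta>)
  case Nil
  have "(stress_at [] :: real \<Rightarrow> real) = (\<lambda>t. 0)" by auto
  then show ?case using Nil by (intro exI[of _ "[]"]) (simp add: correction_def)
next
  case (Cons e E)
  have ap: "approx_solution X Y (e # (E @ E')) F" using Cons.prems(1) by simp
  have "0 < \<eta> / 4" using Cons.prems by simp
  from cancel_one_mode[OF ap this \<alpha>] obtain U V G H where
    1: "approx_solution (X @ U) (Y @ V) (E @ (E' @ G)) (F @ H)"
      "correction \<alpha> (\<eta> / 4) (integral {0..1} (stress_at [e])) U V G H"
    by auto
  have v: "velocity_modes U" "velocity_modes V" and eG: "error_modes G" "error_modes H" "error_modes E"
    using 1(1) by (auto simp: approx_solution_def)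
  have ee: "error_modes [e]" using ap by (auto simp: approx_solution_def error_modes_Cons)
  obtain S where S: "0 < S" "\<And>t. t \<in> {0..1} \<Longrightarrow> size_at U t + size_at V t \<le> S"
    using velocity_pair_bound[OF v] by metis
  have "0 < min (\<eta> / 4) (\<eta> / (8 * S))" using S(1) Cons.prems by simp
  from Cons.IH[OF 1(1) this] obtain U' V' G' H' where
    2: "approx_solution ((X @ U) @ U') ((Y @ V) @ V') ((E' @ G) @ G') ((F @ H) @ H')"
      "correction \<alpha> (min (\<eta> / 4) (\<eta> / (8 * S))) (integral {0..1} (stress_at E)) U' V' G' H'"
    by auto
  have v': "velocity_modes U'" "velocity_modes V'" and eG': "error_modes G'" "error_modes H'"
    using 2(1) by (auto simp: approx_solution_def)
  have "stress_at (e # E) = (\<lambda>t. stress_at [e] t + stress_at E t)" by (auto simp: fun_eq_iff)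
  then have I: "integral {0..1} (stress_at (e # E)) = integral {0..1} (stress_at [e]) + integral {0..1} (stress_at E)"
    by (simp only: integral_stress_append[OF ee eG(3)])
  have "approx_solution (X @ (U @ U')) (Y @ (V @ V')) (E' @ (G @ G')) (F @ (H @ H'))" using 2(1) by simp
  then show ?case
    unfolding I using correction_append[OF v v' eG(1,2) eG' S Cons.prems(2) 1(2) 2(2)] by blast
qed

lemma cancel_errors:
  assumes \<alpha>: "0 < \<alpha>" "\<alpha> < 1" and ap: "approx_solution X Y E F" and \<eta>: "0 < \<eta>"
  shows "\<exists>U V G H. approx_solution (X @ U) (Y @ V) G H \<and>
    correction \<alpha> \<eta> (integral {0..1} (\<lambda>t. stress_at E t + stress_at F t)) U V G H"
proof -
  have ap': "approx_solution X Y (E @ []) F" using ap by simp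
  have "0 < \<eta> / 4" using \<eta> by simp
  from cancel_modes[OF \<alpha> ap' this] obtain U V G H where
    1: "approx_solution (X @ U) (Y @ V) G (F @ H)" "correction \<alpha> (\<eta> / 4) (integral {0..1} (stress_at E)) U V G H"
    by auto
  have v: "velocity_modes U" "velocity_modes V" and eG: "error_modes G" "error_modes H" "error_modes F" "error_modes E"
    using 1(1) ap by (auto simp: approx_solution_def)
  obtain S where S: "0 < S" "\<And>t. t \<in> {0..1} \<Longrightarrow> size_at U t + size_at V t \<le> S"
    using velocity_pair_bound[OF v] by metis
  have "0 < min (\<eta> / 4) (\<eta> / (8 * S))" using S(1) \<eta> by simp
  from cancel_modes[OF \<alpha> approx_solution_sym[OF 1(1)] this] obtain U' V' G' H' where
    2: "approx_solution ((Y @ V) @ V') ((X @ U) @ U') (H @ H') (G @ G')"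
      "correction \<alpha> (min (\<eta> / 4) (\<eta> / (8 * S))) (integral {0..1} (stress_at F)) V' U' H' G'"
    by auto
  have v': "velocity_modes U'" "velocity_modes V'" and eG': "error_modes G'" "error_modes H'"
    using 2(1) by (auto simp: approx_solution_def)
  have "approx_solution (X @ (U @ U')) (Y @ (V @ V')) (G @ G') (H @ H')"
    using approx_solution_sym[OF 2(1)] by simp
  then show ?thesis
    unfolding integral_stress_append[OF eG(4,3)]
    using correction_append[OF v v' eG(1,2) eG' S \<eta> 1(2) correction_sym[OF 2(2)]] by blast
qed

lemma approximating_sequence:
  assumes \<alpha>: "0 < \<alpha>" "\<alpha> < 1" and ap: "approx_solution X0 Y0 E0 F0" and \<kappa>: "0 < \<kappa>"
  obtains X Y E F U V :: "nat \<Rightarrow> mode list" and K :: real where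
    "X 0 = X0" "Y 0 = Y0" "\<And>n. X (Suc n) = X n @ U n" "\<And>n. Y (Suc n) = Y n @ V n"
    "\<And>n. approx_solution (X n) (Y n) (E n) (F n)"
    "\<And>n. integral {0..1} (\<lambda>t. stress_at (E (Suc n)) t + stress_at (F (Suc n)) t) \<le> 1 / 8 ^ Suc n"
    "\<And>n. integral {0..1} (\<lambda>t. holder_at \<alpha> (U n) t + holder_at \<alpha> (V n) t) \<le> \<kappa> / 2 ^ Suc n"
    "\<And>n. integral {0..1} (\<lambda>t. (size_at (U n) t + size_at (V n) t)\<^sup>2) \<le> K / 8 ^ n"
proof -
  (* The rate 8^(-n) leaves room for the weights 2^n in the square summability of the increments. *)
  define \<eta> where "\<eta> n = min \<kappa> 1 / 8 ^ Suc n" for n :: nat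
  define P where "P n s \<longleftrightarrow> (case s of (X, Y, E, F) \<Rightarrow> approx_solution X Y E F \<and> (n = 0 \<longrightarrow> s = (X0, Y0, E0, F0)) \<and>
      (\<forall>m. n = Suc m \<longrightarrow> integral {0..1} (\<lambda>t. stress_at E t + stress_at F t) \<le> \<eta> m))" for n :: nat
      and s :: "mode list \<times> mode list \<times> mode list \<times> mode list"
  define Q where "Q n s s' \<longleftrightarrow> (case s of (X, Y, E, F) \<Rightarrow> case s' of (X', Y', E', F') \<Rightarrow>
     \<exists>U V. X' = X @ U \<and> Y' = Y @ V \<and>
      correction \<alpha> (\<eta> n) (integral {0..1} (\<lambda>t. stress_at E t + stress_at F t)) U V E' F')" for n :: nat
      and s s' :: "mode list \<times> mode list \<times> mode list \<times> mode list"
  have \<eta>: "0 < \<eta> n" for n using \<kappa> by (simp add: \<eta>_def)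
  have "\<exists>f. \<forall>n. P n (f n) \<and> Q n (f n) (f (Suc n))"
  proof (rule dependent_nat_choice)
    show "\<exists>s. P 0 s" using ap by (intro exI[of _ "(X0, Y0, E0, F0)"]) (simp add: P_def)
    fix s n assume s: "P n s"
    obtain X Y E F where [simp]: "s = (X, Y, E, F)" by (cases s)
    have a: "approx_solution X Y E F" using s by (simp add: P_def)
    obtain U V G H where uv: "approx_solution (X @ U) (Y @ V) G H"
        "correction \<alpha> (\<eta> n) (integral {0..1} (\<lambda>t. stress_at E t + stress_at F t)) U V G H"
      using cancel_errors[OF \<alpha> a \<eta>[of n]] by auto
    show "\<exists>s'. P (Suc n) s' \<and> Q n s s'"
      using uv by (intro exI[of _ "(X @ U, Y @ V, G, H)"]) (auto simp: P_def Q_def correction_def)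
  qed
  then obtain f where f: "\<And>n. P n (f n)" "\<And>n. Q n (f n) (f (Suc n))" by auto
  define X where "X n = fst (f n)" for n
  define Y where "Y n = fst (snd (f n))" for n
  define E where "E n = fst (snd (snd (f n)))" for n
  define F where "F n = snd (snd (snd (f n)))" for n
  have fn: "f n = (X n, Y n, E n, F n)" for n by (simp add: X_def Y_def E_def F_def)
  have "\<forall>n. \<exists>U V. X (Suc n) = X n @ U \<and> Y (Suc n) = Y n @ V \<and> correction \<alpha> (\<eta> n)
      (integral {0..1} (\<lambda>t. stress_at (E n) t + stress_at (F n) t)) U V (E (Suc n)) (F (Suc n))"
    using f(2) by (simp add: Q_def fn)
  then obtain U V where step: "\<And>n. X (Suc n) = X n @ U n \<and> Y (Suc n) = Y n @ V n \<and> correction \<alpha> (\<eta> n)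
      (integral {0..1} (\<lambda>t. stress_at (E n) t + stress_at (F n) t)) (U n) (V n) (E (Suc n)) (F (Suc n))"
    unfolding choice_iff by (elim exE, intro that) (erule spec)
  then have uv: "X (Suc n) = X n @ U n" "Y (Suc n) = Y n @ V n"
      "integral {0..1} (\<lambda>t. holder_at \<alpha> (U n) t + holder_at \<alpha> (V n) t) \<le> \<eta> n"
      "integral {0..1} (\<lambda>t. (size_at (U n) t + size_at (V n) t)\<^sup>2)
        \<le> 6 * integral {0..1} (\<lambda>t. stress_at (E n) t + stress_at (F n) t) + \<eta> n" for n
    by (auto simp: correction_def)
  have ap': "approx_solution (X n) (Y n) (E n) (F n)" for n using f(1)[of n] by (simp add: P_def fn)
  have init: "X 0 = X0" "Y 0 = Y0" "E 0 = E0" "F 0 = F0" using f(1)[of 0] by (auto simp: P_def fn)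
  have st: "integral {0..1} (\<lambda>t. stress_at (E (Suc n)) t + stress_at (F (Suc n)) t) \<le> \<eta> n" for n
    using f(1)[of "Suc n"] by (simp add: P_def fn)
  have \<eta>1: "\<eta> n \<le> 1 / 8 ^ Suc n" for n
    unfolding \<eta>_def by (intro divide_right_mono) auto
  have \<eta>2: "\<eta> n \<le> \<kappa> / 2 ^ Suc n" for n
    unfolding \<eta>_def using \<kappa> by (intro frac_le power_mono) auto
  define I0 where "I0 = integral {0..1} (\<lambda>t. stress_at E0 t + stress_at F0 t)"
  have I0: "0 \<le> I0" unfolding I0_def using ap
    by (intro integral_nonneg integrable_continuous_interval continuous_pair_sizes) (auto simp: approx_solution_def)
  show thesis
  proof (rule that[of X Y U V E F "6 * I0 + 7"])
    show "integral {0..1} (\<lambda>t. (size_at (U n) t + size_at (V n) t)\<^sup>2) \<le> (6 * I0 + 7) / 8 ^ n" for n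
    proof (cases n)
      case 0
      then show ?thesis using uv(4)[of 0] init \<eta>1[of 0] by (simp add: I0_def)
    next
      case (Suc m)
      have "1 / 8 ^ Suc n \<le> (1 :: real) / 8 ^ n" by (intro frac_le power_increasing) auto
      then have "\<eta> n \<le> 1 / 8 ^ n" using \<eta>1[of n] by linarith
      moreover have "integral {0..1} (\<lambda>t. stress_at (E n) t + stress_at (F n) t) \<le> 1 / 8 ^ n"
        using st[of m] \<eta>1[of m] unfolding Suc by linarith
      ultimately have "integral {0..1} (\<lambda>t. (size_at (U n) t + size_at (V n) t)\<^sup>2) \<le> 7 * (1 / 8 ^ n)"
        using uv(4)[of n] by linarith
      also have "\<dots> \<le> (6 * I0 + 7) * (1 / 8 ^ n)" using I0 by (intro mult_right_mono) auto
      also have "\<dots> = (6 * I0 + 7) / 8 ^ n" by simp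
      finally show ?thesis .
    qed
    show "integral {0..1} (\<lambda>t. stress_at (E (Suc n)) t + stress_at (F (Suc n)) t) \<le> 1 / 8 ^ Suc n" for n
      using st[of n] \<eta>1[of n] by linarith
    show "integral {0..1} (\<lambda>t. holder_at \<alpha> (U n) t + holder_at \<alpha> (V n) t) \<le> \<kappa> / 2 ^ Suc n" for n
      using uv(3)[of n] \<eta>2[of n] by linarith
  qed (simp_all add: uv init ap')
qed

section \<open>Integration over the torus\<close>

lemma torus_cell_box: "torus_cell \<subseteq> cbox 0 1" "box 0 1 \<subseteq> torus_cell"
  by (auto simp: torus_cell_def mem_box_cart less_imp_le)

lemma torus_cell_borel [measurable, simp]: "torus_cell \<in> sets borel"
proof -
  have "torus_cell = (\<Inter>i\<in>UNIV. {x. 0 \<le> x $ i} \<inter> {x. x $ i < 1})"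
    by (auto simp: torus_cell_def)
  moreover have "{x::real^3. 0 \<le> x $ i} \<inter> {x. x $ i < 1} \<in> sets borel" for i
    by (intro sets.Int borel_closed borel_open closed_Collect_le open_Collect_less continuous_intros)
  then have "(\<Inter>i\<in>UNIV. {x::real^3. 0 \<le> x $ i} \<inter> {x. x $ i < 1}) \<in> sets borel"
    by (intro sets.finite_INT) auto
  ultimately show ?thesis by simp
qed

lemma measure_torus_cell: "emeasure lborel torus_cell = 1" "measure lebesgue torus_cell = 1"
  "torus_cell \<in> lmeasurable"
proof -
  have c: "emeasure lborel (cbox (0::real^3) 1) = 1" "emeasure lborel (box (0::real^3) 1) = 1"
    by (auto simp: emeasure_lborel_cbox_eq emeasure_lborel_box_eq Basis_vec_def inner_axis
       intro!: prod.neutral)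
  show 1: "emeasure lborel torus_cell = 1"
    using emeasure_mono[OF torus_cell_box(1), of lborel] emeasure_mono[OF torus_cell_box(2), of lborel] c
    by (intro antisym) auto
  then have 2: "emeasure lebesgue torus_cell = 1" by simp
  then show "measure lebesgue torus_cell = 1" by (simp add: measure_def)
  show "torus_cell \<in> lmeasurable" using 2 by (intro fmeasurableI) auto
qed

lemma lebesgue_on_eq_lborel:
  fixes g :: "'a::euclidean_space \<Rightarrow> 'b::{banach, second_countable_topology}"
  assumes S: "S \<in> sets borel" and g: "(\<lambda>x. indicator S x *\<^sub>R g x) \<in> borel_measurable borel"
  shows "integral\<^sup>L (lebesgue_on S) g = (\<integral>x. indicator S x *\<^sub>R g x \<partial>lborel)"
    "integrable (lebesgue_on S) g \<longleftrightarrow> integrable lborel (\<lambda>x. indicator S x *\<^sub>R g x)"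
proof -
  have S': "S \<inter> space lebesgue \<in> sets lebesgue" using S by auto
  have g': "(\<lambda>x. indicator S x *\<^sub>R g x) \<in> borel_measurable lborel" using g by simp
  show "integral\<^sup>L (lebesgue_on S) g = (\<integral>x. indicator S x *\<^sub>R g x \<partial>lborel)"
    by (simp add: integral_restrict_space[OF S'] integral_completion[OF g'])
  show "integrable (lebesgue_on S) g \<longleftrightarrow> integrable lborel (\<lambda>x. indicator S x *\<^sub>R g x)"
    by (simp add: integrable_restrict_space[OF S'] integrable_completion[OF g'])
qed

abbreviation cell_int :: "(real^3 \<Rightarrow> 'b::{banach, second_countable_topology}) \<Rightarrow> 'b" where
  "cell_int g \<equiv> integral\<^sup>L (lebesgue_on torus_cell) g"

lemma finite_measure_cell: "finite_measure (lebesgue_on torus_cell)"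
  using measure_torus_cell by (intro finite_measure_lebesgue_on) auto

lemma measure_cell [simp]: "measure (lebesgue_on torus_cell) torus_cell = 1"
  using measure_torus_cell by (subst measure_restrict_space) auto

lemma cell_bounded:
  fixes g :: "real^3 \<Rightarrow> 'b::real_normed_vector"
  assumes "continuous_on UNIV g"
  obtains C where "0 < C" "\<And>x. x \<in> torus_cell \<Longrightarrow> norm (g x) \<le> C"
proof -
  have "bounded (g ` cbox 0 1)"
    by (intro compact_imp_bounded compact_continuous_image continuous_on_subset[OF assms]) auto
  then obtain C where "\<forall>x\<in>cbox 0 1. norm (g x) \<le> C" by (auto simp: bounded_iff)
  then show thesis using torus_cell_box(1) by (intro that[of "max C 1"]) force+
qed

lemma cell_measurable:
  fixes g :: "real^3 \<Rightarrow> 'b::euclidean_space"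
  assumes "continuous_on UNIV g"
  shows "g \<in> borel_measurable (lebesgue_on torus_cell)" "(\<lambda>x. indicator torus_cell x *\<^sub>R g x) \<in> borel_measurable borel"
proof -
  have g: "g \<in> borel_measurable borel" using assms by (rule borel_measurable_continuous_onI)
  then show "(\<lambda>x. indicator torus_cell x *\<^sub>R g x) \<in> borel_measurable borel" by measurable
  show "g \<in> borel_measurable (lebesgue_on torus_cell)"
    using g by (intro measurable_restrict_space1 measurable_completion) auto
qed

lemma cell_integrable:
  fixes g :: "real^3 \<Rightarrow> 'b::euclidean_space"
  assumes "continuous_on UNIV g"
  shows "integrable (lebesgue_on torus_cell) g"
proof -
  obtain C where "0 < C" "\<And>x. x \<in> torus_cell \<Longrightarrow> norm (g x) \<le> C" using cell_bounded[OF assms] by metis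
  then show ?thesis
    by (intro finite_measure.integrable_const_bound[OF finite_measure_cell, of _ C] cell_measurable assms)
       (auto simp: AE_restrict_space_iff)
qed

lemma lborel_translate:
  fixes g :: "real^3 \<Rightarrow> real"
  assumes "g \<in> borel_measurable borel"
  shows "(\<integral>x. g (v + x) \<partial>lborel) = (\<integral>x. g x \<partial>lborel)"
proof -
  have "(\<integral>x. g x \<partial>lborel) = integral\<^sup>L (distr lborel borel ((+) v)) g" by (simp add: lborel_distr_plus)
  also have "\<dots> = (\<integral>x. g (v + x) \<partial>lborel)" using assms by (intro integral_distr) auto
  finally show ?thesis by simp
qed

lemma torus_periodic_axis: "torus_periodic g \<Longrightarrow> g (x + axis j 1) = g x"
  unfolding torus_periodic_def by (metis integer_vec_axis integer_vec_def)

lemma cell_int_translate: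
  fixes g :: "real^3 \<Rightarrow> real"
  assumes per: "torus_periodic g" and cont: "continuous_on UNIV g" and s: "0 \<le> s" "s < 1"
  shows "cell_int (\<lambda>x. g (x + s *\<^sub>R axis j 1)) = cell_int g"
proof -
  define v where "v = s *\<^sub>R (axis j 1 :: real^3)"
  have vj: "v $ i = (if i = j then s else 0)" for i by (auto simp: v_def axis_def)
  have g: "g \<in> borel_measurable borel" using cont by (rule borel_measurable_continuous_onI)
  (* Of the translated cell, A stays in the unit cell and B leaves it through the face x_j = 1; B is
     moved back by the integer vector e_j. *)
  define A B where "A = torus_cell \<inter> {x. s \<le> x $ j}" and "B = torus_cell \<inter> {x. x $ j < s}"
  have AB [measurable]: "A \<in> sets borel" "B \<in> sets borel"
    unfolding A_def B_def
    by (intro sets.Int torus_cell_borel borel_closed borel_open closed_Collect_le open_Collect_less continuous_intros)+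
  obtain C where C: "0 < C" "\<And>x. x \<in> torus_cell \<Longrightarrow> norm (g x) \<le> C" using cell_bounded[OF cont] by metis
  have bint: "integrable lborel (\<lambda>x. indicator S x * g x)" if "S \<in> sets borel" "S \<subseteq> torus_cell" for S
  proof -
    have "emeasure lborel S \<le> emeasure lborel torus_cell" using that by (intro emeasure_mono) auto
    then have "emeasure lborel S < \<infinity>" using measure_torus_cell(1) by (auto simp: le_less_trans)
    then have "integrable lborel (\<lambda>x. C * indicator S x)" using that by (intro integrable_mult_right) auto
    then show ?thesis
    proof (rule Bochner_Integration.integrable_bound)
      show "(\<lambda>x. indicator S x * g x) \<in> borel_measurable lborel" using g that(1) by measurable
      show "AE x in lborel. norm (indicator S x * g x) \<le> norm (C * indicator S x)"
        using C that(2) by (intro AE_I2) (auto simp: indicator_def subset_iff)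
    qed
  qed
  have sh: "indicator torus_cell (x - v) = (indicator A x + indicator B (x - axis j 1) :: real)" for x
  proof -
    have in_v: "x - v \<in> torus_cell \<longleftrightarrow> (\<forall>i. i \<noteq> j \<longrightarrow> 0 \<le> x $ i \<and> x $ i < 1) \<and> s \<le> x $ j \<and> x $ j < 1 + s"
      by (auto simp: torus_cell_def vj split: if_splits)
    have in_A: "x \<in> A \<longleftrightarrow> (\<forall>i. i \<noteq> j \<longrightarrow> 0 \<le> x $ i \<and> x $ i < 1) \<and> s \<le> x $ j \<and> x $ j < 1"
      using s by (auto simp: A_def torus_cell_def) (metis order.trans)
    have in_B: "x - axis j 1 \<in> B \<longleftrightarrow> (\<forall>i. i \<noteq> j \<longrightarrow> 0 \<le> x $ i \<and> x $ i < 1) \<and> 1 \<le> x $ j \<and> x $ j < 1 + s"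
    proof -
      have "x - axis j 1 \<in> B \<longleftrightarrow> (\<forall>i. 0 \<le> (x - axis j 1) $ i \<and> (x - axis j 1) $ i < 1) \<and> (x - axis j 1) $ j < s"
        by (auto simp: B_def torus_cell_def)
      also have "\<dots> \<longleftrightarrow> (\<forall>i. i \<noteq> j \<longrightarrow> 0 \<le> x $ i \<and> x $ i < 1) \<and> 1 \<le> x $ j \<and> x $ j < 1 + s"
        using s by (auto simp: axis_def split: if_splits)
      finally show ?thesis .
    qed
    show ?thesis unfolding indicator_def in_v in_A in_B using s by auto
  qed
  have "cell_int (\<lambda>x. g (x + v)) = (\<integral>x. indicator torus_cell x * g (x + v) \<partial>lborel)"
    using lebesgue_on_eq_lborel(1)[OF torus_cell_borel cell_measurable(2), of "\<lambda>x. g (x + v)"]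
    by (simp add: continuous_on_compose2[OF cont] continuous_intros)
  also have "\<dots> = (\<integral>x. (\<lambda>y. indicator torus_cell (y - v) * g y) (v + x) \<partial>lborel)"
    by (simp add: add.commute)
  also have "\<dots> = (\<integral>x. indicator torus_cell (x - v) * g x \<partial>lborel)"
    using g by (intro lborel_translate) measurable
  also have "\<dots> = (\<integral>x. indicator A x * g x + indicator B (x - axis j 1) * g x \<partial>lborel)"
    by (simp add: sh distrib_right)
  also have "\<dots> = (\<integral>x. indicator A x * g x \<partial>lborel) + (\<integral>x. indicator B (x - axis j 1) * g x \<partial>lborel)"
  proof (intro Bochner_Integration.integral_add bint)
    have "integrable (distr lborel borel ((+) (axis j 1))) (\<lambda>x. indicator B (x - axis j 1) * g x)"
    proof (subst integrable_distr_eq)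
      show "integrable lborel (\<lambda>x. indicator B (axis j 1 + x - axis j 1) * g (axis j 1 + x))"
        using bint[of B] torus_periodic_axis[OF per] AB by (simp add: B_def add.commute)
    qed (use g in measurable)
    then show "integrable lborel (\<lambda>x. indicator B (x - axis j 1) * g x)" by (simp add: lborel_distr_plus)
  qed (auto simp: A_def[symmetric] AB, auto simp: A_def)
  also have "(\<integral>x. indicator B (x - axis j 1) * g x \<partial>lborel) =
     (\<integral>x. (\<lambda>y. indicator B (y - axis j 1) * g y) (axis j 1 + x) \<partial>lborel)"
    using g by (intro lborel_translate[symmetric]) measurable
  also have "\<dots> = (\<integral>x. indicator B x * g x \<partial>lborel)"
    using torus_periodic_axis[OF per] by (simp add: add.commute)
  also have "(\<integral>x. indicator A x * g x \<partial>lborel) + (\<integral>x. indicator B x * g x \<partial>lborel) =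
      (\<integral>x. indicator A x * g x + indicator B x * g x \<partial>lborel)"
    by (intro Bochner_Integration.integral_add[symmetric] bint AB) (auto simp: A_def B_def)
  also have "\<dots> = (\<integral>x. indicator torus_cell x * g x \<partial>lborel)"
    by (intro Bochner_Integration.integral_cong) (auto simp: A_def B_def indicator_def)
  also have "\<dots> = cell_int g"
    using lebesgue_on_eq_lborel(1)[OF torus_cell_borel cell_measurable(2)[OF cont]] by simp
  finally show ?thesis by (simp add: v_def)
qed

lemma partial_line_derivative:
  fixes h :: "real^3 \<Rightarrow> real"
  assumes "h differentiable (at (x + s *\<^sub>R axis j 1))"
  shows "((\<lambda>s. h (x + s *\<^sub>R axis j 1)) has_real_derivative partial j h (x + s *\<^sub>R axis j 1)) (at s)"
proof -
  let ?y = "x + s *\<^sub>R axis j 1"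
  have "(h has_derivative frechet_derivative h (at ?y)) (at ?y)" using assms by (simp add: frechet_derivative_works)
  then have "((\<lambda>s. h (x + s *\<^sub>R axis j 1)) has_derivative (\<lambda>r. frechet_derivative h (at ?y) (r *\<^sub>R axis j 1))) (at s)"
    by (rule has_derivative_compose[rotated]) (auto intro!: derivative_eq_intros)
  moreover have "frechet_derivative h (at ?y) (r *\<^sub>R axis j 1) = partial j h ?y * r" for r
    using linear_frechet_derivative[OF assms] by (simp add: linear_cmul partial_def)
  ultimately show ?thesis by (simp add: has_field_derivative_def)
qed

text \<open>
  The difference quotients of \<open>h\<close> have integral zero by translation invariance, and they converge boundedly to
  the derivative.
\<close>

lemma cell_int_partial:
  fixes h :: "real^3 \<Rightarrow> real"
  assumes per: "torus_periodic h" and diff: "\<And>x. h differentiable (at x)"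
    and cont: "continuous_on UNIV (partial j h)"
  shows "cell_int (partial j h) = 0"
proof -
  define q where "q n x = real (n + 2) * (h (x + (1 / real (n + 2)) *\<^sub>R axis j 1) - h x)" for n x
  have ch: "continuous_on A h" for A
    by (intro continuous_at_imp_continuous_on ballI differentiable_imp_continuous_within diff)
  obtain C where C: "\<And>x. x \<in> cbox 0 (2 *\<^sub>R 1) \<Longrightarrow> \<bar>partial j h x\<bar> \<le> C"
  proof -
    have "bounded (partial j h ` cbox 0 (2 *\<^sub>R 1))"
      by (intro compact_imp_bounded compact_continuous_image continuous_on_subset[OF cont]) auto
    then show thesis using that by (auto simp: bounded_iff)
  qed
  have qc: "continuous_on UNIV (q n)" for n
    unfolding q_def by (intro continuous_intros ch continuous_on_compose2[OF ch]) auto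
  have q0: "cell_int (q n) = 0" for n
  proof -
    have c1: "continuous_on UNIV (\<lambda>x. h (x + (1 / real (n + 2)) *\<^sub>R axis j 1))"
      by (intro continuous_intros continuous_on_compose2[OF ch]) auto
    have "cell_int (q n) = real (n + 2) * (cell_int (\<lambda>x. h (x + (1 / real (n + 2)) *\<^sub>R axis j 1)) - cell_int h)"
      unfolding q_def using cell_integrable[OF c1] cell_integrable[OF ch] by simp
    then show ?thesis using cell_int_translate[OF per ch, of "1 / real (n + 2)" j] by simp
  qed
  have lim: "(\<lambda>n. q n x) \<longlonglongrightarrow> partial j h x" for x
  proof -
    have "((\<lambda>s. (h (x + s *\<^sub>R axis j 1) - h x) / s) \<longlongrightarrow> partial j h x) (at 0)"
      using partial_line_derivative[of h x 0 j] diff by (simp add: DERIV_def)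
    moreover have "filterlim (\<lambda>n. 1 / real (n + 2)) (at 0) sequentially"
    proof -
      have "(\<lambda>n. 1 / real (n + 2)) \<longlonglongrightarrow> 0"
        using LIMSEQ_ignore_initial_segment[OF lim_1_over_n, of 2] by simp
      then show ?thesis by (auto simp: filterlim_at)
    qed
    ultimately have "(\<lambda>n. (h (x + (1 / real (n + 2)) *\<^sub>R axis j 1) - h x) / (1 / real (n + 2))) \<longlonglongrightarrow> partial j h x"
      by (rule filterlim_compose)
    then show ?thesis by (simp add: q_def mult.commute)
  qed
  have bd: "\<bar>q n x\<bar> \<le> C" if x: "x \<in> torus_cell" for n x
  proof -
    let ?\<delta> = "1 / real (n + 2)"
    obtain z where z: "0 < z" "z < ?\<delta>"
      "h (x + ?\<delta> *\<^sub>R axis j 1) - h (x + 0 *\<^sub>R axis j 1) = (?\<delta> - 0) * partial j h (x + z *\<^sub>R axis j 1)"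
      using MVT2[of 0 ?\<delta> "\<lambda>s. h (x + s *\<^sub>R axis j 1)" "\<lambda>s. partial j h (x + s *\<^sub>R axis j 1)"]
        partial_line_derivative[of h x _ j] diff by auto
    have "?\<delta> \<le> 1" by simp
    then have z1: "z \<le> 1" using z(2) by linarith
    have "x + z *\<^sub>R axis j 1 \<in> cbox 0 (2 *\<^sub>R 1)"
      unfolding mem_box_cart
    proof (intro allI conjI)
      fix i
      have "0 \<le> x $ i" "x $ i < 1" using x by (auto simp: torus_cell_def)
      moreover have "0 \<le> (z *\<^sub>R axis j 1 :: real^3) $ i" "(z *\<^sub>R axis j 1 :: real^3) $ i \<le> 1"
        using z(1) z1 by (auto simp: axis_def)
      ultimately show "(0 :: real^3) $ i \<le> (x + z *\<^sub>R axis j 1) $ i"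
        "(x + z *\<^sub>R axis j 1) $ i \<le> (2 *\<^sub>R 1 :: real^3) $ i" by auto
    qed
    then have "\<bar>partial j h (x + z *\<^sub>R axis j 1)\<bar> \<le> C" by (rule C)
    moreover have "q n x = partial j h (x + z *\<^sub>R axis j 1)" using z(3) by (simp add: q_def field_simps)
    ultimately show ?thesis by simp
  qed
  have "(\<lambda>n. cell_int (q n)) \<longlonglongrightarrow> cell_int (partial j h)"
  proof (rule integral_dominated_convergence[where w = "\<lambda>_. C"])
    show "integrable (lebesgue_on torus_cell) (\<lambda>_. C)"
      by (intro finite_measure.integrable_const finite_measure_cell)
  qed (use lim bd in \<open>auto intro!: cell_measurable qc cont simp: AE_restrict_space_iff\<close>)
  then show ?thesis unfolding q0 by (simp add: LIMSEQ_const_iff)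
qed

section \<open>Plane waves tested against a smooth field\<close>

definition wave :: "real^3 \<Rightarrow> real \<Rightarrow> real^3 \<Rightarrow> real" where
  "wave k p x = cos (2 * pi * (k \<bullet> x) + p)"

lemma abs_wave_le [simp]: "\<bar>wave k p x\<bar> \<le> 1"
  by (simp add: wave_def)

lemma continuous_wave [continuous_intros]: "continuous_on A (wave k p)"
  unfolding wave_def by (intro continuous_intros)

lemma wave_periodic: "integer_vec k \<Longrightarrow> torus_periodic (wave k p)"
  unfolding torus_periodic_def
proof (intro allI impI)
  fix x n :: "real^3"
  assume k: "integer_vec k" and n: "\<forall>i. n $ i \<in> \<int>"
  then have "k \<bullet> n \<in> \<int>" by (auto simp: integer_vec_def)
  then obtain m where m: "k \<bullet> n = of_int m" by (auto elim: Ints_cases)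
  have "cos ((2 * pi * (k \<bullet> x) + p) + 2 * pi * of_int m) = cos (2 * pi * (k \<bullet> x) + p)"
    by (simp only: cos_add[of "2 * pi * (k \<bullet> x) + p"] cos_int_2pin sin_int_2pin)
  then show "wave k p (x + n) = wave k p x"
    by (simp add: wave_def inner_add_right m algebra_simps)
qed

lemma wave_has_derivative:
  "(wave k p has_derivative (\<lambda>h. - (2 * pi * (k \<bullet> h)) * wave k (p - pi/2) x)) (at x)"
proof -
  have "wave k (p - pi/2) x = cos ((2 * pi * (k \<bullet> x) + p) - pi/2)"
    by (simp add: wave_def add_diff_eq)
  also have "\<dots> = sin (2 * pi * (k \<bullet> x) + p)" by (simp only: cos_diff cos_pi_half sin_pi_half mult_zero_right mult_1_right add_0)
  finally have sin: "wave k (p - pi/2) x = sin (2 * pi * (k \<bullet> x) + p)" .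
  have "((\<lambda>x. cos (2 * pi * (k \<bullet> x) + p)) has_derivative
      (\<lambda>h. - sin (2 * pi * (k \<bullet> x) + p) * (2 * pi * (k \<bullet> h)))) (at x)"
    by (auto intro!: derivative_eq_intros)
  then show ?thesis unfolding sin by (simp add: wave_def[abs_def] mult.commute)
qed

lemma wave_mult:
  "wave k p x * wave l q x = (wave (k + l) (p + q) x + wave (k - l) (p - q) x) / 2"
proof -
  have "cos A * cos B = (cos (A + B) + cos (A - B)) / 2" for A B :: real
    by (simp add: cos_times_cos add.commute)
  from this[of "2 * pi * (k \<bullet> x) + p" "2 * pi * (l \<bullet> x) + q"]
  show ?thesis by (simp add: wave_def inner_add_left inner_diff_left algebra_simps)
qed

definition field :: "mode list \<Rightarrow> real \<Rightarrow> real^3 \<Rightarrow> real^3" where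
  "field X t x = (\<Sum>m\<leftarrow>X. (amp m t * wave (freq m) (phase m) x) *\<^sub>R dir m)"

lemma field_list_simps [simp]:
  "field [] t x = 0"
  "field (m # X) t x = (amp m t * wave (freq m) (phase m) x) *\<^sub>R dir m + field X t x"
  "field (X @ Y) t x = field X t x + field Y t x"
  by (auto simp: field_def)

lemma norm_field_le: "norm (field X t x) \<le> size_at X t"
proof (induction X)
  case (Cons m X)
  have "norm ((amp m t * wave (freq m) (phase m) x) *\<^sub>R dir m) \<le> \<bar>amp m t\<bar> * norm (dir m)"
    by (simp add: abs_mult mult_right_mono mult_left_le)
  then show ?case using Cons norm_triangle_ineq[of "(amp m t * wave (freq m) (phase m) x) *\<^sub>R dir m" "field X t x"]
    by simp
qed simp

text \<open>
  The properties of a test field at a fixed time that matter here, with a bound \<open>B\<close> for its gradient.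
\<close>

definition test_slice :: "(real^3 \<Rightarrow> real^3) \<Rightarrow> real \<Rightarrow> bool" where
  "test_slice \<phi> B \<longleftrightarrow> torus_periodic \<phi> \<and> (\<forall>x. \<phi> differentiable (at x)) \<and>
     (\<forall>j. continuous_on UNIV (partial j \<phi>)) \<and> (\<forall>x. divergence \<phi> x = 0) \<and>
     (\<forall>j. \<forall>x\<in>torus_cell. norm (partial j \<phi> x) \<le> B)"

lemma partial_component:
  fixes \<phi> :: "real^3 \<Rightarrow> real^3"
  assumes "\<phi> differentiable (at x)"
  shows "(\<lambda>x. \<phi> x $ i) differentiable (at x)" "partial j (\<lambda>x. \<phi> x $ i) x = partial j \<phi> x $ i"
proof -
  have "(\<phi> has_derivative frechet_derivative \<phi> (at x)) (at x)" using assms by (simp add: frechet_derivative_works)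
  then have d: "((\<lambda>x. \<phi> x $ i) has_derivative (\<lambda>h. frechet_derivative \<phi> (at x) h $ i)) (at x)"
    by (rule bounded_linear.has_derivative[OF bounded_linear_vec_nth])
  then show "(\<lambda>x. \<phi> x $ i) differentiable (at x)" by (auto simp: differentiable_def)
  show "partial j (\<lambda>x. \<phi> x $ i) x = partial j \<phi> x $ i"
    unfolding partial_def frechet_derivative_at[OF d, symmetric] by simp
qed

lemma differentiable_continuous_on:
  assumes "\<And>x. f differentiable (at x)"
  shows "continuous_on A (f :: real^3 \<Rightarrow> 'b::real_normed_vector)"
  by (intro continuous_at_imp_continuous_on ballI differentiable_imp_continuous_within assms)

lemma wave_ibp:
  fixes u :: "real^3 \<Rightarrow> real"
  assumes k: "integer_vec k" and u: "torus_periodic u" "\<And>x. u differentiable (at x)" "continuous_on UNIV (partial j u)"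
  shows "cell_int (\<lambda>x. wave k p x * partial j u x) = 2 * pi * k $ j * cell_int (\<lambda>x. wave k (p - pi/2) x * u x)"
proof -
  have d: "((\<lambda>x. wave k p x * u x) has_derivative
     (\<lambda>h. wave k p x * frechet_derivative u (at x) h + (- (2 * pi * (k \<bullet> h)) * wave k (p - pi/2) x) * u x)) (at x)" for x
    using u(2)[of x] by (intro has_derivative_mult wave_has_derivative) (simp add: frechet_derivative_works)
  have kj: "k \<bullet> axis j 1 = k $ j" by (simp add: inner_axis)
  have p: "partial j (\<lambda>x. wave k p x * u x) x = wave k p x * partial j u x - 2 * pi * k $ j * (wave k (p - pi/2) x * u x)" for x
    unfolding partial_def frechet_derivative_at[OF d, symmetric] kj by simp
  have cu: "continuous_on UNIV u" using u(2) by (rule differentiable_continuous_on)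
  have "cell_int (partial j (\<lambda>x. wave k p x * u x)) = 0"
  proof (rule cell_int_partial)
    show "torus_periodic (\<lambda>x. wave k p x * u x)"
      using u(1) wave_periodic[OF k, of p] by (simp add: torus_periodic_def)
    show "(\<lambda>x. wave k p x * u x) differentiable (at x)" for x using d by (auto simp: differentiable_def)
    show "continuous_on UNIV (partial j (\<lambda>x. wave k p x * u x))"
      unfolding p[abs_def] by (intro continuous_intros cu u(3))
  qed
  moreover have "cell_int (partial j (\<lambda>x. wave k p x * u x)) =
     cell_int (\<lambda>x. wave k p x * partial j u x) - 2 * pi * k $ j * cell_int (\<lambda>x. wave k (p - pi/2) x * u x)"
    unfolding p[abs_def]
    by (subst Bochner_Integration.integral_diff) (auto intro!: cell_integrable continuous_intros cu u(3))
  ultimately show ?thesis by simp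
qed

text \<open>
  A Fourier coefficient with an arbitrary phase in place of the complex exponential.
\<close>

definition coeff :: "(real^3 \<Rightarrow> real^3) \<Rightarrow> real^3 \<Rightarrow> real \<Rightarrow> real^3" where
  "coeff \<phi> k p = cell_int (\<lambda>x. wave k p x *\<^sub>R \<phi> x)"

lemma inner_coeff:
  assumes "continuous_on UNIV \<phi>"
  shows "c \<bullet> coeff \<phi> k p = cell_int (\<lambda>x. wave k p x * (c \<bullet> \<phi> x))"
  unfolding coeff_def using cell_integrable[of "\<lambda>x. wave k p x *\<^sub>R \<phi> x"] assms
  by (subst integral_inner_right[symmetric]) (auto intro!: continuous_intros)

lemma coeff_component:
  assumes "continuous_on UNIV \<phi>"
  shows "coeff \<phi> k p $ i = cell_int (\<lambda>x. wave k p x * \<phi> x $ i)"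
  using inner_coeff[OF assms, of "axis i 1"] by (simp add: inner_axis')

text \<open>
  The contraction of \<open>\<nabla>\<phi>\<close> with \<open>u \<otimes> w\<close> in the weak formulation.
\<close>

definition bilin :: "(real^3 \<Rightarrow> real^3) \<Rightarrow> (real^3 \<Rightarrow> real^3) \<Rightarrow> (real^3 \<Rightarrow> real^3) \<Rightarrow> real^3 \<Rightarrow> real" where
  "bilin \<phi> u w x = (\<Sum>i\<in>UNIV. \<Sum>j\<in>UNIV. partial j \<phi> x $ i * (u x $ j * w x $ i))"

context
  fixes \<phi> :: "real^3 \<Rightarrow> real^3" and B :: real
  assumes ts: "test_slice \<phi> B"
begin

lemma test_slice_facts:
  "torus_periodic (\<lambda>x. \<phi> x $ i)" "(\<lambda>x. \<phi> x $ i) differentiable (at x)"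
  "partial j (\<lambda>x. \<phi> x $ i) = (\<lambda>x. partial j \<phi> x $ i)"
  "continuous_on UNIV (\<lambda>x. partial j \<phi> x $ i)" "continuous_on A \<phi>"
  "x \<in> torus_cell \<Longrightarrow> \<bar>partial j \<phi> x $ i\<bar> \<le> B" "0 \<le> B"
proof -
  have d: "\<phi> differentiable (at x)" for x using ts by (simp add: test_slice_def)
  show "torus_periodic (\<lambda>x. \<phi> x $ i)" using ts by (simp add: test_slice_def torus_periodic_def)
  show "(\<lambda>x. \<phi> x $ i) differentiable (at x)" "partial j (\<lambda>x. \<phi> x $ i) = (\<lambda>x. partial j \<phi> x $ i)"
    using partial_component[OF d] by (auto simp: fun_eq_iff)
  show "continuous_on UNIV (\<lambda>x. partial j \<phi> x $ i)"
    using ts by (intro continuous_intros) (simp add: test_slice_def)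
  show "continuous_on A \<phi>" using d by (rule differentiable_continuous_on)
  have *: "norm (partial j \<phi> x) \<le> B" if "x \<in> torus_cell" for x j using ts that by (auto simp: test_slice_def)
  show "\<bar>partial j \<phi> x $ i\<bar> \<le> B" if "x \<in> torus_cell"
    using *[OF that, of j] component_le_norm_cart[of "partial j \<phi> x" i] by linarith
  have "0 \<in> torus_cell" by (simp add: torus_cell_def)
  from *[OF this, of 1] show "0 \<le> B" by (meson norm_ge_zero order.trans)
qed

lemma coeff_ibp:
  assumes "integer_vec k"
  shows "cell_int (\<lambda>x. wave k p x * partial j \<phi> x $ i) = 2 * pi * k $ j * coeff \<phi> k (p - pi/2) $ i"
  using wave_ibp[OF assms test_slice_facts(1,2), of j i p] test_slice_facts by (simp add: coeff_component)

lemma coeff_solenoidal: "solenoidal (coeff \<phi>)"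
  unfolding solenoidal_def
proof (intro allI impI)
  fix k p assume k: "integer_vec k"
  have "2 * pi * (coeff \<phi> k p \<bullet> k) = (\<Sum>j\<in>UNIV. 2 * pi * k $ j * coeff \<phi> k ((p + pi/2) - pi/2) $ j)"
    by (simp add: inner_vec_def sum_distrib_left mult_ac)
  also have "\<dots> = (\<Sum>j\<in>UNIV. cell_int (\<lambda>x. wave k (p + pi/2) x * partial j \<phi> x $ j))"
    by (simp only: coeff_ibp[OF k])
  also have "\<dots> = cell_int (\<lambda>x. \<Sum>j\<in>UNIV. wave k (p + pi/2) x * partial j \<phi> x $ j)"
    by (intro Bochner_Integration.integral_sum[symmetric] cell_integrable continuous_intros test_slice_facts)
  also have "\<dots> = cell_int (\<lambda>x. wave k (p + pi/2) x * divergence \<phi> x)"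
    by (simp add: divergence_def sum_distrib_left)
  also have "\<dots> = 0" using ts by (simp add: test_slice_def)
  finally show "coeff \<phi> k p \<bullet> k = 0" by simp
qed

text \<open>
  One derivative of the test field is traded for a factor \<open>k $ j\<close>. This is what makes the stress, rather
  than the size, the right measure for errors.
\<close>

lemma coeff_bound:
  assumes k: "integer_vec k"
  shows "norm (coeff \<phi> k p) * norm k \<le> 9 * B"
proof -
  have *: "\<bar>k $ j\<bar> * \<bar>coeff \<phi> k p $ i\<bar> \<le> B" for i j
  proof -
    have "\<bar>cell_int (\<lambda>x. wave k (p + pi/2) x * partial j \<phi> x $ i)\<bar> \<le> cell_int (\<lambda>x. B)"
    proof (subst real_norm_def[symmetric], rule Bochner_Integration.integral_norm_bound_integral)
      fix x assume "x \<in> space (lebesgue_on torus_cell)"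
      then have x: "x \<in> torus_cell" by simp
      have "\<bar>wave k (p + pi/2) x\<bar> * \<bar>partial j \<phi> x $ i\<bar> \<le> 1 * B"
        using test_slice_facts(6)[OF x] by (intro mult_mono) auto
      then show "norm (wave k (p + pi/2) x * partial j \<phi> x $ i) \<le> B" by (simp add: abs_mult)
    qed (intro cell_integrable continuous_intros test_slice_facts)+
    also have "cell_int (\<lambda>x. B) = B" using finite_measure_cell by simp
    also have "cell_int (\<lambda>x. wave k (p + pi/2) x * partial j \<phi> x $ i) = 2 * pi * (k $ j * coeff \<phi> k p $ i)"
      using coeff_ibp[OF k, of "p + pi/2" j i] by simp
    finally have "2 * pi * (\<bar>k $ j\<bar> * \<bar>coeff \<phi> k p $ i\<bar>) \<le> B" by (simp add: abs_mult)
    moreover have "1 * (\<bar>k $ j\<bar> * \<bar>coeff \<phi> k p $ i\<bar>) \<le> 2 * pi * (\<bar>k $ j\<bar> * \<bar>coeff \<phi> k p $ i\<bar>)"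
      using pi_gt3 by (intro mult_right_mono) auto
    ultimately show ?thesis by simp
  qed
  have "norm (coeff \<phi> k p) * norm k \<le> (\<Sum>i\<in>UNIV. \<bar>coeff \<phi> k p $ i\<bar>) * (\<Sum>j\<in>UNIV. \<bar>k $ j\<bar>)"
    by (intro mult_mono norm_le_l1_cart) (auto intro: sum_nonneg)
  also have "\<dots> = (\<Sum>i\<in>UNIV. \<Sum>j\<in>UNIV. \<bar>coeff \<phi> k p $ i\<bar> * \<bar>k $ j\<bar>)"
    by (rule sum_product)
  also have "\<dots> \<le> (\<Sum>i\<in>(UNIV::3 set). \<Sum>j\<in>(UNIV::3 set). B)"
    by (intro sum_mono) (subst mult.commute, rule *)
  finally show ?thesis by simp
qed

lemma pairing_coeff_bound:
  assumes "error_modes E"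
  shows "\<bar>pairing (coeff \<phi>) E t\<bar> \<le> 9 * B * stress_at E t"
  using assms
proof (induction E)
  case (Cons m E)
  have k: "integer_vec (freq m)" "freq m \<noteq> 0" using Cons.prems by (auto simp: error_modes_Cons)
  have "\<bar>dir m \<bullet> coeff \<phi> (freq m) (phase m)\<bar> \<le> norm (dir m) * norm (coeff \<phi> (freq m) (phase m))"
    by (rule Cauchy_Schwarz_ineq2)
  also have "\<dots> \<le> norm (dir m) * (9 * B / norm (freq m))"
    using coeff_bound[OF k(1), of "phase m"] k(2) by (intro mult_left_mono) (auto simp: field_simps)
  finally have "\<bar>amp m t\<bar> * \<bar>dir m \<bullet> coeff \<phi> (freq m) (phase m)\<bar> \<le> \<bar>amp m t\<bar> * (norm (dir m) * (9 * B / norm (freq m)))"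
    by (intro mult_left_mono) auto
  then have "\<bar>amp m t * (dir m \<bullet> coeff \<phi> (freq m) (phase m))\<bar> \<le> 9 * B * (\<bar>amp m t\<bar> * norm (dir m) / norm (freq m))"
    by (simp add: abs_mult mult_ac)
  moreover have "\<bar>pairing (coeff \<phi>) E t\<bar> \<le> 9 * B * stress_at E t" using Cons by (auto simp: error_modes_Cons)
  ultimately show ?case unfolding pairing_simps stress_at_simps distrib_left by linarith
qed simp

lemma continuous_field_space [continuous_intros]: "continuous_on A (field X t)"
  unfolding field_def by (induction X) (auto intro!: continuous_intros)

lemma pairing_field: "cell_int (\<lambda>x. field X t x \<bullet> \<phi> x) = pairing (coeff \<phi>) X t"
proof (induction X)
  case (Cons m X)
  have "cell_int (\<lambda>x. field (m # X) t x \<bullet> \<phi> x) =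
    cell_int (\<lambda>x. amp m t * (wave (freq m) (phase m) x * (dir m \<bullet> \<phi> x)) + field X t x \<bullet> \<phi> x)"
    by (simp add: inner_add_left mult.assoc)
  also have "\<dots> = cell_int (\<lambda>x. amp m t * (wave (freq m) (phase m) x * (dir m \<bullet> \<phi> x))) + cell_int (\<lambda>x. field X t x \<bullet> \<phi> x)"
    by (intro Bochner_Integration.integral_add cell_integrable continuous_intros test_slice_facts)
  finally show ?case using Cons by (simp add: inner_coeff[OF test_slice_facts(5)])
qed simp

lemma bilin_continuous [continuous_intros]:
  "continuous_on UNIV u \<Longrightarrow> continuous_on UNIV w \<Longrightarrow> continuous_on UNIV (bilin \<phi> u w)"
  unfolding bilin_def by (intro continuous_intros test_slice_facts)

lemma bilin_simps:
  "bilin \<phi> (\<lambda>x. u x + u' x) w = (\<lambda>x. bilin \<phi> u w x + bilin \<phi> u' w x)"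
  "bilin \<phi> u (\<lambda>x. w x + w' x) = (\<lambda>x. bilin \<phi> u w x + bilin \<phi> u w' x)"
  "bilin \<phi> (\<lambda>x. 0) w = (\<lambda>x. 0)" "bilin \<phi> u (\<lambda>x. 0) = (\<lambda>x. 0)"
  by (simp_all add: bilin_def algebra_simps sum.distrib fun_eq_iff)

lemma bilin_modes:
  assumes m: "integer_vec (freq m)" "dir m \<bullet> freq m = 0" and m': "integer_vec (freq m')"
  shows "cell_int (bilin \<phi> (\<lambda>x. (amp m t * wave (freq m) (phase m) x) *\<^sub>R dir m)
      (\<lambda>x. (amp m' t * wave (freq m') (phase m') x) *\<^sub>R dir m')) = - pairing (coeff \<phi>) (advect1 m m') t"
proof -
  let ?a = "amp m t * amp m' t" and ?k = "freq m" and ?l = "freq m'" and ?p = "phase m" and ?q = "phase m'"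
    and ?d = "dir m" and ?c = "dir m'"
  have eq: "bilin \<phi> (\<lambda>x. (amp m t * wave ?k ?p x) *\<^sub>R ?d) (\<lambda>x. (amp m' t * wave ?l ?q x) *\<^sub>R ?c) x =
    (\<Sum>i\<in>UNIV. \<Sum>j\<in>UNIV. (?a * ?d $ j * ?c $ i / 2) * (wave (?k + ?l) (?p + ?q) x * partial j \<phi> x $ i)
      + (?a * ?d $ j * ?c $ i / 2) * (wave (?k - ?l) (?p - ?q) x * partial j \<phi> x $ i))" for x
    unfolding bilin_def
  proof (intro sum.cong refl)
    fix i j
    have "partial j \<phi> x $ i * (((amp m t * wave ?k ?p x) *\<^sub>R ?d) $ j * ((amp m' t * wave ?l ?q x) *\<^sub>R ?c) $ i)
      = ?a * ?d $ j * ?c $ i * partial j \<phi> x $ i * (wave ?k ?p x * wave ?l ?q x)" by simp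
    then show "partial j \<phi> x $ i * (((amp m t * wave ?k ?p x) *\<^sub>R ?d) $ j * ((amp m' t * wave ?l ?q x) *\<^sub>R ?c) $ i)
      = (?a * ?d $ j * ?c $ i / 2) * (wave (?k + ?l) (?p + ?q) x * partial j \<phi> x $ i)
      + (?a * ?d $ j * ?c $ i / 2) * (wave (?k - ?l) (?p - ?q) x * partial j \<phi> x $ i)"
      unfolding wave_mult by (simp add: field_simps)
  qed
  have I: "integrable (lebesgue_on torus_cell) (\<lambda>x. wave r s x * partial j \<phi> x $ i)" for r s i j
    by (intro cell_integrable continuous_intros test_slice_facts)
  have S: "(\<Sum>i\<in>UNIV. \<Sum>j\<in>UNIV. (?a * ?d $ j * ?c $ i / 2) * cell_int (\<lambda>x. wave r s x * partial j \<phi> x $ i))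
     = pi * ?a * (?d \<bullet> r) * (?c \<bullet> coeff \<phi> r (s - pi/2))" if "integer_vec r" for r s
  proof -
    have "(\<Sum>i\<in>UNIV. \<Sum>j\<in>UNIV. (?a * ?d $ j * ?c $ i / 2) * cell_int (\<lambda>x. wave r s x * partial j \<phi> x $ i))
      = (\<Sum>i\<in>UNIV. \<Sum>j\<in>UNIV. pi * ?a * ((?d $ j * r $ j) * (?c $ i * coeff \<phi> r (s - pi/2) $ i)))"
      by (intro sum.cong refl) (simp add: coeff_ibp[OF that])
    also have "\<dots> = pi * ?a * ((?d \<bullet> r) * (?c \<bullet> coeff \<phi> r (s - pi/2)))"
    proof -
      have "(?d \<bullet> r) * (?c \<bullet> coeff \<phi> r (s - pi/2)) = (\<Sum>j\<in>UNIV. \<Sum>i\<in>UNIV. (?d $ j * r $ j) * (?c $ i * coeff \<phi> r (s - pi/2) $ i))"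
        by (simp only: inner_vec_def inner_real_def sum_product)
      also have "\<dots> = (\<Sum>i\<in>UNIV. \<Sum>j\<in>UNIV. (?d $ j * r $ j) * (?c $ i * coeff \<phi> r (s - pi/2) $ i))"
        by (rule sum.swap)
      finally show ?thesis by (simp only: sum_distrib_left)
    qed
    finally show ?thesis by simp
  qed
  have "cell_int (bilin \<phi> (\<lambda>x. (amp m t * wave ?k ?p x) *\<^sub>R ?d) (\<lambda>x. (amp m' t * wave ?l ?q x) *\<^sub>R ?c)) =
     (\<Sum>i\<in>UNIV. \<Sum>j\<in>UNIV. (?a * ?d $ j * ?c $ i / 2) * cell_int (\<lambda>x. wave (?k + ?l) (?p + ?q) x * partial j \<phi> x $ i)
      + (?a * ?d $ j * ?c $ i / 2) * cell_int (\<lambda>x. wave (?k - ?l) (?p - ?q) x * partial j \<phi> x $ i))"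
    unfolding eq[abs_def]
    by (simp add: I Bochner_Integration.integral_sum Bochner_Integration.integral_add
        Bochner_Integration.integrable_sum Bochner_Integration.integrable_add)
  also have "\<dots> = pi * ?a * (?d \<bullet> (?k + ?l)) * (?c \<bullet> coeff \<phi> (?k + ?l) (?p + ?q - pi/2))
     + pi * ?a * (?d \<bullet> (?k - ?l)) * (?c \<bullet> coeff \<phi> (?k - ?l) (?p - ?q - pi/2))"
    unfolding sum.distrib using S m m' by (simp add: integer_vec_add integer_vec_diff)
  also have "\<dots> = - pairing (coeff \<phi>) (advect1 m m') t"
    using m(2) by (simp add: advect1_def inner_add_right inner_diff_right)
  finally show ?thesis .
qed

lemma bilin_field:
  assumes "velocity_modes Y" "velocity_modes X"
  shows "cell_int (bilin \<phi> (field Y t) (field X t)) = - pairing (coeff \<phi>) (advect Y X) t"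
  using assms(1)
proof (induction Y)
  case Nil
  have "field [] t = (\<lambda>x. 0)" by auto
  then show ?case by (simp add: bilin_simps)
next
  case (Cons m Y)
  let ?u = "\<lambda>x. (amp m t * wave (freq m) (phase m) x) *\<^sub>R dir m"
  have cu: "continuous_on UNIV ?u" by (intro continuous_intros)
  have m: "integer_vec (freq m)" "dir m \<bullet> freq m = 0" using Cons.prems by (auto simp: velocity_modes_Cons)
  have 1: "cell_int (bilin \<phi> ?u (field X t)) = - pairing (coeff \<phi>) (concat (map (advect1 m) X)) t"
    using assms(2)
  proof (induction X)
    case Nil
    have "field [] t = (\<lambda>x. 0)" by auto
    then show ?case by (simp add: bilin_simps)
  next
    case (Cons m' X)
    let ?w = "\<lambda>x. (amp m' t * wave (freq m') (phase m') x) *\<^sub>R dir m'"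
    have cw: "continuous_on UNIV ?w" by (intro continuous_intros)
    have "field (m' # X) t = (\<lambda>x. ?w x + field X t x)" by (auto simp: fun_eq_iff)
    then have "cell_int (bilin \<phi> ?u (field (m' # X) t)) = cell_int (\<lambda>x. bilin \<phi> ?u ?w x + bilin \<phi> ?u (field X t) x)"
      by (simp only: bilin_simps)
    also have "\<dots> = cell_int (bilin \<phi> ?u ?w) + cell_int (bilin \<phi> ?u (field X t))"
      by (intro Bochner_Integration.integral_add cell_integrable bilin_continuous cu cw continuous_field_space)
    finally have F: "cell_int (bilin \<phi> ?u (field (m' # X) t)) = cell_int (bilin \<phi> ?u ?w) + cell_int (bilin \<phi> ?u (field X t))" .
    have v: "integer_vec (freq m')" "velocity_modes X" using Cons.prems by (auto simp: velocity_modes_Cons)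
    show ?case unfolding F bilin_modes[OF m v(1)] Cons.IH[OF v(2)] by simp
  qed
  have "field (m # Y) t = (\<lambda>x. ?u x + field Y t x)" by (auto simp: fun_eq_iff)
  then have "cell_int (bilin \<phi> (field (m # Y) t) (field X t)) = cell_int (\<lambda>x. bilin \<phi> ?u (field X t) x + bilin \<phi> (field Y t) (field X t) x)"
    by (simp only: bilin_simps)
  also have "\<dots> = cell_int (bilin \<phi> ?u (field X t)) + cell_int (bilin \<phi> (field Y t) (field X t))"
    by (intro Bochner_Integration.integral_add cell_integrable bilin_continuous cu continuous_field_space)
  finally have F: "cell_int (bilin \<phi> (field (m # Y) t) (field X t)) =
      cell_int (bilin \<phi> ?u (field X t)) + cell_int (bilin \<phi> (field Y t) (field X t))" .
  have v: "velocity_modes Y" using Cons.prems by (auto simp: velocity_modes_Cons)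
  show ?case unfolding F 1 Cons.IH[OF v] by simp
qed

end

section \<open>Integration over space and time\<close>

text \<open>
  Test fields are only controlled for times less than 1. The final time is a null set, and leaving it out
  gives sets on which everything is Borel measurable.
\<close>

abbreviation slab :: "(real \<times> (real^3)) set" where
  "slab \<equiv> {0..<1} \<times> torus_cell"

lemma slab_borel [measurable, simp]: "slab \<in> sets borel" "{0..1::real} \<times> torus_cell \<in> sets borel"
  by (metis borel_Times atLeastLessThan_borel atLeastAtMost_borel torus_cell_borel)+

lemma emeasure_slab: "emeasure lborel slab = 1"
proof -
  have "emeasure lborel slab = emeasure (lborel \<Otimes>\<^sub>M lborel) slab" by (simp only: lborel_prod)
  also have "\<dots> = emeasure lborel {0..<1::real} * emeasure lborel torus_cell"
    by (intro lborel.emeasure_pair_measure_Times) auto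
  finally show ?thesis by (simp add: measure_torus_cell)
qed

lemma spacetime_AE_slab:
  "AE p in lebesgue. p \<in> {0..1::real} \<times> torus_cell \<longrightarrow> p \<in> slab"
proof -
  have "negligible {p. ((1::real), (0::real^3)) \<bullet> p = 1}" by (intro negligible_hyperplane) (simp add: prod_eq_iff)
  then have "{p. ((1::real), (0::real^3)) \<bullet> p = 1} \<in> null_sets lebesgue" by (simp add: negligible_iff_null_sets)
  then show ?thesis by (rule AE_I') (auto simp: inner_prod_def)
qed

text \<open>
  Moves integrals from the completed measure on \<open>[0,1]\<close> times the cell to the Borel measure on the product,
  for which Fubini is available.
\<close>

lemma spacetime_integral:
  fixes F G :: "real \<times> (real^3) \<Rightarrow> 'b::euclidean_space"
  assumes G: "G \<in> borel_measurable borel" and eq: "\<And>p. p \<in> slab \<Longrightarrow> G p = F p" and z: "\<And>p. p \<notin> slab \<Longrightarrow> G p = 0"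
  shows "F \<in> borel_measurable (spacetime 1)"
    "integral\<^sup>L (spacetime 1) F = integral\<^sup>L lborel G"
    "integrable (spacetime 1) F \<longleftrightarrow> integrable lborel G"
proof -
  let ?I = "{0..1::real} \<times> torus_cell"
  have S: "?I \<inter> space lebesgue \<in> sets lebesgue" using slab_borel(2) by simp
  have Gl: "G \<in> borel_measurable lborel" "G \<in> borel_measurable lebesgue"
    using G by (auto intro: measurable_completion)
  have ae: "AE p in lebesgue. G p = indicator ?I p *\<^sub>R F p"
    using spacetime_AE_slab
  proof eventually_elim
    case (elim p)
    then show ?case using eq[of p] z[of p] by (cases "p \<in> slab") (auto simp: indicator_def)
  qed
  have m: "(\<lambda>p. indicator ?I p *\<^sub>R F p) \<in> borel_measurable lebesgue"
    using Gl(2) ae by (rule borel_measurable_AE)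
  then show "F \<in> borel_measurable (spacetime 1)"
    by (simp add: borel_measurable_restrict_space_iff[OF S])
  have "integral\<^sup>L (spacetime 1) F = (\<integral>p. indicator ?I p *\<^sub>R F p \<partial>lebesgue)"
    by (rule integral_restrict_space[OF S])
  also have "\<dots> = integral\<^sup>L lebesgue G"
    using ae by (intro integral_cong_AE m Gl) (auto elim: eventually_mono)
  also have "\<dots> = integral\<^sup>L lborel G" by (rule integral_completion[OF Gl(1)])
  finally show "integral\<^sup>L (spacetime 1) F = integral\<^sup>L lborel G" .
  have "integrable (spacetime 1) F \<longleftrightarrow> integrable lebesgue (\<lambda>p. indicator ?I p *\<^sub>R F p)"
    by (rule integrable_restrict_space[OF S])
  also have "\<dots> \<longleftrightarrow> integrable lebesgue G"
    using ae by (intro integrable_cong_AE m Gl) (auto elim: eventually_mono)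
  also have "\<dots> \<longleftrightarrow> integrable lborel G" by (rule integrable_completion[OF Gl(1)])
  finally show "integrable (spacetime 1) F \<longleftrightarrow> integrable lborel G" .
qed

lemma slab_continuous_borel:
  fixes F :: "real \<times> (real^3) \<Rightarrow> 'b::euclidean_space"
  assumes "continuous_on ({0..<1} \<times> UNIV) F"
  shows "(\<lambda>p. indicator slab p *\<^sub>R F p) \<in> borel_measurable borel"
  by (intro borel_measurable_continuous_on_indicator continuous_on_subset[OF assms]) auto

lemma slab_integrable:
  fixes F :: "real \<times> (real^3) \<Rightarrow> 'b::euclidean_space"
  assumes "continuous_on ({0..<1} \<times> UNIV) F" "\<And>p. p \<in> slab \<Longrightarrow> norm (F p) \<le> C"
  shows "integrable lborel (\<lambda>p. indicator slab p *\<^sub>R F p)"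
proof -
  have "integrable lborel (\<lambda>p. C * indicator slab p :: real)"
    using emeasure_slab by (intro integrable_mult_right integrable_real_indicator) auto
  then show ?thesis
  proof (rule Bochner_Integration.integrable_bound)
    show "(\<lambda>p. indicator slab p *\<^sub>R F p) \<in> borel_measurable lborel"
      using slab_continuous_borel[OF assms(1)] by simp
    show "AE p in lborel. norm (indicator slab p *\<^sub>R F p) \<le> norm (C * indicator slab p :: real)"
    proof (rule AE_I2)
      fix p show "norm (indicator slab p *\<^sub>R F p) \<le> norm (C * indicator slab p :: real)"
        using assms(2)[of p] by (cases "p \<in> slab") (simp_all add: order.trans[OF _ abs_ge_self])
    qed
  qed
qed

lemma slab_fubini:
  fixes F :: "real \<times> (real^3) \<Rightarrow> real"
  assumes F: "continuous_on ({0..<1} \<times> UNIV) F" "\<And>p. p \<in> slab \<Longrightarrow> norm (F p) \<le> C"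
  shows "integrable (spacetime 1) F"
    "integral\<^sup>L (spacetime 1) F = (\<integral>t. indicator {0..<1} t * cell_int (\<lambda>x. F (t, x)) \<partial>lborel)"
    "integral\<^sup>L (spacetime 1) F = (\<integral>x. indicator torus_cell x * (\<integral>t. indicator {0..<1} t * F (t, x) \<partial>lborel) \<partial>lborel)"
    "integrable lborel (\<lambda>t. indicator {0..<1} t * cell_int (\<lambda>x. F (t, x)))"
proof -
  let ?G = "\<lambda>p. indicator slab p *\<^sub>R F p"
  note int = slab_integrable[OF F]
  note red = spacetime_integral[of ?G F, OF slab_continuous_borel[OF F(1)]]
  show "integrable (spacetime 1) F" using int red(3) by simp
  have int': "integrable (lborel \<Otimes>\<^sub>M lborel) (case_prod (\<lambda>t x. ?G (t, x)))"
    using int by (simp add: lborel_prod case_prod_unfold)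
  have I: "integral\<^sup>L (spacetime 1) F = integral\<^sup>L (lborel \<Otimes>\<^sub>M lborel) (case_prod (\<lambda>t x. ?G (t, x)))"
    using red(2) by (simp add: lborel_prod case_prod_unfold)
  have slice: "(\<integral>x. ?G (t, x) \<partial>lborel) = indicator {0..<1} t * cell_int (\<lambda>x. F (t, x))" for t
  proof (cases "t \<in> {0..<1}")
    case True
    then have "continuous_on UNIV (\<lambda>x. F (t, x))"
      by (intro continuous_on_compose2[OF F(1)] continuous_intros) auto
    from lebesgue_on_eq_lborel(1)[OF torus_cell_borel cell_measurable(2)[OF this]] show ?thesis
      using True by (simp add: indicator_times)
  next
    case False
    then have "(\<lambda>x. ?G (t, x)) = (\<lambda>x. 0)" by (auto simp: indicator_def)
    then show ?thesis using False by simp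
  qed
  show "integral\<^sup>L (spacetime 1) F = (\<integral>t. indicator {0..<1} t * cell_int (\<lambda>x. F (t, x)) \<partial>lborel)"
    unfolding I lborel_pair.integral_fst[OF int', symmetric] slice ..
  show "integrable lborel (\<lambda>t. indicator {0..<1} t * cell_int (\<lambda>x. F (t, x)))"
    using lborel_pair.integrable_fst[OF int'] unfolding slice .
  have slice': "(\<integral>t. ?G (t, x) \<partial>lborel) = indicator torus_cell x * (\<integral>t. indicator {0..<1} t * F (t, x) \<partial>lborel)" for x
    by (simp add: indicator_times mult.commute mult.left_commute[of "indicator torus_cell x"])
       (simp add: mult.commute mult.left_commute)
  show "integral\<^sup>L (spacetime 1) F = (\<integral>x. indicator torus_cell x * (\<integral>t. indicator {0..<1} t * F (t, x) \<partial>lborel) \<partial>lborel)"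
    unfolding I lborel_pair.integral_snd[OF int', symmetric] slice' ..
qed

text \<open>
  A test field vanishes from some time \<open>T'\<close> on, so that it and its first derivatives are bounded on the
  half-open slab although they are only continuous there.
\<close>

definition test_bounds :: "(real \<Rightarrow> real^3 \<Rightarrow> real^3) \<Rightarrow> real \<Rightarrow> real \<Rightarrow> bool" where
  "test_bounds \<phi> B T' \<longleftrightarrow> 0 \<le> T' \<and> T' < 1 \<and> 0 \<le> B \<and>
     continuous_on ({0..<1} \<times> UNIV) (\<lambda>(t, x). \<phi> t x) \<and>
     continuous_on ({0..<1} \<times> UNIV) (\<lambda>(t, x). time_deriv 1 \<phi> t x) \<and>
     (\<forall>j. continuous_on ({0..<1} \<times> UNIV) (\<lambda>(t, x). partial j (\<phi> t) x)) \<and>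
     (\<forall>t\<in>{0..<1}. test_slice (\<phi> t) B) \<and>
     (\<forall>t\<in>{0..<1}. \<forall>x\<in>torus_cell. norm (\<phi> t x) \<le> B \<and> norm (time_deriv 1 \<phi> t x) \<le> B) \<and>
     (\<forall>t\<in>{0..<1}. \<forall>x. ((\<lambda>s. \<phi> s x) has_vector_derivative time_deriv 1 \<phi> t x) (at t within {0..<1})) \<and>
     (\<forall>t\<in>{T'..<1}. \<forall>x. \<phi> t x = 0 \<and> time_deriv 1 \<phi> t x = 0)"

lemma test_function_bounds:
  assumes "mhd_test_function 1 \<phi>"
  obtains B T' where "test_bounds \<phi> B T'"
proof -
  define S :: "(real \<times> (real^3)) set" where "S = {0..<1} \<times> UNIV"
  define F where "F = (\<lambda>(t, x). \<phi> t x)"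
  define D where "D = (\<lambda>p. frechet_derivative F (at p within S))"
  have per: "\<And>t. t \<in> {0..<1} \<Longrightarrow> torus_periodic (\<phi> t)"
    and sm: "smooth_on S F"
    and div: "\<And>t x. t \<in> {0..<1} \<Longrightarrow> divergence (\<phi> t) x = 0"
    using assms by (auto simp: mhd_test_function_def S_def F_def)
  obtain T0 where T0: "T0 < 1" "\<And>t x. t \<in> {0..<1} \<Longrightarrow> T0 \<le> t \<Longrightarrow> \<phi> t x = 0"
    using assms by (auto simp: mhd_test_function_def)
  (* T0 may be negative; and the time derivative is only known to vanish strictly after T0. *)
  define T1 where "T1 = max T0 0"
  define T' where "T' = (T1 + 1) / 2"
  have T': "0 \<le> T'" "T' < 1" "T1 < T'" "0 \<le> T1" "T0 \<le> T1" using T0 by (auto simp: T'_def T1_def)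
  have "Ck_on (Suc 0) S F" "Ck_on 0 S F" using sm by (auto simp: smooth_on_def)
  then have df: "F differentiable_on S" and cD: "\<And>h. continuous_on S (\<lambda>p. D p h)" and cF: "continuous_on S F"
    by (auto simp: D_def)
  have hd: "(F has_derivative D p) (at p within S)" if "p \<in> S" for p
    using df that unfolding D_def by (simp add: differentiable_on_def frechet_derivative_works)
  have space: "(\<phi> t has_derivative (\<lambda>h. D (t, x) (0, h))) (at x)" if t: "t \<in> {0..<1}" for t x
  proof -
    have "(F has_derivative D (t, x)) (at (t, x) within range (Pair t))"
      by (rule has_derivative_subset[OF hd]) (use t in \<open>auto simp: S_def\<close>)
    then have "((\<lambda>x. F (t, x)) has_derivative (\<lambda>h. D (t, x) (0, h))) (at x)"
      by (intro has_derivative_in_compose[of "Pair t" "\<lambda>h. (0, h)" x UNIV F "D (t, x)"])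
         (auto intro!: has_derivative_Pair has_derivative_const has_derivative_ident)
    then show ?thesis by (simp add: F_def)
  qed
  have partial: "partial j (\<phi> t) x = D (t, x) (0, axis j 1)" if "t \<in> {0..<1}" for t x j
    unfolding partial_def frechet_derivative_at[OF space[OF that], symmetric] ..
  have time: "((\<lambda>s. \<phi> s x) has_vector_derivative D (t, x) (1, 0)) (at t within {0..<1})" if t: "t \<in> {0..<1}" for t x
  proof -
    have "(F has_derivative D (t, x)) (at (t, x) within (\<lambda>s. (s, x)) ` {0..<1})"
      by (rule has_derivative_subset[OF hd]) (use t in \<open>auto simp: S_def\<close>)
    then have "((\<lambda>s. F (s, x)) has_derivative (\<lambda>h. D (t, x) (h, 0))) (at t within {0..<1})"
      by (intro has_derivative_in_compose[of "\<lambda>s. (s, x)" "\<lambda>h. (h, 0)" t "{0..<1}" F "D (t, x)"])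
         (auto intro!: has_derivative_Pair has_derivative_const has_derivative_ident)
    moreover have "(\<lambda>h. D (t, x) (h, 0)) = (\<lambda>h. h *\<^sub>R D (t, x) (1, 0))"
    proof
      fix h
      have "linear (D (t, x))" using hd[of "(t, x)"] t by (auto simp: S_def intro: has_derivative_linear)
      from linear_cmul[OF this, of h "(1, 0)"] show "D (t, x) (h, 0) = h *\<^sub>R D (t, x) (1, 0)" by simp
    qed
    ultimately have "((\<lambda>s. F (s, x)) has_derivative (\<lambda>h. h *\<^sub>R D (t, x) (1, 0))) (at t within {0..<1})" by simp
    then show ?thesis by (simp add: has_vector_derivative_def F_def)
  qed
  have lim: "at t within {0..<1} \<noteq> bot" if "t \<in> {0..<1}" for t :: real
  proof -
    have "t islimpt {t<..<1}" using that by (intro islimpt_greaterThanLessThan1) auto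
    then have "t islimpt {0..<1}" by (rule islimpt_subset) (use that in auto)
    then show ?thesis by (simp add: trivial_limit_within)
  qed
  have td: "time_deriv 1 \<phi> t x = D (t, x) (1, 0)" if "t \<in> {0..<1}" for t x
    unfolding time_deriv_def by (rule vector_derivative_within[OF lim[OF that] time[OF that]])
  have zero: "\<phi> t x = 0" "time_deriv 1 \<phi> t x = 0" "partial j (\<phi> t) x = 0" if t: "t \<in> {0..<1}" "T1 < t" for t x j
  proof -
    show "\<phi> t x = 0" using T0(2)[of t x] t T' by auto
    have "\<phi> t = (\<lambda>x. 0)" using T0(2)[of t] t T' by auto
    then show "partial j (\<phi> t) x = 0" by (simp add: partial_def)
    have "((\<lambda>s. 0 :: real^3) has_vector_derivative 0) (at t within {0..<1})" by simp
    then have "((\<lambda>s. \<phi> s x) has_vector_derivative 0) (at t within {0..<1})"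
    proof (rule has_vector_derivative_transform_within[of _ _ _ _ "t - T1"])
      fix s assume "s \<in> {0..<1}" "dist s t < t - T1"
      then show "0 = \<phi> s x" using T0(2)[of s x] T' by (auto simp: dist_real_def)
    qed (use t in auto)
    then show "time_deriv 1 \<phi> t x = 0"
      unfolding time_deriv_def by (rule vector_derivative_within[OF lim[OF t(1)]])
  qed
  have cpt: "\<exists>B\<ge>0. \<forall>t\<in>{0..<1}. \<forall>x\<in>torus_cell. norm (G t x) \<le> B"
    if c: "continuous_on S (\<lambda>(t, x). G t x)" and z: "\<And>t x. t \<in> {0..<1} \<Longrightarrow> T1 < t \<Longrightarrow> G t x = 0"
    for G :: "real \<Rightarrow> real^3 \<Rightarrow> real^3"
  proof -
    have "bounded ((\<lambda>(t, x). G t x) ` ({0..T'} \<times> cbox 0 1))"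
      using T' by (intro compact_imp_bounded compact_continuous_image continuous_on_subset[OF c] compact_Times)
         (auto simp: S_def)
    then obtain B where "\<forall>t\<in>{0..T'}. \<forall>x\<in>cbox 0 1. norm (G t x) \<le> B"
      by (auto simp: bounded_iff)
    then have B: "\<And>t x. t \<in> {0..T'} \<Longrightarrow> x \<in> cbox 0 1 \<Longrightarrow> norm (G t x) \<le> B" by blast
    have "norm (G t x) \<le> max B 0" if "t \<in> {0..<1}" "x \<in> torus_cell" for t x
    proof (cases "t \<le> T'")
      case True
      then show ?thesis using B[of t x] that torus_cell_box(1) by force
    next
      case False
      then show ?thesis using z[of t x] that T' by simp
    qed
    then show ?thesis by (intro exI[of _ "max B 0"]) auto
  qed
  have c\<phi>: "continuous_on S (\<lambda>(t, x). \<phi> t x)" using cF by (simp add: F_def)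
  have ct: "continuous_on S (\<lambda>(t, x). time_deriv 1 \<phi> t x)"
    by (rule continuous_on_eq[OF cD[of "(1, 0)"]]) (auto simp: S_def td)
  have cp: "continuous_on S (\<lambda>(t, x). partial j (\<phi> t) x)" for j
    by (rule continuous_on_eq[OF cD[of "(0, axis j 1)"]]) (auto simp: S_def partial)
  obtain B1 where B1: "B1 \<ge> 0" "\<And>t x. t \<in> {0..<1} \<Longrightarrow> x \<in> torus_cell \<Longrightarrow> norm (\<phi> t x) \<le> B1"
    using cpt[OF c\<phi>] zero by blast
  obtain B2 where B2: "B2 \<ge> 0" "\<And>t x. t \<in> {0..<1} \<Longrightarrow> x \<in> torus_cell \<Longrightarrow> norm (time_deriv 1 \<phi> t x) \<le> B2"
    using cpt[OF ct] zero by blast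
  have "\<forall>j. \<exists>B\<ge>0. \<forall>t\<in>{0..<1}. \<forall>x\<in>torus_cell. norm (partial j (\<phi> t) x) \<le> B"
    using cpt[OF cp] zero by blast
  then obtain b where b: "\<And>j. b j \<ge> 0" "\<And>j t x. t \<in> {0..<1} \<Longrightarrow> x \<in> torus_cell \<Longrightarrow> norm (partial j (\<phi> t) x) \<le> b j"
    by metis
  define B where "B = B1 + B2 + (\<Sum>j\<in>UNIV. b j)"
  have sb: "b j \<le> (\<Sum>j\<in>UNIV. b j)" for j using b(1) by (intro member_le_sum) auto
  have sb0: "0 \<le> (\<Sum>j\<in>UNIV. b j)" using b(1) by (intro sum_nonneg) auto
  have B: "B1 \<le> B" "B2 \<le> B" "b j \<le> B" "0 \<le> B" for j
    using sb[of j] sb0 B1(1) B2(1) by (auto simp: B_def)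
  have slice: "test_slice (\<phi> t) B" if t: "t \<in> {0..<1}" for t
    unfolding test_slice_def
  proof (intro conjI allI ballI)
    show "torus_periodic (\<phi> t)" using per t by auto
    show "\<phi> t differentiable at x" for x using space[OF t] by (auto simp: differentiable_def)
    show "continuous_on UNIV (partial j (\<phi> t))" for j
    proof -
      have c: "continuous_on UNIV (\<lambda>x::real^3. (t, x))"
        by (intro continuous_on_Pair continuous_on_const continuous_on_id)
      have sub: "(\<lambda>x::real^3. (t, x)) ` UNIV \<subseteq> S" using t by (auto simp: S_def)
      from continuous_on_compose2[OF cp c sub, of j] show ?thesis by simp
    qed
    show "divergence (\<phi> t) x = 0" for x using div t by auto
    show "norm (partial j (\<phi> t) x) \<le> B" if "x \<in> torus_cell" for j x
      using b(2)[OF t that, of j] B(3)[of j] by linarith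
  qed
  have "test_bounds \<phi> B T'"
    unfolding test_bounds_def
  proof (intro conjI allI ballI)
    fix t x assume t: "t \<in> {0..<1::real}"
    show "((\<lambda>s. \<phi> s x) has_vector_derivative time_deriv 1 \<phi> t x) (at t within {0..<1})"
      using time[OF t] td[OF t] by simp
  next
    fix t x assume t: "t \<in> {0..<1::real}" and x: "x \<in> torus_cell"
    show "norm (\<phi> t x) \<le> B" "norm (time_deriv 1 \<phi> t x) \<le> B"
      using B1(2)[OF t x] B2(2)[OF t x] B by linarith+
  next
    fix t x assume "t \<in> {T'..<1}"
    then show "\<phi> t x = 0" "time_deriv 1 \<phi> t x = 0" using zero(1,2)[of t x] T' by auto
  qed (use T' B(4) c\<phi> ct cp slice in \<open>auto simp: S_def\<close>)
  then show thesis by (rule that)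
qed

section \<open>The weak form for approximate solutions\<close>

lemma continuous_field:
  assumes "continuous_modes X"
  shows "continuous_on A (\<lambda>p. field X (fst p) (snd p))"
  using assms
proof (induction X)
  case (Cons m X)
  have c: "continuous_on UNIV (amp m)" "continuous_modes X" using Cons.prems by (auto simp: continuous_modes_def)
  have "continuous_on A (\<lambda>p. amp m (fst p))"
    by (rule continuous_on_compose2[OF c(1)]) (auto intro!: continuous_intros)
  moreover have "continuous_on A (\<lambda>p. wave (freq m) (phase m) (snd p))"
    by (rule continuous_on_compose2[OF continuous_wave[of UNIV]]) (auto intro!: continuous_intros)
  ultimately show ?case using Cons.IH[OF c(2)] by (auto intro!: continuous_intros)
qed simp

lemma velocity_modes_dt: "velocity_modes X \<Longrightarrow> continuous_modes (dt X)"
  by (auto simp: velocity_modes_def continuous_modes_def dt_def C1_def)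

lemma field_initial: "velocity_modes X \<Longrightarrow> field X 0 x = 0"
  by (induction X) (auto simp: velocity_modes_Cons)

lemma field_time_derivative:
  "velocity_modes X \<Longrightarrow> ((\<lambda>t. field X t x) has_vector_derivative field (dt X) t x) (at t within A)"
proof (induction X)
  case (Cons m X)
  have m: "C1 (amp m)" "velocity_modes X" using Cons.prems by (auto simp: velocity_modes_Cons)
  have "(amp m has_vector_derivative deriv (amp m) t) (at t within A)"
    using C1_deriv[OF m(1)] by (simp add: has_real_derivative_iff_has_vector_derivative has_vector_derivative_at_within)
  then have "((\<lambda>t. (amp m t * wave (freq m) (phase m) x) *\<^sub>R dir m) has_vector_derivative
     (deriv (amp m) t * wave (freq m) (phase m) x) *\<^sub>R dir m) (at t within A)"
    by (intro has_vector_derivative_scaleR[THEN has_vector_derivative_eq_rhs, OF _ has_vector_derivative_const])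
       (auto intro!: derivative_eq_intros simp: has_real_derivative_iff_has_vector_derivative[symmetric])
  from has_vector_derivative_add[OF this Cons.IH[OF m(2)]] show ?case by simp
qed simp

lemma lborel_interval_integral:
  fixes f :: "real \<Rightarrow> real"
  assumes "continuous_on {0..1} f"
  shows "integrable lborel (\<lambda>t. indicator {0..<1} t * f t)"
    "(\<integral>t. indicator {0..<1} t * f t \<partial>lborel) = integral {0..1} f"
proof -
  have 1: "integrable lborel (\<lambda>t. indicator {0..1} t * f t)"
    using borel_integrable_atLeastAtMost'[OF assms] by (simp add: set_integrable_def)
  have b: "(\<lambda>t. indicator {0..1} t * f t) \<in> borel_measurable lborel" using 1 by blast
  have eq: "indicator {0..<1} t * f t = indicator {0..<1} t * (indicator {0..1} t * f t)" for t :: real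
    by (auto simp: indicator_def)
  have b': "(\<lambda>t. indicator {0..<1} t * f t) \<in> borel_measurable lborel"
    unfolding eq[abs_def] using b by measurable
  have ae: "AE t in lborel. indicator {0..1} t * f t = indicator {0..<1} t * f t"
    using AE_lborel_singleton[of "1::real"] by eventually_elim (auto simp: indicator_def)
  show "integrable lborel (\<lambda>t. indicator {0..<1} t * f t)"
    using integrable_cong_AE[OF b b' ae] 1 by simp
  have "(\<integral>t. indicator {0..<1} t * f t \<partial>lborel) = (\<integral>t. indicator {0..1} t * f t \<partial>lborel)"
    using integral_cong_AE[OF b b' ae] by simp
  also have "\<dots> = integral {0..1} f"
    using set_borel_integral_eq_integral(2)[OF borel_integrable_atLeastAtMost'[OF assms]]
    by (simp add: set_lebesgue_integral_def)
  finally show "(\<integral>t. indicator {0..<1} t * f t \<partial>lborel) = integral {0..1} f" .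
qed

text \<open>
  The integrand of the weak form of \<open>w' + u \<bullet> \<nabla>w + \<nabla>p = 0\<close>.
\<close>

definition weak_integrand ::
  "(real \<Rightarrow> real^3 \<Rightarrow> real^3) \<Rightarrow> (real \<Rightarrow> real^3 \<Rightarrow> real^3) \<Rightarrow> (real \<Rightarrow> real^3 \<Rightarrow> real^3) \<Rightarrow> real \<times> (real^3) \<Rightarrow> real" where
  "weak_integrand \<phi> u w p = w (fst p) (snd p) \<bullet> time_deriv 1 \<phi> (fst p) (snd p) +
     bilin (\<phi> (fst p)) (u (fst p)) (w (fst p)) (snd p)"

lemma bilin_bound:
  assumes "\<And>j. norm (partial j \<phi> x) \<le> B" "norm (u x) \<le> p" "norm (w x) \<le> q"
  shows "\<bar>bilin \<phi> u w x\<bar> \<le> 9 * (B * (p * q))"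
proof -
  have *: "\<bar>partial j \<phi> x $ i * (u x $ j * w x $ i)\<bar> \<le> B * (p * q)" for i j
    unfolding abs_mult using assms component_le_norm_cart[of "partial j \<phi> x" i] component_le_norm_cart[of "u x" j]
      component_le_norm_cart[of "w x" i]
    by (intro mult_mono) (auto intro: order.trans mult_nonneg_nonneg order.trans[OF norm_ge_zero])
  have "\<bar>bilin \<phi> u w x\<bar> \<le> (\<Sum>i\<in>(UNIV::3 set). \<Sum>j\<in>(UNIV::3 set). B * (p * q))"
    unfolding bilin_def by (intro order.trans[OF sum_abs] sum_mono *)
  then show ?thesis by simp
qed

text \<open>
  The weak integrand is \<open>h + r\<close>. Here \<open>h\<close> is the time derivative of \<open>X \<bullet> \<phi>\<close>, which integrates to zero
  because \<open>X\<close> vanishes at time 0 and \<open>\<phi>\<close> near time 1; and the integral of \<open>r\<close> in space is minus the pairing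
  with the error.
\<close>

lemma approx_solution_weak_form:
  assumes tb: "test_bounds \<phi> B T'" and ap: "approx_solution X Y E F"
  shows "\<bar>integral\<^sup>L (spacetime 1) (weak_integrand \<phi> (field Y) (field X))\<bar> \<le> 9 * B * integral {0..1} (stress_at E)"
proof -
  have vX: "velocity_modes X" and vY: "velocity_modes Y" and eE: "error_modes E"
    and eq: "\<And>\<Phi> t. solenoidal \<Phi> \<Longrightarrow> pairing \<Phi> (dt X @ advect Y X) t = pairing \<Phi> E t"
    using ap by (auto simp: approx_solution_def)
  have T': "0 \<le> T'" "T' < 1" "0 \<le> B"
    and c\<phi>: "continuous_on ({0..<1} \<times> UNIV) (\<lambda>p. \<phi> (fst p) (snd p))"
    and ct: "continuous_on ({0..<1} \<times> UNIV) (\<lambda>p. time_deriv 1 \<phi> (fst p) (snd p))"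
    and cp: "\<And>j. continuous_on ({0..<1} \<times> UNIV) (\<lambda>p. partial j (\<phi> (fst p)) (snd p))"
    and sl: "\<And>t. t \<in> {0..<1} \<Longrightarrow> test_slice (\<phi> t) B"
    and bd: "\<And>t x. t \<in> {0..<1} \<Longrightarrow> x \<in> torus_cell \<Longrightarrow> norm (\<phi> t x) \<le> B"
      "\<And>t x. t \<in> {0..<1} \<Longrightarrow> x \<in> torus_cell \<Longrightarrow> norm (time_deriv 1 \<phi> t x) \<le> B"
    and vd: "\<And>t x. t \<in> {0..<1} \<Longrightarrow> ((\<lambda>s. \<phi> s x) has_vector_derivative time_deriv 1 \<phi> t x) (at t within {0..<1})"
    and zero: "\<And>t x. t \<in> {T'..<1} \<Longrightarrow> \<phi> t x = 0" "\<And>t x. t \<in> {T'..<1} \<Longrightarrow> time_deriv 1 \<phi> t x = 0"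
    using tb unfolding test_bounds_def case_prod_unfold by blast+
  have cmX: "continuous_modes X" "continuous_modes Y" "continuous_modes (dt X)"
    using vX vY velocity_modes_continuous velocity_modes_dt by auto
  obtain s1 where s1: "0 < s1" "\<And>t. t \<in> {0..1} \<Longrightarrow> size_at X t \<le> s1" using continuous_modes_bound[OF cmX(1)] by metis
  obtain s2 where s2: "0 < s2" "\<And>t. t \<in> {0..1} \<Longrightarrow> size_at Y t \<le> s2" using continuous_modes_bound[OF cmX(2)] by metis
  obtain s3 where s3: "0 < s3" "\<And>t. t \<in> {0..1} \<Longrightarrow> size_at (dt X) t \<le> s3" using continuous_modes_bound[OF cmX(3)] by metis
  define h where "h p = field (dt X) (fst p) (snd p) \<bullet> \<phi> (fst p) (snd p)
     + field X (fst p) (snd p) \<bullet> time_deriv 1 \<phi> (fst p) (snd p)" for p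
  define r where "r p = bilin (\<phi> (fst p)) (field Y (fst p)) (field X (fst p)) (snd p)
     - field (dt X) (fst p) (snd p) \<bullet> \<phi> (fst p) (snd p)" for p
  have split: "weak_integrand \<phi> (field Y) (field X) = (\<lambda>p. h p + r p)"
    by (simp add: weak_integrand_def h_def r_def fun_eq_iff)
  have ch: "continuous_on ({0..<1} \<times> UNIV) h"
    unfolding h_def by (intro continuous_intros continuous_field cmX c\<phi> ct)
  have cr: "continuous_on ({0..<1} \<times> UNIV) r"
    unfolding r_def bilin_def by (intro continuous_intros continuous_field cmX c\<phi> cp)
  have fb: "norm (field X t x) \<le> s1" "norm (field Y t x) \<le> s2" "norm (field (dt X) t x) \<le> s3"
    if "t \<in> {0..<1}" for t x
    using norm_field_le[of X t x] norm_field_le[of Y t x] norm_field_le[of "dt X" t x]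
      s1(2)[of t] s2(2)[of t] s3(2)[of t] that by auto
  have ib: "\<bar>a \<bullet> b\<bar> \<le> p * q" if "norm a \<le> p" "norm b \<le> q" for a b :: "real^3" and p q
    using Cauchy_Schwarz_ineq2[of a b] mult_mono[OF that] norm_ge_zero[of a] norm_ge_zero[of b] that by linarith
  have hb: "norm (h p) \<le> s3 * B + s1 * B" and rb: "norm (r p) \<le> 9 * (B * (s2 * s1)) + s3 * B" if p: "p \<in> slab" for p
  proof -
    obtain t x where px: "p = (t, x)" "t \<in> {0..<1}" "x \<in> torus_cell" using p by auto
    have "\<bar>field (dt X) t x \<bullet> \<phi> t x\<bar> \<le> s3 * B" "\<bar>field X t x \<bullet> time_deriv 1 \<phi> t x\<bar> \<le> s1 * B"
      using fb[OF px(2), of x] bd[OF px(2,3)] by (auto intro: ib)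
    moreover have "\<bar>bilin (\<phi> t) (field Y t) (field X t) x\<bar> \<le> 9 * (B * (s2 * s1))"
      using sl[OF px(2)] px(3) fb[OF px(2), of x] by (intro bilin_bound) (auto simp: test_slice_def)
    ultimately show "norm (h p) \<le> s3 * B + s1 * B" "norm (r p) \<le> 9 * (B * (s2 * s1)) + s3 * B"
      unfolding h_def r_def px(1) fst_conv snd_conv real_norm_def by linarith+
  qed
  note fh = slab_fubini[of h, OF ch hb] and fr = slab_fubini[of r, OF cr rb]
  have hx: "(\<integral>t. indicator {0..<1} t * h (t, x) \<partial>lborel) = 0" for x
  proof -
    have "(\<integral>t. indicator {0..<1} t * h (t, x) \<partial>lborel) = (\<integral>t. indicator {0..T'} t *\<^sub>R h (t, x) \<partial>lborel)"
      using T' zero by (intro Bochner_Integration.integral_cong) (auto simp: indicator_def h_def)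
    also have "\<dots> = field X T' x \<bullet> \<phi> T' x - field X 0 x \<bullet> \<phi> 0 x"
    proof (rule integral_FTC_Icc[OF T'(1)])
      fix t assume t: "0 \<le> t" "t \<le> T'"
      have 1: "((\<lambda>s. \<phi> s x) has_vector_derivative time_deriv 1 \<phi> t x) (at t within {0..T'})"
        by (rule has_vector_derivative_within_subset[OF vd]) (use t T' in auto)
      show "((\<lambda>t. field X t x \<bullet> \<phi> t x) has_vector_derivative h (t, x)) (at t within {0..T'})"
        using bounded_bilinear.has_vector_derivative[OF bounded_bilinear_inner field_time_derivative[OF vX] 1]
        by (simp add: h_def add.commute)
    next
      have "(\<lambda>t. (t, x)) ` {0..T'} \<subseteq> {0..<1} \<times> UNIV" using T' by auto
      moreover have "continuous_on {0..T'} (\<lambda>t. (t, x))" by (intro continuous_intros)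
      ultimately show "continuous_on {0..T'} (\<lambda>t. h (t, x))"
        using continuous_on_compose2[OF ch] by blast
    qed
    also have "\<dots> = 0" using zero(1)[of T' x] T' field_initial[OF vX, of x] by simp
    finally show ?thesis .
  qed
  have H: "integral\<^sup>L (spacetime 1) h = 0" by (subst fh(3)) (simp_all add: hx)
  have rt: "cell_int (\<lambda>x. r (t, x)) = - pairing (coeff (\<phi> t)) E t" if t: "t \<in> {0..<1}" for t
  proof -
    note ts = sl[OF t]
    have cfX: "continuous_on UNIV (field Z t)" for Z by (rule continuous_field_space[OF ts])
    have "cell_int (\<lambda>x. r (t, x)) = cell_int (bilin (\<phi> t) (field Y t) (field X t)) - cell_int (\<lambda>x. field (dt X) t x \<bullet> \<phi> t x)"
      unfolding r_def fst_conv snd_conv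
      by (intro Bochner_Integration.integral_diff cell_integrable bilin_continuous[OF ts] cfX continuous_intros test_slice_facts(5)[OF ts])
    also have "\<dots> = - pairing (coeff (\<phi> t)) (dt X @ advect Y X) t"
      unfolding bilin_field[OF ts vY vX] pairing_field[OF ts] by simp
    finally show ?thesis using eq[OF coeff_solenoidal[OF ts], of t] by simp
  qed
  have cs: "continuous_on {0..1} (\<lambda>t. 9 * B * stress_at E t)"
    using error_modes_continuous[OF eE] by (intro continuous_intros)
  have "norm (integral\<^sup>L (spacetime 1) r) \<le> (\<integral>t. indicator {0..<1} t * (9 * B * stress_at E t) \<partial>lborel)"
  proof (subst fr(2), assumption, rule Bochner_Integration.integral_norm_bound_integral[OF _ lborel_interval_integral(1)[OF cs]])
    show "integrable lborel (\<lambda>t. indicator {0..<1} t * cell_int (\<lambda>x. r (t, x)))" by (rule fr(4))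
    fix t :: real
    show "norm (indicator {0..<1} t * cell_int (\<lambda>x. r (t, x))) \<le> indicator {0..<1} t * (9 * B * stress_at E t)"
      using rt[of t] pairing_coeff_bound[OF sl eE, of t t] by (cases "t \<in> {0..<1}") auto
  qed
  also have "\<dots> = 9 * B * integral {0..1} (stress_at E)"
    unfolding lborel_interval_integral(2)[OF cs] by simp
  finally have R: "\<bar>integral\<^sup>L (spacetime 1) r\<bar> \<le> 9 * B * integral {0..1} (stress_at E)" by simp
  have "integral\<^sup>L (spacetime 1) (weak_integrand \<phi> (field Y) (field X)) = integral\<^sup>L (spacetime 1) h + integral\<^sup>L (spacetime 1) r"
    unfolding split by (rule Bochner_Integration.integral_add[OF fh(1) fr(1)])
  then show ?thesis using H R by simp
qed

section \<open>Times of convergence\<close>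

text \<open>
  A series with summable integrals converges for almost all times; at the others the limit fields will be
  set to zero, which turns almost-everywhere statements into pointwise ones.
\<close>

definition good_times :: "(nat \<Rightarrow> real \<Rightarrow> real) \<Rightarrow> real set" where
  "good_times g = {t \<in> {0..<1}. (\<Sum>n. ennreal (g n t)) < top}"

lemma good_times:
  assumes c: "\<And>n. continuous_on UNIV (g n)" and pos: "\<And>n t. 0 \<le> g n t"
    and sm: "summable (\<lambda>n. integral {0..1} (g n))"
  shows "good_times g \<in> sets borel" "good_times g \<subseteq> {0..<1}"
    "\<And>t. t \<in> good_times g \<Longrightarrow> summable (\<lambda>n. g n t)"
    "AE t in lborel. t \<in> {0..<1} \<longrightarrow> t \<in> good_times g"
    "integrable lborel (\<lambda>t. indicator (good_times g) t * (\<Sum>n. g n t))"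
    "(\<integral>t. indicator (good_times g) t * (\<Sum>n. g n t) \<partial>lborel) \<le> (\<Sum>n. integral {0..1} (g n))"
proof -
  let ?G = "good_times g"
  have gb [measurable]: "g n \<in> borel_measurable borel" for n
    using c by (rule borel_measurable_continuous_onI)
  show G [measurable]: "?G \<in> sets borel" unfolding good_times_def by measurable
  show "?G \<subseteq> {0..<1}" by (auto simp: good_times_def)
  show S: "summable (\<lambda>n. g n t)" if "t \<in> ?G" for t
    using that pos by (intro summable_suminf_not_top) (auto simp: good_times_def)
  have In: "(\<integral>\<^sup>+t. indicator {0..<1} t * ennreal (g n t) \<partial>lborel) = ennreal (integral {0..1} (g n))" for n
  proof -
    have c': "continuous_on {0..1} (g n)" using c continuous_on_subset by blast
    have "(\<integral>\<^sup>+t. indicator {0..<1} t * ennreal (g n t) \<partial>lborel) = (\<integral>\<^sup>+t. ennreal (indicator {0..<1} t * g n t) \<partial>lborel)"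
      by (intro nn_integral_cong) (auto simp: indicator_def)
    also have "\<dots> = ennreal (\<integral>t. indicator {0..<1} t * g n t \<partial>lborel)"
      using lborel_interval_integral(1)[OF c'] pos by (intro nn_integral_eq_integral) auto
    finally show ?thesis using lborel_interval_integral(2)[OF c'] by simp
  qed
  have Ipos: "0 \<le> integral {0..1} (g n)" for n
    using pos continuous_on_subset[OF c] by (intro integral_nonneg integrable_continuous_interval) auto
  have tot: "(\<integral>\<^sup>+t. indicator {0..<1} t * (\<Sum>n. ennreal (g n t)) \<partial>lborel) = ennreal (\<Sum>n. integral {0..1} (g n))"
  proof -
    have "(\<integral>\<^sup>+t. indicator {0..<1} t * (\<Sum>n. ennreal (g n t)) \<partial>lborel) =
       (\<integral>\<^sup>+t. (\<Sum>n. indicator {0..<1} t * ennreal (g n t)) \<partial>lborel)"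
      by (simp add: ennreal_suminf_cmult)
    also have "\<dots> = (\<Sum>n. \<integral>\<^sup>+t. indicator {0..<1} t * ennreal (g n t) \<partial>lborel)"
      by (intro nn_integral_suminf) measurable
    also have "\<dots> = (\<Sum>n. ennreal (integral {0..1} (g n)))" by (simp only: In)
    also have "\<dots> = ennreal (\<Sum>n. integral {0..1} (g n))" using Ipos sm by (intro suminf_ennreal2) auto
    finally show ?thesis .
  qed
  have "AE t in lborel. indicator {0..<1} t * (\<Sum>n. ennreal (g n t)) \<noteq> \<infinity>"
    by (intro nn_integral_PInf_AE) (auto simp: tot)
  then show "AE t in lborel. t \<in> {0..<1} \<longrightarrow> t \<in> ?G"
    by eventually_elim (auto simp: good_times_def less_top)
  have eq: "ennreal (indicator ?G t * (\<Sum>n. g n t)) = indicator ?G t * (\<Sum>n. ennreal (g n t))" for t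
    using S[of t] pos by (auto simp: indicator_def suminf_ennreal2)
  have posS: "0 \<le> indicator ?G t * (\<Sum>n. g n t)" for t
    using S[of t] pos by (auto simp: indicator_def intro!: suminf_nonneg)
  have "(\<integral>\<^sup>+t. ennreal (indicator ?G t * (\<Sum>n. g n t)) \<partial>lborel) \<le> (\<integral>\<^sup>+t. indicator {0..<1} t * (\<Sum>n. ennreal (g n t)) \<partial>lborel)"
    unfolding eq by (intro nn_integral_mono) (auto simp: indicator_def good_times_def)
  then have fin: "(\<integral>\<^sup>+t. ennreal (indicator ?G t * (\<Sum>n. g n t)) \<partial>lborel) \<le> ennreal (\<Sum>n. integral {0..1} (g n))"
    unfolding tot .
  show int: "integrable lborel (\<lambda>t. indicator ?G t * (\<Sum>n. g n t))"
  proof (rule integrableI_nonneg)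
    show "(\<integral>\<^sup>+t. ennreal (indicator ?G t * (\<Sum>n. g n t)) \<partial>lborel) < \<infinity>"
      using fin by (simp add: le_less_trans)
  qed (use posS in auto)
  have "ennreal (\<integral>t. indicator ?G t * (\<Sum>n. g n t) \<partial>lborel) \<le> ennreal (\<Sum>n. integral {0..1} (g n))"
    using fin nn_integral_eq_integral[OF int] posS by simp
  then show "(\<integral>t. indicator ?G t * (\<Sum>n. g n t) \<partial>lborel) \<le> (\<Sum>n. integral {0..1} (g n))"
    using suminf_nonneg[OF sm Ipos] by (simp add: ennreal_le_iff)
qed

section \<open>Hoelder norms\<close>

definition holder_part :: "real \<Rightarrow> mode list \<Rightarrow> real \<Rightarrow> real" where
  "holder_part \<alpha> X t = (\<Sum>m\<leftarrow>X. \<bar>amp m t\<bar> * norm (dir m) * (2 * (2 * pi * norm (freq m)) powr \<alpha>))"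

lemma holder_at_split: "holder_at \<alpha> X t = size_at X t + holder_part \<alpha> X t"
  by (induction X) (auto simp: holder_part_def algebra_simps)

lemma holder_part_nonneg [simp]: "0 \<le> holder_part \<alpha> X t"
  unfolding holder_part_def by (rule sum_list_nonneg) auto

lemma abs_cos_diff_le: "\<bar>cos a - cos b\<bar> \<le> \<bar>a - b\<bar>" for a b :: real
proof -
  have "\<bar>cos a - cos b\<bar> = 2 * (\<bar>sin ((a + b) / 2)\<bar> * \<bar>sin ((b - a) / 2)\<bar>)"
    by (simp add: cos_diff_cos abs_mult)
  also have "\<dots> \<le> 2 * (1 * \<bar>(b - a) / 2\<bar>)"
    by (intro mult_left_mono mult_mono abs_sin_x_le_abs_x) auto
  finally show ?thesis by simp
qed

text \<open>
  Interpolation between the bounds \<open>2\<pi> |k| |x - y|\<close> and 2 for the difference.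
\<close>

lemma wave_holder:
  assumes \<alpha>: "0 < \<alpha>" "\<alpha> < 1"
  shows "\<bar>wave k p x - wave k p y\<bar> \<le> 2 * (2 * pi * norm k) powr \<alpha> * dist x y powr \<alpha>"
proof -
  define s where "s = 2 * pi * norm k * dist x y"
  have s: "0 \<le> s" by (simp add: s_def)
  have "\<bar>wave k p x - wave k p y\<bar> \<le> \<bar>2 * pi * (k \<bullet> x) + p - (2 * pi * (k \<bullet> y) + p)\<bar>"
    unfolding wave_def by (rule abs_cos_diff_le)
  also have "\<dots> = 2 * pi * \<bar>k \<bullet> (x - y)\<bar>" by (simp add: inner_diff_right abs_mult flip: right_diff_distrib)
  also have "\<dots> \<le> s" unfolding s_def mult.assoc dist_norm by (intro mult_left_mono Cauchy_Schwarz_ineq2) auto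
  finally have 1: "\<bar>wave k p x - wave k p y\<bar> \<le> s" .
  have 2: "\<bar>wave k p x - wave k p y\<bar> \<le> 2"
    using abs_wave_le[of k p x] abs_wave_le[of k p y] by linarith
  have "\<bar>wave k p x - wave k p y\<bar> \<le> 2 * s powr \<alpha>"
  proof (cases "s \<le> 1")
    case True
    have "s \<le> s powr \<alpha>"
    proof (cases "s = 0")
      case False
      then have "s powr 1 \<le> s powr \<alpha>" using True s \<alpha> by (intro powr_mono') auto
      then show ?thesis using False s by simp
    qed simp
    then show ?thesis using 1 s by linarith
  next
    case False
    then have "1 \<le> s powr \<alpha>" using \<alpha> by (simp add: ge_one_powr_ge_zero)
    then show ?thesis using 2 by linarith
  qed
  then show ?thesis by (simp add: s_def powr_mult mult.assoc)
qed

lemma field_holder: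
  assumes "0 < \<alpha>" "\<alpha> < 1"
  shows "norm (field X t x - field X t y) \<le> holder_part \<alpha> X t * dist x y powr \<alpha>"
proof (induction X)
  case (Cons m X)
  let ?d = "wave (freq m) (phase m) x - wave (freq m) (phase m) y"
  have "field (m # X) t x - field (m # X) t y = (amp m t * ?d) *\<^sub>R dir m + (field X t x - field X t y)"
    by (simp add: algebra_simps)
  then have "norm (field (m # X) t x - field (m # X) t y) \<le> norm ((amp m t * ?d) *\<^sub>R dir m) + norm (field X t x - field X t y)"
    by (simp only: norm_triangle_ineq)
  moreover have "norm ((amp m t * ?d) *\<^sub>R dir m) \<le> (\<bar>amp m t\<bar> * norm (dir m)) * (2 * (2 * pi * norm (freq m)) powr \<alpha> * dist x y powr \<alpha>)"
    using mult_left_mono[OF wave_holder[OF assms, of "freq m" "phase m" x y], of "\<bar>amp m t\<bar> * norm (dir m)"]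
    by (simp add: abs_mult mult_ac)
  ultimately show ?case using Cons.IH by (simp add: holder_part_def algebra_simps)
qed (simp add: holder_part_def)

lemma field_periodic: "velocity_modes X \<Longrightarrow> torus_periodic (field X t)"
proof (induction X)
  case (Cons m X)
  then have "torus_periodic (wave (freq m) (phase m))" "torus_periodic (field X t)"
    by (auto simp: velocity_modes_Cons intro: wave_periodic)
  then show ?case by (simp add: torus_periodic_def)
qed (simp add: torus_periodic_def)

lemma holder_norm_le:
  assumes "\<And>x. norm (u x) \<le> A" "\<And>x y. norm (u x - u y) \<le> C * dist x y powr \<alpha>"
  shows "holder_norm \<alpha> u \<le> A + C"
  unfolding holder_norm_def
proof (rule add_mono)
  show "(SUP x. norm (u x)) \<le> A" by (intro cSUP_least) (auto simp: assms)
  have ne: "{(x, y :: real^3). x \<noteq> y} \<noteq> {}"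
  proof -
    have "(0 :: real^3, 1) \<in> {(x, y). x \<noteq> y}" by simp
    then show ?thesis by blast
  qed
  show "(SUP (x, y)\<in>{(x, y). x \<noteq> y}. norm (u x - u y) / dist x y powr \<alpha>) \<le> C"
    by (intro cSUP_least ne) (use assms(2) in \<open>auto simp: divide_le_eq\<close>)
qed

lemma torus_holderI:
  assumes "torus_periodic u" "\<And>x. norm (u x) \<le> A" "\<And>x y. norm (u x - u y) \<le> C * dist x y powr \<alpha>"
  shows "u \<in> torus_holder \<alpha>"
  using assms by (auto simp: torus_holder_def bounded_iff)

lemma torus_holder_norms:
  assumes "u \<in> torus_holder \<alpha>"
  obtains A C where "holder_norm \<alpha> u = A + C" "\<And>x. norm (u x) \<le> A"
    "\<And>x y. norm (u x - u y) \<le> C * dist x y powr \<alpha>"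
proof -
  obtain C0 where C0: "\<And>x y. norm (u x - u y) \<le> C0 * dist x y powr \<alpha>" using assms by (auto simp: torus_holder_def)
  have b1: "bdd_above (range (\<lambda>x. norm (u x)))"
    using assms by (auto simp: torus_holder_def bounded_iff bdd_above_def)
  have b2: "bdd_above ((\<lambda>(x, y). norm (u x - u y) / dist x y powr \<alpha>) ` {(x, y). x \<noteq> y})"
    by (rule bdd_aboveI[of _ C0]) (use C0 in \<open>auto simp: divide_le_eq\<close>)
  show thesis
  proof (rule that[OF holder_norm_def])
    show "norm (u x) \<le> (SUP x. norm (u x))" for x by (rule cSUP_upper[OF UNIV_I b1])
    show "norm (u x - u y) \<le> (SUP (x, y)\<in>{(x, y). x \<noteq> y}. norm (u x - u y) / dist x y powr \<alpha>) * dist x y powr \<alpha>" for x y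
    proof (cases "x = y")
      case False
      then have "norm (u x - u y) / dist x y powr \<alpha> \<le> (SUP (x, y)\<in>{(x, y). x \<noteq> y}. norm (u x - u y) / dist x y powr \<alpha>)"
        using cSUP_upper[OF _ b2, of "(x, y)"] by simp
      then show ?thesis using False by (simp add: divide_le_eq)
    qed simp
  qed
qed

lemma holder_norm_triangle:
  assumes u: "u \<in> torus_holder \<alpha>" and w: "w \<in> torus_holder \<alpha>"
  shows "\<bar>holder_norm \<alpha> u - holder_norm \<alpha> w\<bar> \<le> holder_norm \<alpha> (\<lambda>x. u x - w x)"
proof -
  have *: "holder_norm \<alpha> u \<le> holder_norm \<alpha> w + holder_norm \<alpha> d"
    if w: "w \<in> torus_holder \<alpha>" and d: "d \<in> torus_holder \<alpha>" and eq: "\<And>x. u x = w x + d x" for u w d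
  proof -
    obtain A C where 1: "holder_norm \<alpha> w = A + C" "\<And>x. norm (w x) \<le> A" "\<And>x y. norm (w x - w y) \<le> C * dist x y powr \<alpha>"
      using torus_holder_norms[OF w] by metis
    obtain A' C' where 2: "holder_norm \<alpha> d = A' + C'" "\<And>x. norm (d x) \<le> A'" "\<And>x y. norm (d x - d y) \<le> C' * dist x y powr \<alpha>"
      using torus_holder_norms[OF d] by metis
    have "holder_norm \<alpha> u \<le> (A + A') + (C + C')"
    proof (rule holder_norm_le)
      fix x y
      show "norm (u x) \<le> A + A'" unfolding eq by (rule norm_triangle_mono[OF 1(2) 2(2)])
      have "u x - u y = (w x - w y) + (d x - d y)" by (simp add: eq)
      then show "norm (u x - u y) \<le> (C + C') * dist x y powr \<alpha>"
        using norm_triangle_mono[OF 1(3)[of x y] 2(3)[of x y]] by (simp add: distrib_right)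
    qed
    then show ?thesis using 1(1) 2(1) by simp
  qed
  have diff: "(\<lambda>x. u x - w x) \<in> torus_holder \<alpha>" if u: "u \<in> torus_holder \<alpha>" and w: "w \<in> torus_holder \<alpha>" for u w
  proof -
    obtain A C where 1: "\<And>x. norm (w x) \<le> A" "\<And>x y. norm (w x - w y) \<le> C * dist x y powr \<alpha>"
      using torus_holder_norms[OF w] by metis
    obtain A' C' where 2: "\<And>x. norm (u x) \<le> A'" "\<And>x y. norm (u x - u y) \<le> C' * dist x y powr \<alpha>"
      using torus_holder_norms[OF u] by metis
    show ?thesis
    proof (rule torus_holderI[of _ "A' + A" "C' + C"])
      show "torus_periodic (\<lambda>x. u x - w x)" using u w by (simp add: torus_holder_def torus_periodic_def)
      fix x y
      show "norm (u x - w x) \<le> A' + A" using norm_triangle_ineq4[of "u x" "w x"] 1(1)[of x] 2(1)[of x] by linarith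
      have eq: "u x - w x - (u y - w y) = (u x - u y) - (w x - w y)" by simp
      show "norm (u x - w x - (u y - w y)) \<le> (C' + C) * dist x y powr \<alpha>"
        unfolding eq distrib_right
        using norm_triangle_ineq4[of "u x - u y" "w x - w y"] 1(2)[of x y] 2(2)[of x y] by linarith
    qed
  qed
  have sym: "holder_norm \<alpha> (\<lambda>x. w x - u x) = holder_norm \<alpha> (\<lambda>x. u x - w x)"
  proof -
    have "norm (w x - u x) = norm (u x - w x)" for x by (rule norm_minus_commute)
    moreover have "norm (w x - u x - (w y - u y)) = norm (u x - w x - (u y - w y))" for x y
      using norm_minus_commute[of "w x - u x" "w y - u y"] by (simp add: algebra_simps)
    ultimately show ?thesis unfolding holder_norm_def by simp
  qed
  show ?thesis
    using *[OF w diff[OF u w], of u] *[OF u diff[OF w u], of w] sym by simp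
qed

section \<open>Limits of series of plane waves\<close>

text \<open>
  The waves with the differences of the amplitudes at two times represent the difference of the fields
  (\<open>field_freeze\<close>), in the Hoelder norm as well.
\<close>

lemma amplitudes_uniformly_continuous:
  assumes "continuous_modes X" "0 < \<epsilon>"
  shows "\<exists>\<delta>>0. \<forall>t\<in>{0..1}. \<forall>s\<in>{0..1}. \<bar>t - s\<bar> < \<delta> \<longrightarrow>
     holder_at \<alpha> (map (\<lambda>m. Mode (\<lambda>_. amp m t - amp m s) (dir m) (freq m) (phase m)) X) 0 < \<epsilon>"
  using assms
proof (induction X arbitrary: \<epsilon>)
  case Nil
  then show ?case by (intro exI[of _ 1]) auto
next
  case (Cons m X)
  have c: "continuous_on UNIV (amp m)" "continuous_modes X" using Cons.prems by (auto simp: continuous_modes_def)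
  define w where "w = norm (dir m) * (1 + 2 * (2 * pi * norm (freq m)) powr \<alpha>)"
  have w: "0 \<le> w" by (simp add: w_def)
  obtain \<delta>1 where d1: "\<delta>1 > 0" "\<And>t s. t \<in> {0..1} \<Longrightarrow> s \<in> {0..1} \<Longrightarrow> \<bar>t - s\<bar> < \<delta>1 \<Longrightarrow>
     holder_at \<alpha> (map (\<lambda>m. Mode (\<lambda>_. amp m t - amp m s) (dir m) (freq m) (phase m)) X) 0 < \<epsilon> / 2"
    using Cons.IH[OF c(2), of "\<epsilon> / 2"] Cons.prems(2) by auto
  have "uniformly_continuous_on {0..1} (amp m)"
    by (intro compact_uniformly_continuous continuous_on_subset[OF c(1)]) auto
  moreover have e0: "0 < \<epsilon> / (2 * (w + 1))" using w Cons.prems(2) by simp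
  ultimately obtain \<delta>2 where d2: "\<delta>2 > 0"
    "\<And>t s. t \<in> {0..1} \<Longrightarrow> s \<in> {0..1} \<Longrightarrow> \<bar>t - s\<bar> < \<delta>2 \<Longrightarrow> \<bar>amp m t - amp m s\<bar> < \<epsilon> / (2 * (w + 1))"
    unfolding uniformly_continuous_on_def dist_real_def by metis
  show ?case
  proof (intro exI[of _ "min \<delta>1 \<delta>2"] conjI ballI impI)
    fix t s :: real assume ts: "t \<in> {0..1}" "s \<in> {0..1}" "\<bar>t - s\<bar> < min \<delta>1 \<delta>2"
    have "\<bar>amp m t - amp m s\<bar> * w \<le> \<epsilon> / (2 * (w + 1)) * (w + 1)"
      using d2(2)[OF ts(1,2)] ts(3) w e0 by (intro mult_mono) auto
    also have "\<dots> = \<epsilon> / 2" using w by (simp add: field_simps)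
    finally have "\<bar>amp m t - amp m s\<bar> * w \<le> \<epsilon> / 2" .
    moreover have "holder_at \<alpha> (map (\<lambda>m. Mode (\<lambda>_. amp m t - amp m s) (dir m) (freq m) (phase m)) X) 0 < \<epsilon> / 2"
      using d1(2)[OF ts(1,2)] ts(3) by simp
    moreover have "holder_at \<alpha> (map (\<lambda>m. Mode (\<lambda>_. amp m t - amp m s) (dir m) (freq m) (phase m)) (m # X)) 0
        = \<bar>amp m t - amp m s\<bar> * w
          + holder_at \<alpha> (map (\<lambda>m. Mode (\<lambda>_. amp m t - amp m s) (dir m) (freq m) (phase m)) X) 0"
      by (simp add: w_def mult.assoc)
    ultimately show "holder_at \<alpha> (map (\<lambda>m. Mode (\<lambda>_. amp m t - amp m s) (dir m) (freq m) (phase m)) (m # X)) 0 < \<epsilon>"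
      by linarith
  qed (use d1 d2 in auto)
qed

lemma field_freeze:
  "field (map (\<lambda>m. Mode (\<lambda>_. amp m t - amp m s) (dir m) (freq m) (phase m)) X) 0 x = field X t x - field X s x"
  by (induction X) (auto simp: algebra_simps)

lemma simple_function_grid:
  assumes "0 < N"
  shows "simple_function (lebesgue_on {0..1}) (\<lambda>t. real_of_int \<lfloor>real N * t\<rfloor> / real N)"
  unfolding simple_function_def
proof
  have "(\<lambda>t. real_of_int \<lfloor>real N * t\<rfloor> / real N) ` space (lebesgue_on {0..1})
      \<subseteq> (\<lambda>z. real_of_int z / real N) ` {0..int N}"
  proof
    fix y assume "y \<in> (\<lambda>t. real_of_int \<lfloor>real N * t\<rfloor> / real N) ` space (lebesgue_on {0..1})"
    then obtain t where t: "0 \<le> t" "t \<le> 1" "y = real_of_int \<lfloor>real N * t\<rfloor> / real N" by auto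
    have "real N * t \<le> real N * 1" using t by (intro mult_left_mono) auto
    then have "\<lfloor>real N * t\<rfloor> \<in> {0..int N}" using t by (auto simp: floor_le_iff)
    then show "y \<in> (\<lambda>z. real_of_int z / real N) ` {0..int N}" using t(3) by blast
  qed
  then show "finite ((\<lambda>t. real_of_int \<lfloor>real N * t\<rfloor> / real N) ` space (lebesgue_on {0..1}))"
    by (rule finite_subset) simp
  have "(\<lambda>t. real_of_int \<lfloor>real N * t\<rfloor> / real N) \<in> borel_measurable borel" by measurable
  then have "(\<lambda>t. real_of_int \<lfloor>real N * t\<rfloor> / real N) \<in> borel_measurable (lebesgue_on {0..1})"
    by (intro measurable_restrict_space1 measurable_completion) simp
  then show "\<forall>x\<in>(\<lambda>t. real_of_int \<lfloor>real N * t\<rfloor> / real N) ` space (lebesgue_on {0..1}).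
      (\<lambda>t. real_of_int \<lfloor>real N * t\<rfloor> / real N) -` {x} \<inter> space (lebesgue_on {0..1}) \<in> sets (lebesgue_on {0..1})"
    by (intro ballI) (erule measurable_sets, simp)
qed

lemma suminf_tail_tendsto_0:
  fixes f :: "nat \<Rightarrow> real"
  assumes "summable f"
  shows "(\<lambda>n. \<Sum>k. f (k + n)) \<longlonglongrightarrow> 0"
proof -
  have "(\<lambda>n. suminf f - (\<Sum>k<n. f k)) \<longlonglongrightarrow> suminf f - suminf f"
    by (intro tendsto_intros summable_LIMSEQ assms)
  then show ?thesis by (simp add: suminf_minus_initial_segment[OF assms])
qed

text \<open>
  The fields obtained from \<open>Z\<close> by adding the increments \<open>W 0\<close>, \<open>W 1\<close>, \<open>\<dots>\<close>, for which \<open>g\<close> is a common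
  majorant. The weights \<open>2 ^ n\<close> turn square integrability of each increment into square integrability of the
  sum.
\<close>

locale mode_series =
  fixes \<alpha> :: real and Z :: "mode list" and W :: "nat \<Rightarrow> mode list" and g :: "nat \<Rightarrow> real \<Rightarrow> real"
  assumes \<alpha>: "0 < \<alpha>" "\<alpha> < 1"
    and velZ: "velocity_modes Z" and velW: "\<And>n. velocity_modes (W n)"
    and gcont: "\<And>n. continuous_on UNIV (g n)"
    and gsum: "summable (\<lambda>n. integral {0..1} (g n))"
    and g_holder: "\<And>n t. holder_at \<alpha> (W n) t \<le> g n t"
    and g_square: "\<And>n t. 2 ^ n * (size_at (W n) t)\<^sup>2 \<le> g n t"
begin

definition partial_sum :: "nat \<Rightarrow> mode list" where
  "partial_sum n = Z @ concat (map W [0..<n])"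

definition limit :: "real \<Rightarrow> real^3 \<Rightarrow> real^3" where
  "limit t x = indicator (good_times g) t *\<^sub>R (field Z t x + (\<Sum>n. field (W n) t x))"

abbreviation "G \<equiv> good_times g"

lemma g_nonneg: "0 \<le> g n t"
  using g_holder[of n t] holder_at_nonneg[of \<alpha> "W n" t] by linarith

lemmas G_facts = good_times[OF gcont g_nonneg gsum]

lemma G_range: "t \<in> G \<Longrightarrow> 0 \<le> t \<and> t < 1"
  using G_facts(2) by auto

lemma field_partial_sum: "field (partial_sum n) t x = field Z t x + (\<Sum>k<n. field (W k) t x)"
  by (induction n) (auto simp: partial_sum_def add.assoc)

lemma velocity_partial_sum: "velocity_modes (partial_sum n)"
  using velZ velW by (auto simp: partial_sum_def velocity_modes_def)

lemma size_partial_sum: "size_at (partial_sum n) t = size_at Z t + (\<Sum>k<n. size_at (W k) t)"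
  by (induction n) (auto simp: partial_sum_def add.assoc)

lemma summable_parts:
  assumes "t \<in> G"
  shows "summable (\<lambda>n. size_at (W n) t)" "summable (\<lambda>n. holder_part \<alpha> (W n) t)"
    "summable (\<lambda>n. field (W n) t x)" "summable (\<lambda>n. norm (field (W n) t x))"
proof -
  have le: "size_at (W n) t \<le> g n t" "holder_part \<alpha> (W n) t \<le> g n t" for n
    using g_holder[of n t] size_at_nonneg[of "W n" t] holder_part_nonneg[of \<alpha> "W n" t]
    unfolding holder_at_split by linarith+
  show 1: "summable (\<lambda>n. size_at (W n) t)" "summable (\<lambda>n. holder_part \<alpha> (W n) t)"
    by (rule summable_comparison_test'[OF G_facts(3)[OF assms], of 0]; simp add: le)+
  show "summable (\<lambda>n. norm (field (W n) t x))"
    by (rule summable_comparison_test'[OF 1(1), of 0]) (simp add: norm_field_le)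
  then show "summable (\<lambda>n. field (W n) t x)" by (rule summable_norm_cancel)
qed

lemma limit_tail:
  assumes "t \<in> G"
  shows "limit t x - field (partial_sum n) t x = (\<Sum>k. field (W (k + n)) t x)"
  using assms suminf_split_initial_segment[OF summable_parts(3)[OF assms], of x n]
  by (simp add: limit_def field_partial_sum)

lemma limit_tail_bounds:
  assumes t: "t \<in> G"
  shows "norm (limit t x - field (partial_sum n) t x) \<le> (\<Sum>k. size_at (W (k + n)) t)"
    "norm ((limit t x - field (partial_sum n) t x) - (limit t y - field (partial_sum n) t y))
        \<le> (\<Sum>k. holder_part \<alpha> (W (k + n)) t) * dist x y powr \<alpha>"
proof -
  have s: "summable (\<lambda>k. size_at (W (k + n)) t)" "summable (\<lambda>k. holder_part \<alpha> (W (k + n)) t)"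
    "summable (\<lambda>k. field (W (k + n)) t z)" "summable (\<lambda>k. norm (field (W (k + n)) t z))" for z
    using summable_parts[OF t] by (auto intro: summable_ignore_initial_segment)
  show "norm (limit t x - field (partial_sum n) t x) \<le> (\<Sum>k. size_at (W (k + n)) t)"
    unfolding limit_tail[OF t]
    by (rule order.trans[OF summable_norm[OF s(4)] suminf_le[OF _ s(4) s(1)]]) (rule norm_field_le)
  have le: "norm (field (W (k + n)) t x - field (W (k + n)) t y) \<le> holder_part \<alpha> (W (k + n)) t * dist x y powr \<alpha>" for k
    by (rule field_holder[OF \<alpha>])
  have s2: "summable (\<lambda>k. holder_part \<alpha> (W (k + n)) t * dist x y powr \<alpha>)" using s(2) by (rule summable_mult2)
  have s3: "summable (\<lambda>k. norm (field (W (k + n)) t x - field (W (k + n)) t y))"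
    by (rule summable_comparison_test'[OF s2, of 0]) (simp add: le)
  have "norm ((limit t x - field (partial_sum n) t x) - (limit t y - field (partial_sum n) t y))
     = norm (\<Sum>k. field (W (k + n)) t x - field (W (k + n)) t y)"
    unfolding limit_tail[OF t] suminf_diff[OF s(3) s(3)] ..
  also have "\<dots> \<le> (\<Sum>k. norm (field (W (k + n)) t x - field (W (k + n)) t y))" by (rule summable_norm[OF s3])
  also have "\<dots> \<le> (\<Sum>k. holder_part \<alpha> (W (k + n)) t * dist x y powr \<alpha>)" by (rule suminf_le[OF le s3 s2])
  also have "\<dots> = (\<Sum>k. holder_part \<alpha> (W (k + n)) t) * dist x y powr \<alpha>" using s(2) by (rule suminf_mult2[symmetric])
  finally show "norm ((limit t x - field (partial_sum n) t x) - (limit t y - field (partial_sum n) t y))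
        \<le> (\<Sum>k. holder_part \<alpha> (W (k + n)) t) * dist x y powr \<alpha>" .
qed

lemma limit_pointwise:
  assumes t: "t \<in> G"
  shows "(\<lambda>n. field (partial_sum n) t x) \<longlonglongrightarrow> limit t x"
proof -
  have "(\<lambda>n. field (partial_sum n) t x - limit t x) \<longlonglongrightarrow> 0"
  proof (rule Lim_null_comparison)
    show "\<forall>\<^sub>F n in sequentially. norm (field (partial_sum n) t x - limit t x) \<le> (\<Sum>k. size_at (W (k + n)) t)"
      using limit_tail_bounds(1)[OF t] by (intro always_eventually) (simp add: norm_minus_commute)
  qed (rule suminf_tail_tendsto_0[OF summable_parts(1)[OF t]])
  then show ?thesis by (simp add: LIM_zero_iff)
qed

lemma limit_off: "t \<notin> G \<Longrightarrow> limit t x = 0"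
  by (simp add: limit_def)

lemma limit_periodic: "torus_periodic (limit t)"
  using field_periodic[OF velZ, of t] field_periodic[OF velW, of _ t]
  by (simp add: torus_periodic_def limit_def)

lemma field_borel:
  assumes "velocity_modes X"
  shows "(\<lambda>p. field X (fst p) (snd p)) \<in> borel_measurable borel"
  by (intro borel_measurable_continuous_onI continuous_field velocity_modes_continuous assms)

lemma limit_borel: "(\<lambda>p. limit (fst p) (snd p)) \<in> borel_measurable borel"
proof -
  have [measurable]: "(\<lambda>p. field (W n) (fst p) (snd p)) \<in> borel_measurable borel"
    "(\<lambda>p. field Z (fst p) (snd p)) \<in> borel_measurable borel" for n
    using velW velZ by (auto intro: field_borel)
  have [measurable]: "G \<in> sets borel" by (rule G_facts(1))
  have [measurable]: "(fst :: real \<times> (real^3) \<Rightarrow> real) \<in> borel_measurable borel"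
    by (intro borel_measurable_continuous_onI continuous_intros)
  show ?thesis unfolding limit_def by measurable
qed

text \<open>
  For \<open>S\<close> a bound for the size of \<open>Z\<close>, this integrable function of time dominates the squares of all
  partial sums; it is the majorant in the passage to the limit in the quadratic terms.
\<close>

definition majorant :: "real \<Rightarrow> real \<Rightarrow> real" where
  "majorant S t = 2 * S\<^sup>2 + 4 * (indicator G t * (\<Sum>n. g n t))"

lemma partial_sum_square:
  assumes t: "t \<in> G" and S: "size_at Z t \<le> S"
  shows "(size_at (partial_sum n) t)\<^sup>2 \<le> majorant S t"
proof -
  let ?s = "\<lambda>k. size_at (W k) t"
  (* Cauchy-Schwarz with the weights 2^(-k) and 2^k. *)
  have "(\<Sum>k<n. ?s k)\<^sup>2 = (\<Sum>k<n. sqrt ((1/2) ^ k) * (sqrt (2 ^ k) * ?s k))\<^sup>2"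
    by (simp add: mult.assoc[symmetric] real_sqrt_mult[symmetric] power_mult_distrib[symmetric])
  also have "\<dots> \<le> (\<Sum>k<n. (sqrt ((1/2) ^ k))\<^sup>2) * (\<Sum>k<n. (sqrt (2 ^ k) * ?s k)\<^sup>2)"
    by (rule Cauchy_Schwarz_ineq_sum)
  also have "\<dots> = (\<Sum>k<n. (1/2) ^ k) * (\<Sum>k<n. 2 ^ k * (?s k)\<^sup>2)"
    by (simp add: power_mult_distrib)
  also have "\<dots> \<le> 2 * (\<Sum>k. g k t)"
  proof (rule mult_mono)
    have "(\<Sum>k<n. (1/2::real) ^ k) \<le> (\<Sum>k. (1/2) ^ k)" by (intro sum_le_suminf summable_geometric) auto
    then show "(\<Sum>k<n. (1/2::real) ^ k) \<le> 2" by (simp add: suminf_geometric)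
    have "(\<Sum>k<n. 2 ^ k * (?s k)\<^sup>2) \<le> (\<Sum>k<n. g k t)" by (intro sum_mono g_square)
    also have "\<dots> \<le> (\<Sum>k. g k t)" using g_nonneg by (intro sum_le_suminf G_facts(3)[OF t]) auto
    finally show "(\<Sum>k<n. 2 ^ k * (?s k)\<^sup>2) \<le> (\<Sum>k. g k t)" .
  qed (auto intro!: sum_nonneg)
  finally have 1: "(\<Sum>k<n. ?s k)\<^sup>2 \<le> 2 * (\<Sum>k. g k t)" .
  have 2: "(size_at Z t)\<^sup>2 \<le> S\<^sup>2" using S by (intro power_mono) auto
  have "(size_at (partial_sum n) t)\<^sup>2 \<le> 2 * (size_at Z t)\<^sup>2 + 2 * (\<Sum>k<n. ?s k)\<^sup>2"
    unfolding size_partial_sum using sum_squares_bound[of "size_at Z t" "\<Sum>k<n. ?s k"] by (simp add: power2_sum)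
  then show ?thesis using 1 2 t by (simp add: majorant_def)
qed

lemma partial_sum_norm_square:
  assumes t: "t \<in> G" and S: "size_at Z t \<le> S"
  shows "(norm (field (partial_sum n) t x))\<^sup>2 \<le> majorant S t"
  using power_mono[OF norm_field_le norm_ge_zero, of "partial_sum n" t x 2] partial_sum_square[OF assms, of n] by linarith

lemma limit_norm_square:
  assumes t: "t \<in> G" and S: "size_at Z t \<le> S"
  shows "(norm (limit t x))\<^sup>2 \<le> majorant S t"
  by (rule LIMSEQ_le_const2[OF tendsto_power[OF tendsto_norm[OF limit_pointwise[OF t]]]])
     (use partial_sum_norm_square[OF assms] in auto)

lemma limit_holder: "limit t \<in> torus_holder \<alpha>"
  and limit_holder_norm: "t \<in> G \<Longrightarrow> holder_norm \<alpha> (limit t) \<le> holder_at \<alpha> Z t + (\<Sum>n. g n t)"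
proof -
  have *: "norm (limit t x) \<le> size_at Z t + (\<Sum>k. size_at (W k) t)"
    "norm (limit t x - limit t y) \<le> (holder_part \<alpha> Z t + (\<Sum>k. holder_part \<alpha> (W k) t)) * dist x y powr \<alpha>"
    if t: "t \<in> G" for x y
  proof -
    note b = limit_tail_bounds[OF t, of _ 0]
    have f0: "field (partial_sum 0) t x = field Z t x" for x by (simp add: partial_sum_def)
    show "norm (limit t x) \<le> size_at Z t + (\<Sum>k. size_at (W k) t)"
      using b(1)[of x] norm_field_le[of Z t x] norm_triangle_ineq[of "limit t x - field Z t x" "field Z t x"]
      by (simp add: f0)
    have "norm (limit t x - limit t y) \<le> norm ((limit t x - field Z t x) - (limit t y - field Z t y)) + norm (field Z t x - field Z t y)"
      using norm_triangle_ineq[of "(limit t x - field Z t x) - (limit t y - field Z t y)" "field Z t x - field Z t y"] by simp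
    then show "norm (limit t x - limit t y) \<le> (holder_part \<alpha> Z t + (\<Sum>k. holder_part \<alpha> (W k) t)) * dist x y powr \<alpha>"
      using b(2)[of x y] field_holder[OF \<alpha>, of Z t x y] by (simp add: f0 distrib_right)
  qed
  show "limit t \<in> torus_holder \<alpha>"
  proof (cases "t \<in> G")
    case True
    show ?thesis by (rule torus_holderI[OF limit_periodic *[OF True]])
  next
    case False
    show ?thesis by (rule torus_holderI[OF limit_periodic, where A = 0 and C = 0]) (use False in \<open>auto simp: limit_off\<close>)
  qed
  show "holder_norm \<alpha> (limit t) \<le> holder_at \<alpha> Z t + (\<Sum>n. g n t)" if t: "t \<in> G"
  proof -
    have "(\<Sum>k. size_at (W k) t) + (\<Sum>k. holder_part \<alpha> (W k) t) = (\<Sum>k. holder_at \<alpha> (W k) t)"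
      unfolding holder_at_split by (rule suminf_add[OF summable_parts(1,2)[OF t]])
    also have "\<dots> \<le> (\<Sum>k. g k t)"
      using summable_add[OF summable_parts(1,2)[OF t]]
      by (intro suminf_le g_holder G_facts(3)[OF t]) (simp add: holder_at_split)
    finally show ?thesis using holder_norm_le[OF *[OF t]] unfolding holder_at_split by linarith
  qed
qed

definition holder_close :: "(real^3 \<Rightarrow> real^3) \<Rightarrow> (real^3 \<Rightarrow> real^3) \<Rightarrow> real \<Rightarrow> bool" where
  "holder_close u w \<delta> \<longleftrightarrow> (\<exists>A C. A + C < \<delta> \<and> (\<forall>x. norm (u x - w x) \<le> A) \<and>
     (\<forall>x y. norm ((u x - w x) - (u y - w y)) \<le> C * dist x y powr \<alpha>))"

definition close_on_grid :: "nat \<Rightarrow> nat \<Rightarrow> bool" where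
  "close_on_grid n N \<longleftrightarrow> 0 < N \<and> (\<forall>t\<in>{0..1}. holder_close (field (partial_sum n) t)
     (field (partial_sum n) (real_of_int \<lfloor>real N * t\<rfloor> / real N)) (1 / 2 ^ n))"

lemma grid_step: "\<exists>N. close_on_grid n N"
proof -
  have cm: "continuous_modes (partial_sum n)" by (rule velocity_modes_continuous[OF velocity_partial_sum])
  have e0: "0 < (1::real) / 2 ^ n" by simp
  obtain \<delta> where \<delta>: "\<delta> > 0" "\<forall>t\<in>{0..1}. \<forall>s\<in>{0..1}. \<bar>t - s\<bar> < \<delta> \<longrightarrow>
     holder_at \<alpha> (map (\<lambda>m. Mode (\<lambda>_. amp m t - amp m s) (dir m) (freq m) (phase m)) (partial_sum n)) 0 < 1 / 2 ^ n"
    using amplitudes_uniformly_continuous[OF cm e0, of \<alpha>] by blast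
  then have d: "\<delta> > 0" "\<And>t s. t \<in> {0..1} \<Longrightarrow> s \<in> {0..1} \<Longrightarrow> \<bar>t - s\<bar> < \<delta> \<Longrightarrow>
     holder_at \<alpha> (map (\<lambda>m. Mode (\<lambda>_. amp m t - amp m s) (dir m) (freq m) (phase m)) (partial_sum n)) 0 < 1 / 2 ^ n"
    by blast+
  obtain N :: nat where N: "1 / \<delta> < real N" using reals_Archimedean2 by blast
  have N0: "0 < real N" using N d by (meson less_trans zero_less_divide_1_iff)
  have N1: "1 / real N < \<delta>" using N N0 d by (simp add: field_simps)
  show ?thesis unfolding close_on_grid_def
  proof (intro exI[of _ N] conjI ballI)
    show "0 < N" using N0 by simp
    fix t :: real assume t: "t \<in> {0..1}"
    define s where "s = real_of_int \<lfloor>real N * t\<rfloor> / real N"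
    have fl: "real_of_int \<lfloor>real N * t\<rfloor> \<le> real N * t" "real N * t < real_of_int \<lfloor>real N * t\<rfloor> + 1" by linarith+
    have st: "s \<le> t" using fl(1) N0 by (simp add: s_def pos_divide_le_eq mult.commute)
    moreover have "t < (real_of_int \<lfloor>real N * t\<rfloor> + 1) / real N"
      using fl(2) N0 by (simp only: pos_less_divide_eq mult.commute)
    then have "t - s < 1 / real N" by (simp add: s_def add_divide_distrib)
    moreover have "0 \<le> s" using t N0 by (simp add: s_def)
    ultimately have "s \<in> {0..1}" "\<bar>t - s\<bar> < \<delta>" using t N1 by auto
    note lt = d(2)[OF t this]
    let ?D = "map (\<lambda>m. Mode (\<lambda>_. amp m t - amp m s) (dir m) (freq m) (phase m)) (partial_sum n)"
    show "holder_close (field (partial_sum n) t)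
        (field (partial_sum n) (real_of_int \<lfloor>real N * t\<rfloor> / real N)) (1 / 2 ^ n)"
      unfolding holder_close_def s_def[symmetric] field_freeze[of t s, symmetric]
      by (rule exI[of _ "size_at ?D 0"], rule exI[of _ "holder_part \<alpha> ?D 0"])
         (use lt norm_field_le field_holder[OF \<alpha>] in \<open>auto simp: holder_at_split\<close>)
  qed
qed

lemma AE_good: "AE t in lebesgue_on {0..1}. t \<in> G"
proof -
  have "AE t in lebesgue. t \<in> {0..<1} \<longrightarrow> t \<in> G" by (rule AE_completion[OF G_facts(4)])
  moreover have "AE t in lebesgue. t \<noteq> (1::real)" by (rule AE_completion[OF AE_lborel_singleton])
  ultimately have "AE t in lebesgue. t \<in> {0..1} \<longrightarrow> t \<in> G" by eventually_elim auto
  then show ?thesis by (subst AE_restrict_space_iff) auto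
qed

text \<open>
  The Hoelder norm of the limit is measurable in time as a limit of norms of simple functions, which exist
  because each partial sum is uniformly continuous in time with values in \<open>C\<^sup>\<alpha>\<close>.
\<close>

lemma limit_L1_holder: "L1_holder \<alpha> 1 limit"
proof -
  obtain N where N': "\<And>n. close_on_grid n (N n)" using grid_step by metis
  then have N: "\<And>n. 0 < N n" by (simp add: close_on_grid_def)
  (* Freezing the partial sums on a time grid gives simple functions with values in the Hoelder space. *)
  define s where "s n t = field (partial_sum n) (real_of_int \<lfloor>real (N n) * t\<rfloor> / real (N n))" for n t
  have simple: "simple_function (lebesgue_on {0..1}) (s n)" for n
    unfolding s_def using simple_function_compose[OF simple_function_grid[OF N[of n]], of "field (partial_sum n)"]
    by (simp add: comp_def)
  have s_holder: "s n t \<in> torus_holder \<alpha>" for n t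
    unfolding s_def
    by (rule torus_holderI[OF field_periodic[OF velocity_partial_sum] norm_field_le field_holder[OF \<alpha>]])
  have conv: "(\<lambda>n. holder_norm \<alpha> (\<lambda>x. limit t x - s n t x)) \<longlonglongrightarrow> 0" if t: "t \<in> G" for t
  proof (rule Lim_null_comparison)
    have t01: "t \<in> {0..1}" using G_range[OF t] by auto
    show "\<forall>\<^sub>F n in sequentially. norm (holder_norm \<alpha> (\<lambda>x. limit t x - s n t x)) \<le>
        ((\<Sum>k. size_at (W (k + n)) t) + (\<Sum>k. holder_part \<alpha> (W (k + n)) t)) + (1/2) ^ n"
    proof (intro always_eventually allI)
      fix n
      obtain A C where AC: "A + C < 1 / 2 ^ n" "\<And>x. norm (field (partial_sum n) t x - s n t x) \<le> A"
        "\<And>x y. norm ((field (partial_sum n) t x - s n t x) - (field (partial_sum n) t y - s n t y)) \<le> C * dist x y powr \<alpha>"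
        using N'[of n] t01 unfolding close_on_grid_def holder_close_def s_def by blast
      have "holder_norm \<alpha> (\<lambda>x. limit t x - s n t x) \<le>
        ((\<Sum>k. size_at (W (k + n)) t) + A) + ((\<Sum>k. holder_part \<alpha> (W (k + n)) t) + C)"
      proof (rule holder_norm_le)
        fix x y
        let ?d = "\<lambda>x. limit t x - field (partial_sum n) t x" and ?e = "\<lambda>x. field (partial_sum n) t x - s n t x"
        have eq: "limit t x - s n t x = ?d x + ?e x" for x by simp
        show "norm (limit t x - s n t x) \<le> (\<Sum>k. size_at (W (k + n)) t) + A"
          unfolding eq by (rule norm_triangle_mono[OF limit_tail_bounds(1)[OF t] AC(2)])
        have "limit t x - s n t x - (limit t y - s n t y) = (?d x - ?d y) + (?e x - ?e y)" by simp
        then show "norm (limit t x - s n t x - (limit t y - s n t y)) \<le>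
            ((\<Sum>k. holder_part \<alpha> (W (k + n)) t) + C) * dist x y powr \<alpha>"
          unfolding distrib_right by (simp only: norm_triangle_mono[OF limit_tail_bounds(2)[OF t] AC(3)])
      qed
      moreover have "0 \<le> holder_norm \<alpha> (\<lambda>x. limit t x - s n t x)"
        using holder_norm_triangle[OF limit_holder s_holder, of t n t] by linarith
      ultimately show "norm (holder_norm \<alpha> (\<lambda>x. limit t x - s n t x)) \<le>
        ((\<Sum>k. size_at (W (k + n)) t) + (\<Sum>k. holder_part \<alpha> (W (k + n)) t)) + (1/2) ^ n"
        using AC(1) by (simp add: power_one_over)
    qed
    have "(\<lambda>n. ((\<Sum>k. size_at (W (k + n)) t) + (\<Sum>k. holder_part \<alpha> (W (k + n)) t)) + (1/2) ^ n) \<longlonglongrightarrow> (0 + 0) + 0"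
      by (intro tendsto_add suminf_tail_tendsto_0 summable_parts[OF t] LIMSEQ_realpow_zero) auto
    then show "(\<lambda>n. ((\<Sum>k. size_at (W (k + n)) t) + (\<Sum>k. holder_part \<alpha> (W (k + n)) t)) + (1/2) ^ n) \<longlonglongrightarrow> 0"
      by simp
  qed
  have norm_conv: "(\<lambda>n. indicator G t * holder_norm \<alpha> (s n t)) \<longlonglongrightarrow> holder_norm \<alpha> (limit t)" for t
  proof (cases "t \<in> G")
    case True
    have "(\<lambda>n. holder_norm \<alpha> (s n t) - holder_norm \<alpha> (limit t)) \<longlonglongrightarrow> 0"
    proof (rule Lim_null_comparison[OF _ conv[OF True]])
      show "\<forall>\<^sub>F n in sequentially. norm (holder_norm \<alpha> (s n t) - holder_norm \<alpha> (limit t))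
          \<le> holder_norm \<alpha> (\<lambda>x. limit t x - s n t x)"
        using holder_norm_triangle[OF limit_holder s_holder, of t _ t]
        by (intro always_eventually) (simp add: abs_minus_commute)
    qed
    then show ?thesis using True by (simp add: LIM_zero_iff)
  next
    case False
    have 1: "\<bar>holder_norm \<alpha> (limit t) - holder_norm \<alpha> (limit t)\<bar> \<le> holder_norm \<alpha> (\<lambda>x. limit t x - limit t x)"
      by (rule holder_norm_triangle[OF limit_holder limit_holder])
    have "holder_norm \<alpha> (limit t) \<le> 0 + 0"
      by (rule holder_norm_le) (use False in \<open>auto simp: limit_off\<close>)
    moreover have "limit t = (\<lambda>x. limit t x - limit t x)" using False by (auto simp: limit_off)
    ultimately have "holder_norm \<alpha> (limit t) = 0" using 1 by simp
    then show ?thesis using False by simp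
  qed
  have Gm: "G \<in> sets (lebesgue_on {0..1})"
    using G_facts(1,2) by (auto simp: sets_restrict_space image_iff intro!: bexI[of _ G])
  have meas: "(\<lambda>t. holder_norm \<alpha> (limit t)) \<in> borel_measurable (lebesgue_on {0..1})"
  proof (rule borel_measurable_LIMSEQ_metric[of "\<lambda>n t. indicator G t * holder_norm \<alpha> (s n t)"])
    fix n
    have "simple_function (lebesgue_on {0..1}) (\<lambda>t. holder_norm \<alpha> (s n t))"
      using simple_function_compose[OF simple[of n], of "holder_norm \<alpha>"] by (simp add: comp_def)
    then have "(\<lambda>t. holder_norm \<alpha> (s n t)) \<in> borel_measurable (lebesgue_on {0..1})"
      by (rule borel_measurable_simple_function)
    then show "(\<lambda>t. indicator G t * holder_norm \<alpha> (s n t)) \<in> borel_measurable (lebesgue_on {0..1})"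
      using Gm by (intro borel_measurable_times borel_measurable_indicator)
  qed (rule norm_conv)
  have dom: "integrable (lebesgue_on {0..1}) (\<lambda>t. holder_at \<alpha> Z t + indicator G t * (\<Sum>n. g n t))"
  proof (rule Bochner_Integration.integrable_add)
    show "integrable (lebesgue_on {0..1}) (holder_at \<alpha> Z)"
      by (intro continuous_imp_integrable_real) (simp add: continuous_on_sizes velocity_modes_continuous velZ)
    have eq: "indicator {0..1} t *\<^sub>R (indicator G t * (\<Sum>n. g n t)) = indicator G t * (\<Sum>n. g n t)" for t
      using G_range[of t] by (auto simp: indicator_def)
    show "integrable (lebesgue_on {0..1}) (\<lambda>t. indicator G t * (\<Sum>n. g n t))"
      using G_facts(5) borel_measurable_integrable[OF G_facts(5)]
      by (subst lebesgue_on_eq_lborel(2)) (simp_all add: eq del: real_scaleR_def)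
  qed
  have int: "integrable (lebesgue_on {0..1}) (\<lambda>t. holder_norm \<alpha> (limit t))"
  proof (rule Bochner_Integration.integrable_bound[OF dom meas])
    show "AE t in lebesgue_on {0..1}. norm (holder_norm \<alpha> (limit t)) \<le> norm (holder_at \<alpha> Z t + indicator G t * (\<Sum>n. g n t))"
      using AE_good
    proof eventually_elim
      case (elim t)
      have "0 \<le> holder_norm \<alpha> (limit t)"
      proof -
        obtain A C where "holder_norm \<alpha> (limit t) = A + C" "\<And>x. norm (limit t x) \<le> A"
          "\<And>x y. norm (limit t x - limit t y) \<le> C * dist x y powr \<alpha>"
          using torus_holder_norms[OF limit_holder[of t]] by metis
        moreover have "0 \<le> A" using calculation(2)[of 0] norm_ge_zero order.trans by blast
        moreover have "0 \<le> C" using order.trans[OF norm_ge_zero calculation(3)[of 0 1]]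
          by (simp add: zero_le_mult_iff)
        ultimately show ?thesis by simp
      qed
      then show ?case using limit_holder_norm[OF elim] elim by simp
    qed
  qed
  show ?thesis
    unfolding L1_holder_def
  proof (intro conjI exI[of _ s] allI ballI)
    show "AE t in lebesgue_on {0..1}. limit t \<in> torus_holder \<alpha>" using limit_holder by simp
    show "AE t in lebesgue_on {0..1}. (\<lambda>n. holder_norm \<alpha> (\<lambda>x. limit t x - s n t x)) \<longlonglongrightarrow> 0"
      using AE_good conv by (auto elim: eventually_mono)
  qed (use simple s_holder int in auto)
qed

end

section \<open>Passage to the limit in the weak formulation\<close>

lemma fst_borel [measurable]: "(fst :: real \<times> (real^3) \<Rightarrow> real) \<in> borel_measurable borel"
  by (intro borel_measurable_continuous_onI continuous_intros)

lemma slab_time_integrable: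
  fixes f :: "real \<Rightarrow> real"
  assumes [measurable]: "f \<in> borel_measurable borel" and int: "integrable lborel (\<lambda>t. indicator {0..<1} t * f t)"
  shows "integrable lborel (\<lambda>p::real \<times> (real^3). indicator slab p * f (fst p))"
    "(\<integral>p. indicator slab p * f (fst (p :: real \<times> (real^3))) \<partial>lborel) = (\<integral>t. indicator {0..<1} t * f t \<partial>lborel)"
proof -
  let ?F = "\<lambda>p::real \<times> (real^3). indicator slab p * f (fst p)"
  have m: "?F \<in> borel_measurable borel" by measurable
  have cell: "integrable lborel (indicator torus_cell :: real^3 \<Rightarrow> real)" "(\<integral>x. indicator torus_cell x \<partial>lborel) = (1::real)"
    using measure_torus_cell(1) by (auto simp: measure_def)
  have sl: "indicator slab (t, x) * f t = (indicator {0..<1} t * f t) * indicator torus_cell x" for t and x :: "real^3"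
    by (simp add: indicator_times)
  have "integrable (lborel \<Otimes>\<^sub>M lborel) ?F"
  proof (rule lborel_pair.Fubini_integrable)
    show "?F \<in> borel_measurable (lborel \<Otimes>\<^sub>M lborel)" using m by (simp add: lborel_prod)
    have "(\<integral>y. norm (?F (t, y)) \<partial>lborel) = \<bar>indicator {0..<1} t * f t\<bar>" for t
    proof -
      have "norm (?F (t, y)) = \<bar>indicator {0..<1} t * f t\<bar> * indicator torus_cell y" for y
        by (simp add: sl abs_mult)
      then show ?thesis using cell by simp
    qed
    then show "integrable lborel (\<lambda>t. \<integral>y. norm (?F (t, y)) \<partial>lborel)" using int by simp
    show "AE t in lborel. integrable lborel (\<lambda>y. ?F (t, y))" using cell by (simp add: sl)
  qed
  then have int2: "integrable (lborel \<Otimes>\<^sub>M lborel) (case_prod (\<lambda>t x. ?F (t, x)))" by (simp add: case_prod_unfold)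
  then show "integrable lborel ?F" by (simp add: lborel_prod case_prod_unfold)
  have "integral\<^sup>L lborel ?F = integral\<^sup>L (lborel \<Otimes>\<^sub>M lborel) (case_prod (\<lambda>t x. ?F (t, x)))"
    by (simp add: lborel_prod case_prod_unfold)
  also have "\<dots> = (\<integral>t. (\<integral>x. ?F (t, x) \<partial>lborel) \<partial>lborel)" by (rule lborel_pair.integral_fst[OF int2, symmetric])
  also have "\<dots> = (\<integral>t. indicator {0..<1} t * f t \<partial>lborel)" using cell by (simp add: sl)
  finally show "integral\<^sup>L lborel ?F = (\<integral>t. indicator {0..<1} t * f t \<partial>lborel)" .
qed

lemma smooth_scalar:
  assumes "torus_smooth (\<psi> :: real^3 \<Rightarrow> real)"
  shows "torus_periodic \<psi>" "\<And>x. \<psi> differentiable (at x)" "\<And>j. continuous_on UNIV (partial j \<psi>)"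
proof -
  have "Ck_on (Suc 0) UNIV \<psi>" using assms by (auto simp: torus_smooth_def smooth_on_def)
  then show "\<And>x. \<psi> differentiable (at x)" "\<And>j. continuous_on UNIV (partial j \<psi>)"
    by (auto simp: differentiable_on_def partial_def[abs_def])
  show "torus_periodic \<psi>" using assms by (simp add: torus_smooth_def)
qed

lemma field_div_free:
  assumes "velocity_modes X" and \<psi>: "torus_smooth (\<psi> :: real^3 \<Rightarrow> real)"
  shows "cell_int (\<lambda>x. \<Sum>j\<in>UNIV. field X t x $ j * partial j \<psi> x) = 0"
  using assms(1)
proof (induction X)
  case (Cons m X)
  note s = smooth_scalar[OF \<psi>]
  have m: "integer_vec (freq m)" "dir m \<bullet> freq m = 0" "velocity_modes X" using Cons.prems by (auto simp: velocity_modes_Cons)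
  have cf: "continuous_on UNIV (field X t)"
    unfolding field_def by (induction X) (auto intro!: continuous_intros)
  have I: "integrable (lebesgue_on torus_cell) (\<lambda>x. wave (freq m) (phase m) x * partial j \<psi> x)" for j
    by (intro cell_integrable continuous_intros s)
  have "cell_int (\<lambda>x. \<Sum>j\<in>UNIV. field (m # X) t x $ j * partial j \<psi> x) =
     cell_int (\<lambda>x. (\<Sum>j\<in>UNIV. (amp m t * dir m $ j) * (wave (freq m) (phase m) x * partial j \<psi> x))
       + (\<Sum>j\<in>UNIV. field X t x $ j * partial j \<psi> x))"
    by (simp add: algebra_simps sum.distrib)
  also have "\<dots> = cell_int (\<lambda>x. \<Sum>j\<in>UNIV. (amp m t * dir m $ j) * (wave (freq m) (phase m) x * partial j \<psi> x))
      + cell_int (\<lambda>x. \<Sum>j\<in>UNIV. field X t x $ j * partial j \<psi> x)"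
    by (intro Bochner_Integration.integral_add cell_integrable continuous_intros s cf)
  also have "cell_int (\<lambda>x. \<Sum>j\<in>UNIV. (amp m t * dir m $ j) * (wave (freq m) (phase m) x * partial j \<psi> x))
      = (\<Sum>j\<in>UNIV. (amp m t * dir m $ j) * cell_int (\<lambda>x. wave (freq m) (phase m) x * partial j \<psi> x))"
    using I by (subst Bochner_Integration.integral_sum) auto
  also have "\<dots> = (\<Sum>j\<in>UNIV. amp m t * 2 * pi * cell_int (\<lambda>x. wave (freq m) (phase m - pi/2) x * \<psi> x) * (dir m $ j * freq m $ j))"
    by (intro sum.cong refl) (subst wave_ibp[OF m(1) s], simp add: mult_ac)
  also have "\<dots> = amp m t * 2 * pi * cell_int (\<lambda>x. wave (freq m) (phase m - pi/2) x * \<psi> x) * (dir m \<bullet> freq m)"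
    by (simp add: inner_vec_def sum_distrib_left)
  finally show ?case using m Cons.IH by simp
qed simp

lemma AE_slab_time:
  assumes G: "G \<in> sets borel" and ae: "AE t in lborel. t \<in> {0..<1::real} \<longrightarrow> t \<in> G"
  shows "AE p in lborel. p \<in> slab \<longrightarrow> fst p \<in> G"
proof -
  define N where "N = {0..<1} - G"
  have N: "N \<in> sets borel" using G by (auto simp: N_def)
  have "AE t in lborel. t \<notin> N" using ae by eventually_elim (auto simp: N_def)
  then have "N \<in> null_sets lborel" using N by (subst (asm) AE_iff_null_sets[symmetric]) auto
  then have N0: "emeasure lborel N = 0" by auto
  have "emeasure lborel (N \<times> (UNIV :: (real^3) set)) = emeasure (lborel \<Otimes>\<^sub>M lborel) (N \<times> (UNIV :: (real^3) set))" by (simp only: lborel_prod)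
  also have "\<dots> = emeasure lborel N * emeasure lborel (UNIV :: (real^3) set)"
    using N by (intro lborel.emeasure_pair_measure_Times) auto
  finally have "emeasure lborel (N \<times> (UNIV :: (real^3) set)) = 0" using N0 by simp
  moreover have "N \<times> (UNIV :: (real^3) set) \<in> sets borel" using N by (intro borel_Times) auto
  ultimately have "N \<times> (UNIV :: (real^3) set) \<in> null_sets lborel" by (intro null_setsI) auto
  then show ?thesis by (rule AE_I') (auto simp: N_def)
qed

context mode_series
begin

lemma G_borel [measurable]: "G \<in> sets borel"
  by (rule G_facts(1))

lemma majorant_nonneg: "0 \<le> majorant S t"
proof (cases "t \<in> G")
  case True
  then show ?thesis using suminf_nonneg[OF G_facts(3)[OF True] g_nonneg] by (simp add: majorant_def)
qed (simp add: majorant_def)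

lemma majorant_borel [measurable]: "majorant S \<in> borel_measurable borel"
  using borel_measurable_integrable[OF G_facts(5)] unfolding majorant_def by (simp add: borel_measurable_add borel_measurable_times)

lemma majorant_integrable: "integrable lborel (\<lambda>p::real \<times> (real^3). indicator slab p * majorant S (fst p))"
proof (rule slab_time_integrable(1)[OF majorant_borel])
  have "indicator {0..<1} t * majorant S t = indicator {0..<1} t * (2 * S\<^sup>2) + 4 * (indicator G t * (\<Sum>n. g n t))" for t
    using G_range[of t] by (auto simp: majorant_def indicator_def)
  moreover have "integrable lborel (\<lambda>t. indicator {0..<1} t * (2 * S\<^sup>2) + 4 * (indicator G t * (\<Sum>n. g n t)))"
    by (intro Bochner_Integration.integrable_add integrable_mult_left integrable_mult_right G_facts(5)
        integrable_real_indicator) auto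
  ultimately show "integrable lborel (\<lambda>t. indicator {0..<1} t * majorant S t)" by presburger
qed

lemma limit_L2: "L2_spacetime 1 limit"
  unfolding L2_spacetime_def
proof (intro conjI ballI)
  show "torus_periodic (limit t)" for t by (rule limit_periodic)
  note b [measurable] = limit_borel
  have m1: "(\<lambda>p. indicator slab p *\<^sub>R limit (fst p) (snd p)) \<in> borel_measurable borel" by measurable
  show "(\<lambda>(t, x). limit t x) \<in> borel_measurable (spacetime 1)"
    by (rule spacetime_integral(1)[OF m1]) auto
  have m2: "(\<lambda>p. indicator slab p * (norm (limit (fst p) (snd p)))\<^sup>2) \<in> borel_measurable borel" by measurable
  obtain S where S: "0 < S" "\<And>t. t \<in> {0..1} \<Longrightarrow> size_at Z t \<le> S"
    using continuous_modes_bound[OF velocity_modes_continuous[OF velZ]] by metis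
  have "integrable lborel (\<lambda>p. indicator slab p * (norm (limit (fst p) (snd p)))\<^sup>2)"
  proof (rule Bochner_Integration.integrable_bound[OF majorant_integrable[of S]])
    show "AE p in lborel. norm (indicator slab p * (norm (limit (fst p) (snd p)))\<^sup>2) \<le> norm (indicator slab p * majorant S (fst p))"
    proof (rule AE_I2)
      fix p
      have "(norm (limit (fst p) (snd p)))\<^sup>2 \<le> majorant S (fst p)"
      proof (cases "fst p \<in> G")
        case True
        then show ?thesis using G_range[OF True] S(2)[of "fst p"] by (intro limit_norm_square) auto
      next
        case False
        then show ?thesis using majorant_nonneg by (simp add: limit_off)
      qed
      then show "norm (indicator slab p * (norm (limit (fst p) (snd p)))\<^sup>2) \<le> norm (indicator slab p * majorant S (fst p))"
        using majorant_nonneg[of S "fst p"] by (simp add: indicator_def)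
    qed
  qed (use m2 in simp)
  then show "integrable (spacetime 1) (\<lambda>(t, x). (norm (limit t x))\<^sup>2)"
    by (subst spacetime_integral(3)[OF m2]) auto
qed

lemma limit_div_free: "weakly_div_free (limit t)"
proof (cases "t \<in> G")
  case False
  then show ?thesis by (simp add: weakly_div_free_def limit_off)
next
  case True
  show ?thesis unfolding weakly_div_free_def
  proof (intro allI impI)
    fix \<psi> :: "real^3 \<Rightarrow> real" assume \<psi>: "torus_smooth \<psi>"
    note s = smooth_scalar[OF \<psi>]
    obtain S where S: "size_at Z t \<le> S" by blast
    have "\<forall>j. \<exists>C>0. \<forall>x\<in>torus_cell. norm (partial j \<psi> x) \<le> C"
      using cell_bounded[OF s(3)] by metis
    then obtain C where C: "\<And>j. 0 < C j" "\<And>j x. x \<in> torus_cell \<Longrightarrow> \<bar>partial j \<psi> x\<bar> \<le> C j"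
      unfolding real_norm_def by metis
    let ?f = "\<lambda>n x. \<Sum>j\<in>UNIV. field (partial_sum n) t x $ j * partial j \<psi> x"
    have cf: "continuous_on UNIV (field X t)" for X
      unfolding field_def by (induction X) (auto intro!: continuous_intros)
    have lim: "(\<lambda>n. ?f n x) \<longlonglongrightarrow> (\<Sum>j\<in>UNIV. limit t x $ j * partial j \<psi> x)" for x
      by (intro tendsto_sum tendsto_mult tendsto_vec_nth tendsto_const limit_pointwise True)
    have fm: "?f n \<in> borel_measurable (lebesgue_on torus_cell)" for n
      by (intro cell_measurable continuous_intros cf s)
    have "(\<lambda>n. cell_int (?f n)) \<longlonglongrightarrow> cell_int (\<lambda>x. \<Sum>j\<in>UNIV. limit t x $ j * partial j \<psi> x)"
    proof (rule integral_dominated_convergence[where w = "\<lambda>_. \<Sum>j\<in>UNIV. (1 + majorant S t) * C j"])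
      show "(\<lambda>x. \<Sum>j\<in>UNIV. limit t x $ j * partial j \<psi> x) \<in> borel_measurable (lebesgue_on torus_cell)"
        by (rule borel_measurable_LIMSEQ_metric[OF fm lim])
      show "integrable (lebesgue_on torus_cell) (\<lambda>_. \<Sum>j\<in>UNIV. (1 + majorant S t) * C j)"
        by (rule finite_measure.integrable_const[OF finite_measure_cell])
      have "norm (?f n x) \<le> (\<Sum>j\<in>UNIV. (1 + majorant S t) * C j)" if x: "x \<in> torus_cell" for n x
      proof -
        let ?a = "norm (field (partial_sum n) t x)"
        have "?a \<le> 1 + ?a\<^sup>2" using sum_squares_bound[of ?a "1/2"] by (simp add: power2_eq_square)
        then have a: "?a \<le> 1 + majorant S t" using partial_sum_norm_square[OF True S, of n x] by linarith
        show ?thesis unfolding real_norm_def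
        proof (intro order.trans[OF sum_abs] sum_mono)
          fix j
          have "\<bar>field (partial_sum n) t x $ j\<bar> \<le> 1 + majorant S t"
            using component_le_norm_cart[of "field (partial_sum n) t x" j] a by linarith
          then show "\<bar>field (partial_sum n) t x $ j * partial j \<psi> x\<bar> \<le> (1 + majorant S t) * C j"
            unfolding abs_mult using C(2)[OF x, of j] majorant_nonneg[of S t] by (intro mult_mono) auto
        qed
      qed
      then show "AE x in lebesgue_on torus_cell. norm (?f n x) \<le> (\<Sum>j\<in>UNIV. (1 + majorant S t) * C j)" for n
        by (intro AE_I2) simp
    qed (use lim fm in auto)
    then show "cell_int (\<lambda>x. \<Sum>j\<in>UNIV. limit t x $ j * partial j \<psi> x) = 0"
      by (simp add: field_div_free[OF velocity_partial_sum \<psi>] LIMSEQ_const_iff)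
  qed
qed

end

lemma weak_integrand_bound:
  assumes tb: "test_bounds \<phi> B T'" and p: "(t, x) \<in> slab"
    and u: "(norm (u t x))\<^sup>2 \<le> M" and w: "(norm (w t x))\<^sup>2 \<le> M"
  shows "\<bar>weak_integrand \<phi> u w (t, x)\<bar> \<le> 10 * B * (1 + M)"
proof -
  have tx: "t \<in> {0..<1}" "x \<in> torus_cell" using p by auto
  have B: "0 \<le> B" "norm (time_deriv 1 \<phi> t x) \<le> B" "\<And>j. norm (partial j (\<phi> t) x) \<le> B"
    using tb tx by (auto simp: test_bounds_def test_slice_def)
  have M: "0 \<le> M" using u zero_le_power2[of "norm (u t x)"] by linarith
  have "norm (u t x) \<le> sqrt M" "norm (w t x) \<le> sqrt M" using u w by (auto intro: real_le_rsqrt)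
  then have "\<bar>bilin (\<phi> t) (u t) (w t) x\<bar> \<le> 9 * (B * (sqrt M * sqrt M))" by (intro bilin_bound B)
  moreover have "sqrt M \<le> 1 + M"
    using M sum_squares_bound[of "sqrt M" "1/2"] by (simp add: power2_eq_square)
  then have "norm (w t x) \<le> 1 + M" using \<open>norm (w t x) \<le> sqrt M\<close> by linarith
  then have "norm (w t x) * norm (time_deriv 1 \<phi> t x) \<le> (1 + M) * B"
    using B M by (intro mult_mono) auto
  then have "\<bar>w t x \<bullet> time_deriv 1 \<phi> t x\<bar> \<le> (1 + M) * B"
    using Cauchy_Schwarz_ineq2[of "w t x" "time_deriv 1 \<phi> t x"] by linarith
  ultimately have "\<bar>weak_integrand \<phi> u w (t, x)\<bar> \<le> (1 + M) * B + 9 * (B * M)"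
    using M unfolding weak_integrand_def fst_conv snd_conv by simp
  also have "\<dots> \<le> 10 * B * (1 + M)" using B(1) M by (simp add: algebra_simps)
  finally show ?thesis .
qed

text \<open>
  Dominated convergence: the partial sums converge pointwise at good times, and the integrand is bounded by
  a multiple of 1 plus the majorants of the squares.
\<close>

lemma weak_limit:
  fixes Z Z' :: "mode list"
  assumes A: "mode_series \<alpha> Z W g" and A': "mode_series \<alpha> Z' W' g"
    and tb: "test_bounds \<phi> B T'"
    and conv: "(\<lambda>n. integral\<^sup>L (spacetime 1) (weak_integrand \<phi> (field (mode_series.partial_sum Z' W' n))
        (field (mode_series.partial_sum Z W n)))) \<longlonglongrightarrow> 0"
  shows "integrable (spacetime 1) (weak_integrand \<phi> (mode_series.limit Z' W' g) (mode_series.limit Z W g))"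
    "integral\<^sup>L (spacetime 1) (weak_integrand \<phi> (mode_series.limit Z' W' g) (mode_series.limit Z W g)) = 0"
proof -
  interpret A: mode_series \<alpha> Z W g by (rule A)
  interpret A': mode_series \<alpha> Z' W' g by (rule A')
  let ?G = "good_times g"
  let ?F = "\<lambda>n. weak_integrand \<phi> (field (A'.partial_sum n)) (field (A.partial_sum n))"
  let ?L = "weak_integrand \<phi> A'.limit A.limit"
  have G [measurable]: "?G \<in> sets borel" by (rule A.G_facts(1))
  obtain S where S: "0 < S" "\<And>t. t \<in> {0..1} \<Longrightarrow> size_at Z t \<le> S"
    using continuous_modes_bound[OF velocity_modes_continuous[OF A.velZ]] by metis
  obtain S' where S': "0 < S'" "\<And>t. t \<in> {0..1} \<Longrightarrow> size_at Z' t \<le> S'"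
    using continuous_modes_bound[OF velocity_modes_continuous[OF A'.velZ]] by metis
  define M where "M t = A.majorant S t + A'.majorant S' t" for t
  have c: "continuous_on ({0..<1} \<times> UNIV) (?F n)" for n
  proof -
    have "continuous_on ({0..<1} \<times> UNIV) (\<lambda>p. time_deriv 1 \<phi> (fst p) (snd p))"
      "\<And>j. continuous_on ({0..<1} \<times> UNIV) (\<lambda>p. partial j (\<phi> (fst p)) (snd p))"
      using tb unfolding test_bounds_def case_prod_unfold by blast+
    then show ?thesis unfolding weak_integrand_def bilin_def
      by (intro continuous_intros continuous_field velocity_modes_continuous A.velocity_partial_sum A'.velocity_partial_sum)
  qed
  have Fm: "(\<lambda>p. indicator slab p *\<^sub>R ?F n p) \<in> borel_measurable borel" for n
    by (rule slab_continuous_borel[OF c])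
  define f where "f n p = indicator ?G (fst p) * (indicator slab p *\<^sub>R ?F n p)" for n p
  have fm: "f n \<in> borel_measurable borel" for n unfolding f_def using Fm[of n] by measurable
  have off: "?L p = 0" if "fst p \<notin> ?G" for p
    using that by (simp add: weak_integrand_def bilin_def A.limit_off A'.limit_off)
  have lim: "(\<lambda>n. f n p) \<longlonglongrightarrow> indicator slab p * ?L p" for p
  proof (cases "fst p \<in> ?G")
    case True
    have "(\<lambda>n. ?F n p) \<longlonglongrightarrow> ?L p"
      unfolding weak_integrand_def bilin_def
      by (intro tendsto_intros A.limit_pointwise A'.limit_pointwise True)
    then show ?thesis using True by (auto simp: f_def intro!: tendsto_intros)
  next
    case False
    then show ?thesis by (simp add: f_def off)
  qed
  have Lm: "(\<lambda>p. indicator slab p * ?L p) \<in> borel_measurable borel"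
    by (rule borel_measurable_LIMSEQ_metric[OF fm lim])
  have dom: "integrable lborel (\<lambda>p. 10 * B * (indicator slab p * (1 + M (fst p))))"
  proof -
    have "integrable lborel (\<lambda>p::real \<times> (real^3). indicator slab p + (indicator slab p * A.majorant S (fst p)
        + indicator slab p * A'.majorant S' (fst p)) :: real)"
      using emeasure_slab
      by (intro Bochner_Integration.integrable_add A.majorant_integrable A'.majorant_integrable integrable_real_indicator) auto
    then show ?thesis by (intro integrable_mult_right) (simp add: M_def distrib_left)
  qed
  have bound: "norm (f n p) \<le> 10 * B * (indicator slab p * (1 + M (fst p)))" for n p
  proof (cases "p \<in> slab \<and> fst p \<in> ?G")
    case True
    obtain t x where p: "p = (t, x)" by (cases p)
    have t: "t \<in> ?G" "t \<in> {0..1}" using True p by auto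
    have M2: "(norm (field (A'.partial_sum n) t x))\<^sup>2 \<le> M t" "(norm (field (A.partial_sum n) t x))\<^sup>2 \<le> M t"
      using A.partial_sum_norm_square[OF t(1) S(2)[OF t(2)], of n x] A.majorant_nonneg[of S t]
        A'.partial_sum_norm_square[OF t(1) S'(2)[OF t(2)], of n x] A'.majorant_nonneg[of S' t]
      unfolding M_def by linarith+
    have "\<bar>?F n (t, x)\<bar> \<le> 10 * B * (1 + M t)"
      by (rule weak_integrand_bound[OF tb]) (use True p M2 in auto)
    then show ?thesis using True by (simp add: f_def p)
  next
    case False
    have "0 \<le> B" using tb by (simp add: test_bounds_def)
    then show ?thesis using False A.majorant_nonneg[of S "fst p"] A'.majorant_nonneg[of S' "fst p"]
      by (auto simp: f_def M_def)
  qed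
  have main: "integrable lborel (\<lambda>p. indicator slab p * ?L p)" "(\<lambda>n. integral\<^sup>L lborel (f n)) \<longlonglongrightarrow> integral\<^sup>L lborel (\<lambda>p. indicator slab p * ?L p)"
  proof -
    have 1: "(\<lambda>p. indicator slab p * ?L p) \<in> borel_measurable lborel" "\<And>n. f n \<in> borel_measurable lborel"
      using Lm fm by auto
    have 2: "AE p in lborel. (\<lambda>n. f n p) \<longlonglongrightarrow> indicator slab p * ?L p" by (intro AE_I2 lim)
    have 3: "AE p in lborel. norm (f n p) \<le> 10 * B * (indicator slab p * (1 + M (fst p)))" for n by (intro AE_I2 bound)
    show "integrable lborel (\<lambda>p. indicator slab p * ?L p)"
      by (rule integrable_dominated_convergence[OF 1 dom 2 3])
    show "(\<lambda>n. integral\<^sup>L lborel (f n)) \<longlonglongrightarrow> integral\<^sup>L lborel (\<lambda>p. indicator slab p * ?L p)"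
      by (rule integral_dominated_convergence[OF 1 dom 2 3])
  qed
  have "integral\<^sup>L lborel (f n) = integral\<^sup>L (spacetime 1) (?F n)" for n
  proof -
    have "integral\<^sup>L lborel (f n) = integral\<^sup>L lborel (\<lambda>p. indicator slab p *\<^sub>R ?F n p)"
    proof (rule integral_cong_AE)
      show "AE p in lborel. f n p = indicator slab p *\<^sub>R ?F n p"
        using AE_slab_time[OF G A.G_facts(4)] by eventually_elim (auto simp: f_def indicator_def)
    qed (use fm Fm in auto)
    also have "\<dots> = integral\<^sup>L (spacetime 1) (?F n)"
      by (rule spacetime_integral(2)[OF Fm, symmetric]) auto
    finally show ?thesis .
  qed
  then have "integral\<^sup>L lborel (\<lambda>p. indicator slab p * ?L p) = 0"
    using main(2) conv LIMSEQ_unique by simp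
  then show "integral\<^sup>L (spacetime 1) ?L = 0"
    by (subst spacetime_integral(2)[OF Lm]) auto
  show "integrable (spacetime 1) ?L"
    using main(1) by (subst spacetime_integral(3)[OF Lm]) auto
qed

section \<open>Infinitely many solutions\<close>

definition scale_modes :: "real \<Rightarrow> mode list \<Rightarrow> mode list" where
  "scale_modes c X = map (\<lambda>m. Mode (\<lambda>t. c * amp m t) (dir m) (freq m) (phase m)) X"

lemma scale_modes:
  "field (scale_modes c X) t x = c *\<^sub>R field X t x"
  "size_at (scale_modes c X) t = \<bar>c\<bar> * size_at X t"
  "holder_at \<alpha> (scale_modes c X) t = \<bar>c\<bar> * holder_at \<alpha> X t"
  "velocity_modes X \<Longrightarrow> velocity_modes (scale_modes c X)"
  by (induction X)
    (auto simp: scale_modes_def algebra_simps abs_mult velocity_modes_Cons C1_cmult)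

text \<open>
  A shear flow whose amplitude grows linearly. It is transported by the zero field, so the only error is its
  time derivative, a single wave with constant amplitude.
\<close>

definition seed_modes :: "real \<Rightarrow> mode list" where
  "seed_modes a = [Mode (\<lambda>t. a * t) (axis 1 1) (axis 2 1) 0]"

lemma seed_approx_solution: "approx_solution (seed_modes a) [] [Mode (\<lambda>_. a) (axis 1 1) (axis 2 1) 0] []"
proof -
  have d: "((\<lambda>t. a * t) has_real_derivative (\<lambda>_. a) t) (at t)" for t
    by (auto intro!: derivative_eq_intros)
  have C: "C1 (\<lambda>t. a * t)" "deriv (\<lambda>t. a * t) = (\<lambda>_. a)"
    using C1_I[OF d] by auto
  have o: "(axis 1 1 :: real^3) \<bullet> axis 2 1 = 0" by (simp add: inner_axis_axis)
  show ?thesis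
    unfolding approx_solution_def seed_modes_def
    by (auto simp: velocity_modes_Cons error_modes_Cons C o axis_eq_0_iff)
qed

lemma wave_mean_zero:
  assumes "integer_vec k" "k \<noteq> 0"
  shows "cell_int (wave k p) = 0"
proof -
  obtain j where j: "k $ j \<noteq> 0" using assms(2) by (auto simp: vec_eq_iff)
  have p0: "partial j (\<lambda>_::real^3. 1::real) = (\<lambda>_. 0)" by (simp add: partial_def fun_eq_iff)
  have "cell_int (\<lambda>x. wave k (p + pi/2) x * partial j (\<lambda>_. 1) x) = 2 * pi * k $ j * cell_int (\<lambda>x. wave k ((p + pi/2) - pi/2) x * 1)"
    by (rule wave_ibp[OF assms(1)]) (auto simp: torus_periodic_def p0)
  then show ?thesis using j by (simp add: p0)
qed

lemma seed_energy:
  "integrable (spacetime 1) (\<lambda>p. fst p * (wave (axis 2 1) 0 (snd p))\<^sup>2)"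
  "integral\<^sup>L (spacetime 1) (\<lambda>p. fst p * (wave (axis 2 1) 0 (snd p))\<^sup>2) = 1 / 4"
proof -
  let ?F = "\<lambda>p::real \<times> (real^3). fst p * (wave (axis 2 1) 0 (snd p))\<^sup>2"
  have c: "continuous_on ({0..<1} \<times> UNIV) ?F"
    by (intro continuous_intros continuous_on_compose2[OF continuous_wave[of UNIV]]) auto
  have b: "norm (?F p) \<le> 1" if "p \<in> slab" for p
  proof -
    have "(wave (axis 2 1) 0 (snd p))\<^sup>2 \<le> 1" by (simp add: abs_square_le_1)
    then have "fst p * (wave (axis 2 1) 0 (snd p))\<^sup>2 \<le> 1 * 1" using that by (intro mult_mono) auto
    then show ?thesis using that by (auto simp: abs_mult)
  qed
  show "integrable (spacetime 1) ?F" by (rule slab_fubini(1)[OF c b])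
  have "cell_int (\<lambda>x. (wave (axis 2 1) 0 x)\<^sup>2) = 1 / 2"
  proof -
    have "(wave (axis 2 1) 0 x)\<^sup>2 = (wave (axis 2 1 + axis 2 1) 0 x + 1) / 2" for x :: "real^3"
      using wave_mult[of "axis 2 1" 0 x "axis 2 1" 0] by (simp add: power2_eq_square) (simp add: wave_def)
    moreover have "cell_int (\<lambda>x. (wave (axis 2 1 + axis 2 1) 0 x + 1) / 2) = 1 / 2"
    proof -
      have "(axis 2 1 + axis 2 1 :: real^3) \<noteq> 0" by (simp add: vec_eq_iff axis_def exI[of _ 2])
      then have "cell_int (wave (axis 2 1 + axis 2 1) 0) = 0"
        by (rule wave_mean_zero[OF integer_vec_add[OF integer_vec_axis integer_vec_axis]])
      moreover have "integrable (lebesgue_on torus_cell) (wave (axis 2 1 + axis 2 1) 0)" "integrable (lebesgue_on torus_cell) (\<lambda>x. 1::real)"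
        by (intro cell_integrable continuous_intros)+
      ultimately show ?thesis by (simp add: Bochner_Integration.integral_add)
    qed
    ultimately show ?thesis by (simp only:)
  qed
  then have cellF: "cell_int (\<lambda>x. ?F (t, x)) = t / 2" for t by simp
  then have "integral\<^sup>L (spacetime 1) ?F = (\<integral>t. indicator {0..<1} t * (t / 2) \<partial>lborel)"
    by (subst slab_fubini(2)[OF c b]) (assumption, simp only: cellF)
  also have "\<dots> = integral {0..1} (\<lambda>t::real. t / 2)" by (rule lborel_interval_integral(2)) (intro continuous_intros, simp)
  also have "\<dots> = 1 / 4"
  proof -
    have "((\<lambda>t::real. t / 2) has_integral (1\<^sup>2 / 4 - 0\<^sup>2 / 4)) {0..1}"
      by (rule fundamental_theorem_of_calculus)
         (auto intro!: derivative_eq_intros simp: has_real_derivative_iff_has_vector_derivative[symmetric])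
    then show ?thesis by (simp add: integral_unique)
  qed
  finally show "integral\<^sup>L (spacetime 1) ?F = 1 / 4" .
qed

text \<open>
  In the Elsasser variables the construction starts from \<open>seed_modes a\<close> and zero, hence \<open>v\<close> from one half
  of it. The velocity and the magnetic field are half the sum and half the difference of the two limits; they
  are also treated as limits of series in their own right, which gives their regularity. \<open>\<rho>\<close> is the sum of
  the Hoelder majorants of all increments.
\<close>

lemma solution_near_seed:
  assumes \<alpha>: "0 < \<alpha>" "\<alpha> < 1" and \<kappa>: "0 < \<kappa>"
  shows "\<exists>v b \<rho>. mhd_weak_solution 1 (\<lambda>_. 0) (\<lambda>_. 0) v b \<and> L1_holder \<alpha> 1 v \<and> L1_holder \<alpha> 1 b \<and>
    integrable (spacetime 1) (\<lambda>p. \<rho> (fst p)) \<and> integral\<^sup>L (spacetime 1) (\<lambda>p. \<rho> (fst p)) \<le> \<kappa> \<and>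
    (AE p in spacetime 1. norm (v (fst p) (snd p) - (a / 2 * fst p * wave (axis 2 1) 0 (snd p)) *\<^sub>R axis 1 1) \<le> \<rho> (fst p))"
proof -
  obtain X Y E F U V :: "nat \<Rightarrow> mode list" and K where
    init: "X 0 = seed_modes a" "Y 0 = []" and step: "\<And>n. X (Suc n) = X n @ U n" "\<And>n. Y (Suc n) = Y n @ V n"
    and ap: "\<And>n. approx_solution (X n) (Y n) (E n) (F n)"
    and st: "\<And>n. integral {0..1} (\<lambda>t. stress_at (E (Suc n)) t + stress_at (F (Suc n)) t) \<le> 1 / 8 ^ Suc n"
    and ho: "\<And>n. integral {0..1} (\<lambda>t. holder_at \<alpha> (U n) t + holder_at \<alpha> (V n) t) \<le> \<kappa> / 2 ^ Suc n"
    and sq: "\<And>n. integral {0..1} (\<lambda>t. (size_at (U n) t + size_at (V n) t)\<^sup>2) \<le> K / 8 ^ n"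
    by (rule approximating_sequence[OF \<alpha> seed_approx_solution \<kappa>]) (rule that; assumption)
  have vX: "velocity_modes (X n)" "velocity_modes (Y n)" for n using ap[of n] by (auto simp: approx_solution_def)
  have vU: "velocity_modes (U n)" "velocity_modes (V n)" for n
    using vX[of "Suc n"] unfolding step by auto
  have eE: "error_modes (E n)" "error_modes (F n)" for n using ap[of n] by (auto simp: approx_solution_def)
  define h where "h n t = holder_at \<alpha> (U n) t + holder_at \<alpha> (V n) t" for n t
  define s where "s n t = size_at (U n) t + size_at (V n) t" for n t
  (* One majorant for all four series, so that they converge on the same set of times. *)
  define g where "g n t = h n t + 2 ^ n * (s n t)\<^sup>2" for n t
  have ch: "continuous_on A (h n)" for A n
    unfolding h_def by (intro continuous_pair_sizes vU)
  have cs: "continuous_on A (\<lambda>t. (s n t)\<^sup>2)" for A n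
    unfolding s_def by (intro continuous_pair_sizes vU)
  have cg: "continuous_on A (g n)" for A n
    unfolding g_def by (intro continuous_intros ch cs)
  have h0: "0 \<le> h n t" and s0: "0 \<le> s n t" and g0: "0 \<le> g n t" and hg: "h n t \<le> g n t" and sh: "s n t \<le> h n t" for n t
    using size_le_holder[of "U n" t \<alpha>] size_le_holder[of "V n" t \<alpha>] by (auto simp: h_def s_def g_def)
  have intpos: "0 \<le> integral {0..1} (h n)" "0 \<le> integral {0..1} (g n)" for n
    using h0 g0 by (auto intro!: integral_nonneg integrable_continuous_interval ch cg)
  have hsum: "summable (\<lambda>n. integral {0..1} (h n))" and htot: "(\<Sum>n. integral {0..1} (h n)) \<le> \<kappa>"
  proof -
    have geo: "(\<lambda>n. \<kappa> / 2 ^ Suc n) sums \<kappa>"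
      using sums_mult[OF power_half_series, of \<kappa>] by (simp add: power_one_over)
    have le: "integral {0..1} (h n) \<le> \<kappa> / 2 ^ Suc n" for n using ho[of n] by (simp add: h_def[abs_def])
    show 1: "summable (\<lambda>n. integral {0..1} (h n))"
      by (rule summable_comparison_test'[OF sums_summable[OF geo], of 0]) (use le intpos in auto)
    show "(\<Sum>n. integral {0..1} (h n)) \<le> \<kappa>"
      using suminf_le[OF le 1 sums_summable[OF geo]] sums_unique[OF geo] by simp
  qed
  have gsum: "summable (\<lambda>n. integral {0..1} (g n))"
  proof -
    have eq: "integral {0..1} (g n) = integral {0..1} (h n) + 2 ^ n * integral {0..1} (\<lambda>t. (s n t)\<^sup>2)" for n
    proof -
      have "integral {0..1} (g n) = integral {0..1} (h n) + integral {0..1} (\<lambda>t. 2 ^ n * (s n t)\<^sup>2)"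
        unfolding g_def by (intro Henstock_Kurzweil_Integration.integral_add integrable_continuous_interval continuous_intros ch cs)
      then show ?thesis by simp
    qed
    have le: "2 ^ n * integral {0..1} (\<lambda>t. (s n t)\<^sup>2) \<le> K * (1/4) ^ n" for n
    proof -
      have "2 ^ n * integral {0..1} (\<lambda>t. (s n t)\<^sup>2) \<le> 2 ^ n * (K / 8 ^ n)"
        using sq[of n] unfolding s_def by (intro mult_left_mono) auto
      also have "\<dots> = K * (2 ^ n / 8 ^ n)" by simp
      also have "(2::real) ^ n / 8 ^ n = (1/4) ^ n" using power_divide[of "2::real" 8 n] by simp
      finally show ?thesis .
    qed
    have pos: "0 \<le> 2 ^ n * integral {0..1} (\<lambda>t. (s n t)\<^sup>2)" for n
      by (intro mult_nonneg_nonneg integral_nonneg integrable_continuous_interval cs) auto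
    have "summable (\<lambda>n. K * (1/4::real) ^ n)" by (intro summable_mult summable_geometric) simp
    then have "summable (\<lambda>n. 2 ^ n * integral {0..1} (\<lambda>t. (s n t)\<^sup>2))"
      by (rule summable_comparison_test'[of _ 0]) (use le pos in auto)
    then show ?thesis unfolding eq using hsum by (intro summable_add)
  qed
  let ?Zv = "scale_modes (1/2) (X 0) @ scale_modes (1/2) (Y 0)"
  let ?Wv = "\<lambda>n. scale_modes (1/2) (U n) @ scale_modes (1/2) (V n)"
  let ?Zb = "scale_modes (1/2) (X 0) @ scale_modes (-(1/2)) (Y 0)"
  let ?Wb = "\<lambda>n. scale_modes (1/2) (U n) @ scale_modes (-(1/2)) (V n)"
  have series: "mode_series \<alpha> Z W g"
    if "velocity_modes Z" "\<And>n. velocity_modes (W n)" "\<And>n t. holder_at \<alpha> (W n) t \<le> h n t" "\<And>n t. size_at (W n) t \<le> s n t" for Z W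
  proof
    show "2 ^ n * (size_at (W n) t)\<^sup>2 \<le> g n t" for n t
    proof -
      have "2 ^ n * (size_at (W n) t)\<^sup>2 \<le> 2 ^ n * (s n t)\<^sup>2"
        using that(4)[of n t] by (intro mult_left_mono power_mono) auto
      then show ?thesis unfolding g_def using h0[of n t] by linarith
    qed
    show "holder_at \<alpha> (W n) t \<le> g n t" for n t using that(3)[of n t] hg[of n t] by linarith
  qed (use \<alpha> that cg gsum in auto)
  have MX: "mode_series \<alpha> (X 0) U g" by (rule series) (auto simp: vX vU h_def s_def)
  have MY: "mode_series \<alpha> (Y 0) V g" by (rule series) (auto simp: vX vU h_def s_def)
  have half: "p / 2 + q / 2 \<le> p + q" if "0 \<le> p" "0 \<le> q" for p q :: real using that by simp
  have Mv: "mode_series \<alpha> ?Zv ?Wv g"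
    by (rule series) (simp_all add: scale_modes vX vU h_def s_def half)
  have Mb: "mode_series \<alpha> ?Zb ?Wb g"
    by (rule series) (simp_all add: scale_modes vX vU h_def s_def half)
  interpret x: mode_series \<alpha> "X 0" U g by (rule MX)
  interpret y: mode_series \<alpha> "Y 0" V g by (rule MY)
  interpret v: mode_series \<alpha> ?Zv ?Wv g by (rule Mv)
  interpret b: mode_series \<alpha> ?Zb ?Wb g by (rule Mb)
  have sum_v: "v.limit t z = (1/2) *\<^sub>R (x.limit t z + y.limit t z)"
    and sum_b: "b.limit t z = (1/2) *\<^sub>R (x.limit t z - y.limit t z)" for t z
  proof -
    have "v.limit t z = (1/2) *\<^sub>R (x.limit t z + y.limit t z) \<and> b.limit t z = (1/2) *\<^sub>R (x.limit t z - y.limit t z)"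
    proof (cases "t \<in> good_times g")
      case True
      note sx = x.summable_parts(3)[OF True, of z] and sy = y.summable_parts(3)[OF True, of z]
      have 1: "(\<Sum>n. field (?Wv n) t z) = (1/2) *\<^sub>R (\<Sum>n. field (U n) t z) + (1/2) *\<^sub>R (\<Sum>n. field (V n) t z)"
        using suminf_add[OF summable_scaleR_right[OF sx, of "1/2"] summable_scaleR_right[OF sy, of "1/2"]]
        by (simp add: scale_modes suminf_scaleR_right[OF sx] suminf_scaleR_right[OF sy])
      have 2: "(\<Sum>n. field (?Wb n) t z) = (1/2) *\<^sub>R (\<Sum>n. field (U n) t z) + (-(1/2)) *\<^sub>R (\<Sum>n. field (V n) t z)"
        using suminf_add[OF summable_scaleR_right[OF sx, of "1/2"] summable_scaleR_right[OF sy, of "-(1/2)"]]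
        by (simp add: scale_modes suminf_scaleR_right[OF sx] suminf_scaleR_right[OF sy])
      show ?thesis unfolding v.limit_def b.limit_def x.limit_def y.limit_def 1 2
        using True by (simp add: scale_modes algebra_simps)
    next
      case False
      then show ?thesis by (simp add: v.limit_off b.limit_off x.limit_off y.limit_off)
    qed
    then show "v.limit t z = (1/2) *\<^sub>R (x.limit t z + y.limit t z)" "b.limit t z = (1/2) *\<^sub>R (x.limit t z - y.limit t z)" by auto
  qed
  have PX: "x.partial_sum n = X n" "y.partial_sum n = Y n" for n
    by (induction n) (simp_all add: x.partial_sum_def y.partial_sum_def step)
  have stress0: "(\<lambda>n. 9 * B * integral {0..1} (stress_at (E n))) \<longlonglongrightarrow> 0" "(\<lambda>n. 9 * B * integral {0..1} (stress_at (F n))) \<longlonglongrightarrow> 0" for B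
  proof -
    have le: "integral {0..1} (stress_at (E (Suc n))) \<le> (1/8) ^ Suc n" "integral {0..1} (stress_at (F (Suc n))) \<le> (1/8) ^ Suc n"
      and pos: "0 \<le> integral {0..1} (stress_at (E n))" "0 \<le> integral {0..1} (stress_at (F n))" for n
    proof -
      show p: "0 \<le> integral {0..1} (stress_at (E n))" "0 \<le> integral {0..1} (stress_at (F n))" for n
        using eE by (auto intro!: integral_nonneg integrable_continuous_interval continuous_pair_sizes)
      show "integral {0..1} (stress_at (E (Suc n))) \<le> (1/8) ^ Suc n" "integral {0..1} (stress_at (F (Suc n))) \<le> (1/8) ^ Suc n"
        using st[of n] integral_stress_append[OF eE, of "Suc n" "Suc n"] p[of "Suc n"] by (simp_all add: power_one_over)
    qed
    have z: "(\<lambda>n. (1/8::real) ^ Suc n) \<longlonglongrightarrow> 0" by (intro LIMSEQ_Suc LIMSEQ_realpow_zero) auto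
    have "(\<lambda>n. integral {0..1} (stress_at (E (Suc n)))) \<longlonglongrightarrow> 0" "(\<lambda>n. integral {0..1} (stress_at (F (Suc n)))) \<longlonglongrightarrow> 0"
      by (rule tendsto_sandwich[OF _ _ tendsto_const z]; simp add: le pos del: power_Suc)+
    then have "(\<lambda>n. integral {0..1} (stress_at (E n))) \<longlonglongrightarrow> 0" "(\<lambda>n. integral {0..1} (stress_at (F n))) \<longlonglongrightarrow> 0"
      by (auto dest: LIMSEQ_imp_Suc)
    then show "(\<lambda>n. 9 * B * integral {0..1} (stress_at (E n))) \<longlonglongrightarrow> 0" "(\<lambda>n. 9 * B * integral {0..1} (stress_at (F n))) \<longlonglongrightarrow> 0"
      by (auto intro: tendsto_mult_right_zero)
  qed
  have sol: "mhd_weak_solution 1 (\<lambda>_. 0) (\<lambda>_. 0) v.limit b.limit"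
    unfolding mhd_weak_solution_def
  proof (intro conjI allI impI)
    show "L2_spacetime 1 v.limit" "L2_spacetime 1 b.limit" by (rule v.limit_L2, rule b.limit_L2)
    show "AE t in lebesgue_on {0..1}. weakly_div_free (v.limit t) \<and> weakly_div_free (b.limit t)"
      using v.limit_div_free b.limit_div_free by simp
  next
    fix \<phi> assume "mhd_test_function 1 \<phi>"
    then obtain B T' where tb: "test_bounds \<phi> B T'" using test_function_bounds by blast
    have c1: "(\<lambda>n. integral\<^sup>L (spacetime 1) (weak_integrand \<phi> (field (y.partial_sum n)) (field (x.partial_sum n)))) \<longlonglongrightarrow> 0"
      unfolding PX
      by (rule Lim_null_comparison[OF _ stress0(1)[of B]])
         (use approx_solution_weak_form[OF tb ap] in auto)
    have c2: "(\<lambda>n. integral\<^sup>L (spacetime 1) (weak_integrand \<phi> (field (x.partial_sum n)) (field (y.partial_sum n)))) \<longlonglongrightarrow> 0"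
      unfolding PX
      by (rule Lim_null_comparison[OF _ stress0(2)[of B]])
         (use approx_solution_weak_form[OF tb approx_solution_sym[OF ap]] in auto)
    note w1 = weak_limit[OF MX MY tb c1] and w2 = weak_limit[OF MY MX tb c2]
    let ?p = "weak_integrand \<phi> y.limit x.limit" and ?q = "weak_integrand \<phi> x.limit y.limit"
    have eqv: "(\<lambda>(t, x). v.limit t x \<bullet> time_deriv 1 \<phi> t x +
             (\<Sum>i\<in>UNIV. \<Sum>j\<in>UNIV. partial j (\<phi> t) x $ i *
                (v.limit t x $ j * v.limit t x $ i - b.limit t x $ j * b.limit t x $ i)))
       = (\<lambda>p. 1/2 * (?p p + ?q p))"
    proof (rule ext, clarify)
      fix t z
      have "(\<Sum>i\<in>UNIV. \<Sum>j\<in>UNIV. partial j (\<phi> t) z $ i *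
                (v.limit t z $ j * v.limit t z $ i - b.limit t z $ j * b.limit t z $ i))
        = 1/2 * (bilin (\<phi> t) (y.limit t) (x.limit t) z + bilin (\<phi> t) (x.limit t) (y.limit t) z)"
        unfolding bilin_def sum.distrib[symmetric] sum_distrib_left
        by (intro sum.cong refl) (simp add: sum_v sum_b field_simps)
      then show "v.limit t z \<bullet> time_deriv 1 \<phi> t z +
             (\<Sum>i\<in>UNIV. \<Sum>j\<in>UNIV. partial j (\<phi> t) z $ i *
                (v.limit t z $ j * v.limit t z $ i - b.limit t z $ j * b.limit t z $ i))
          = 1/2 * (?p (t, z) + ?q (t, z))"
        by (simp add: weak_integrand_def sum_v inner_add_left)
    qed
    have eqb: "(\<lambda>(t, x). b.limit t x \<bullet> time_deriv 1 \<phi> t x +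
             (\<Sum>i\<in>UNIV. \<Sum>j\<in>UNIV. partial j (\<phi> t) x $ i *
                (v.limit t x $ j * b.limit t x $ i - b.limit t x $ j * v.limit t x $ i)))
       = (\<lambda>p. 1/2 * (?p p - ?q p))"
    proof (rule ext, clarify)
      fix t z
      have "(\<Sum>i\<in>UNIV. \<Sum>j\<in>UNIV. partial j (\<phi> t) z $ i *
                (v.limit t z $ j * b.limit t z $ i - b.limit t z $ j * v.limit t z $ i))
        = 1/2 * (bilin (\<phi> t) (y.limit t) (x.limit t) z - bilin (\<phi> t) (x.limit t) (y.limit t) z)"
        unfolding bilin_def sum_subtractf[symmetric] sum_distrib_left
        by (intro sum.cong refl) (simp add: sum_v sum_b field_simps)
      then show "b.limit t z \<bullet> time_deriv 1 \<phi> t z +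
             (\<Sum>i\<in>UNIV. \<Sum>j\<in>UNIV. partial j (\<phi> t) z $ i *
                (v.limit t z $ j * b.limit t z $ i - b.limit t z $ j * v.limit t z $ i))
          = 1/2 * (?p (t, z) - ?q (t, z))"
        by (simp add: weak_integrand_def sum_b inner_diff_left)
    qed
    show "integral\<^sup>L (spacetime 1) (\<lambda>(t, x). v.limit t x \<bullet> time_deriv 1 \<phi> t x +
             (\<Sum>i\<in>UNIV. \<Sum>j\<in>UNIV. partial j (\<phi> t) x $ i *
                (v.limit t x $ j * v.limit t x $ i - b.limit t x $ j * b.limit t x $ i)))
          = - cell_int (\<lambda>x. 0 \<bullet> \<phi> 0 x)"
      unfolding eqv using w1 w2 by simp
    show "integral\<^sup>L (spacetime 1) (\<lambda>(t, x). b.limit t x \<bullet> time_deriv 1 \<phi> t x +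
             (\<Sum>i\<in>UNIV. \<Sum>j\<in>UNIV. partial j (\<phi> t) x $ i *
                (v.limit t x $ j * b.limit t x $ i - b.limit t x $ j * v.limit t x $ i)))
          = - cell_int (\<lambda>x. 0 \<bullet> \<phi> 0 x)"
      unfolding eqb using w1 w2 by simp
  qed
  note gh = good_times[of h, OF ch h0 hsum]
  define \<rho> where "\<rho> t = indicator (good_times h) t * (\<Sum>n. h n t)" for t
  have \<rho>b: "\<rho> \<in> borel_measurable borel" using borel_measurable_integrable[OF gh(5)] by (simp add: \<rho>_def[abs_def])
  have \<rho>s: "indicator {0..<1} t * \<rho> t = \<rho> t" for t using gh(2) by (auto simp: \<rho>_def indicator_def)
  have \<rho>i: "integrable lborel (\<lambda>t. indicator {0..<1} t * \<rho> t)" unfolding \<rho>s using gh(5) by (simp add: \<rho>_def[abs_def])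
  note sl = slab_time_integrable[OF \<rho>b \<rho>i]
  have \<rho>m: "(\<lambda>p::real \<times> (real^3). indicator slab p * \<rho> (fst p)) \<in> borel_measurable borel"
    using borel_measurable_integrable[OF sl(1)] by simp
  have \<rho>1: "integrable (spacetime 1) (\<lambda>p. \<rho> (fst p))"
    using sl(1) by (subst spacetime_integral(3)[OF \<rho>m]) auto
  have "integral\<^sup>L (spacetime 1) (\<lambda>p. \<rho> (fst p)) = integral\<^sup>L lborel (\<lambda>p::real \<times> (real^3). indicator slab p * \<rho> (fst p))"
    by (rule spacetime_integral(2)[OF \<rho>m]) auto
  also have "\<dots> = (\<integral>t. \<rho> t \<partial>lborel)" unfolding sl(2) \<rho>s ..
  also have "\<dots> \<le> \<kappa>" using gh(6) htot by (simp add: \<rho>_def[abs_def])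
  finally have \<rho>2: "integral\<^sup>L (spacetime 1) (\<lambda>p. \<rho> (fst p)) \<le> \<kappa>" .
  have near: "norm (v.limit t z - (a / 2 * t * wave (axis 2 1) 0 z) *\<^sub>R axis 1 1) \<le> \<rho> t"
    if t: "t \<in> good_times g" "t \<in> good_times h" for t z
  proof -
    have eq: "field (v.partial_sum 0) t z = (a / 2 * t * wave (axis 2 1) 0 z) *\<^sub>R axis 1 1"
      unfolding v.partial_sum_def by (simp add: scale_modes init seed_modes_def)
    have "norm (v.limit t z - field (v.partial_sum 0) t z) \<le> (\<Sum>k. size_at (?Wv (k + 0)) t)"
      by (rule v.limit_tail_bounds(1)[OF t(1)])
    also have "\<dots> \<le> (\<Sum>k. h k t)"
    proof (rule suminf_le)
      show "size_at (?Wv (k + 0)) t \<le> h k t" for k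
        using sh[of k t] half[OF size_at_nonneg[of "U k" t] size_at_nonneg[of "V k" t]]
        by (simp add: scale_modes s_def)
      show "summable (\<lambda>k. size_at (?Wv (k + 0)) t)" using v.summable_parts(1)[OF t(1)] by simp
      show "summable (\<lambda>k. h k t)" by (rule gh(3)[OF t(2)])
    qed
    finally show ?thesis using t(2) by (simp add: eq \<rho>_def)
  qed
  have "AE p in lborel. p \<in> slab \<longrightarrow> fst p \<in> good_times g" "AE p in lborel. p \<in> slab \<longrightarrow> fst p \<in> good_times h"
    by (rule AE_slab_time[OF v.G_facts(1,4)], rule AE_slab_time[OF gh(1,4)])
  then have "AE p in lebesgue. p \<in> slab \<longrightarrow> fst p \<in> good_times g" "AE p in lebesgue. p \<in> slab \<longrightarrow> fst p \<in> good_times h"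
    by (auto intro: AE_completion)
  then have "AE p in lebesgue. p \<in> {0..1} \<times> torus_cell \<longrightarrow>
      norm (v.limit (fst p) (snd p) - (a / 2 * fst p * wave (axis 2 1) 0 (snd p)) *\<^sub>R axis 1 1) \<le> \<rho> (fst p)"
    using spacetime_AE_slab by eventually_elim (use near in blast)
  then have "AE p in spacetime 1. norm (v.limit (fst p) (snd p) - (a / 2 * fst p * wave (axis 2 1) 0 (snd p)) *\<^sub>R axis 1 1) \<le> \<rho> (fst p)"
    by (subst AE_restrict_space_iff) auto
  then show ?thesis
    using sol v.limit_L1_holder b.limit_L1_holder \<rho>1 \<rho>2 by blast
qed

text \<open>
  The halved seeds differ by \<open>(a' - a) / 2 t cos (2\<pi> x\<^sub>2)\<close>, which has integral \<open>(a' - a) / 8\<close> against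
  \<open>cos (2\<pi> x\<^sub>2)\<close>. If the velocities agree, this is at most 1/16.
\<close>

lemma seeds_far_apart:
  fixes v v' :: "real \<Rightarrow> real^3 \<Rightarrow> real^3"
  assumes \<rho>: "integrable (spacetime 1) (\<lambda>p. \<rho> (fst p))" "integral\<^sup>L (spacetime 1) (\<lambda>p. \<rho> (fst p)) \<le> 1/32"
      "AE p in spacetime 1. norm (v (fst p) (snd p) - (a / 2 * fst p * wave (axis 2 1) 0 (snd p)) *\<^sub>R axis 1 1) \<le> \<rho> (fst p)"
    and \<rho>': "integrable (spacetime 1) (\<lambda>p. \<rho>' (fst p))" "integral\<^sup>L (spacetime 1) (\<lambda>p. \<rho>' (fst p)) \<le> 1/32"
      "AE p in spacetime 1. norm (v' (fst p) (snd p) - (a' / 2 * fst p * wave (axis 2 1) 0 (snd p)) *\<^sub>R axis 1 1) \<le> \<rho>' (fst p)"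
    and eq: "AE p in spacetime 1. v (fst p) (snd p) = v' (fst p) (snd p)"
  shows "a' < a + 1"
proof (rule ccontr)
  assume "\<not> a' < a + 1"
  then have aa: "a + 1 \<le> a'" by simp
  let ?e = "\<lambda>p::real \<times> (real^3). fst p * (wave (axis 2 1) 0 (snd p))\<^sup>2"
  have sp: "AE p in spacetime 1. p \<in> space (spacetime 1)" by (rule AE_space)
  have "(a' - a) / 2 * (1 / 4) = integral\<^sup>L (spacetime 1) (\<lambda>p. (a' - a) / 2 * ?e p)"
    by (simp only: integral_mult_right_zero seed_energy(2))
  also have "\<dots> \<le> integral\<^sup>L (spacetime 1) (\<lambda>p. \<rho> (fst p) + \<rho>' (fst p))"
  proof (rule integral_mono_AE)
    show "AE p in spacetime 1. (a' - a) / 2 * ?e p \<le> \<rho> (fst p) + \<rho>' (fst p)"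
      using \<rho>(3) \<rho>'(3) eq sp
    proof eventually_elim
      case (elim p)
      let ?c = "wave (axis 2 1) 0 (snd p)"
      have p0: "0 \<le> fst p" using elim(4) by auto
      have "(a' / 2 * fst p * ?c) *\<^sub>R (axis 1 1 :: real^3) - (a / 2 * fst p * ?c) *\<^sub>R axis 1 1 = ((a' - a) / 2 * fst p * ?c) *\<^sub>R axis 1 1"
        by (simp add: algebra_simps diff_divide_distrib flip: scaleR_left_diff_distrib)
      then have "\<bar>(a' - a) / 2 * fst p * ?c\<bar> =
          norm ((a' / 2 * fst p * ?c) *\<^sub>R (axis 1 1 :: real^3) - (a / 2 * fst p * ?c) *\<^sub>R axis 1 1)" by simp
      also have "\<dots> \<le> norm (v (fst p) (snd p) - (a / 2 * fst p * ?c) *\<^sub>R axis 1 1)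
          + norm (v' (fst p) (snd p) - (a' / 2 * fst p * ?c) *\<^sub>R axis 1 1)"
        using norm_triangle_ineq4[of "v (fst p) (snd p) - (a / 2 * fst p * ?c) *\<^sub>R axis 1 1" "v' (fst p) (snd p) - (a' / 2 * fst p * ?c) *\<^sub>R axis 1 1"]
        by (simp add: elim(3))
      also have "\<dots> \<le> \<rho> (fst p) + \<rho>' (fst p)" using elim(1,2) by linarith
      finally have le: "\<bar>(a' - a) / 2 * fst p * ?c\<bar> \<le> \<rho> (fst p) + \<rho>' (fst p)" .
      have "(a' - a) / 2 * ?e p = ((a' - a) / 2 * fst p * ?c) * ?c" by (simp add: power2_eq_square)
      also have "\<dots> \<le> \<bar>(a' - a) / 2 * fst p * ?c\<bar> * \<bar>?c\<bar>" by (simp flip: abs_mult)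
      also have "\<dots> \<le> \<bar>(a' - a) / 2 * fst p * ?c\<bar> * 1" by (intro mult_left_mono) auto
      finally show ?case using le by linarith
    qed
  qed (use seed_energy \<rho>(1) \<rho>'(1) in auto)
  also have "\<dots> \<le> 1 / 16" using \<rho> \<rho>' by simp
  finally show False using aa by simp
qed

theorem corollary1p7:
  fixes \<epsilon> :: real
  assumes "0 < \<epsilon>" and "\<epsilon> < 1"
  shows "\<exists>T>0. \<exists>v0 b0 :: real^3 \<Rightarrow> real^3.
    torus_smooth v0 \<and> (\<forall>x. divergence v0 x = 0) \<and> mean_free v0 \<and>
    torus_smooth b0 \<and> (\<forall>x. divergence b0 x = 0) \<and> mean_free b0 \<and>
    infinite ({(v, b). mhd_weak_solution T v0 b0 v b \<and>
                 L1_holder (1 - \<epsilon>) T v \<and> L1_holder (1 - \<epsilon>) T b} // ae_equal T)"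
proof -
  let ?S = "{(v, b). mhd_weak_solution 1 (\<lambda>_. 0) (\<lambda>_. 0) v b \<and> L1_holder (1 - \<epsilon>) 1 v \<and> L1_holder (1 - \<epsilon>) 1 b}"
  have \<alpha>: "0 < 1 - \<epsilon>" "1 - \<epsilon> < 1" using assms by auto
  have ck: "Ck_on n UNIV (\<lambda>x::real^3. 0::real^3)" for n
    by (induction n) auto
  have smooth: "torus_smooth (\<lambda>x. 0 :: real^3)"
    using ck by (simp add: torus_smooth_def torus_periodic_def smooth_on_def)
  have div: "divergence (\<lambda>x. 0) x = 0" for x by (simp add: divergence_def partial_def)
  have mean: "mean_free (\<lambda>x. 0)" by (simp add: mean_free_def)
  have "\<forall>m::nat. \<exists>v b \<rho>. mhd_weak_solution 1 (\<lambda>_. 0) (\<lambda>_. 0) v b \<and> L1_holder (1 - \<epsilon>) 1 v \<and> L1_holder (1 - \<epsilon>) 1 b \<and>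
    integrable (spacetime 1) (\<lambda>p. \<rho> (fst p)) \<and> integral\<^sup>L (spacetime 1) (\<lambda>p. \<rho> (fst p)) \<le> 1/32 \<and>
    (AE p in spacetime 1. norm (v (fst p) (snd p) - (real m / 2 * fst p * wave (axis 2 1) 0 (snd p)) *\<^sub>R axis 1 1) \<le> \<rho> (fst p))"
    using solution_near_seed[OF \<alpha>, of "1/32"] by simp
  then obtain v b \<rho> where sol: "\<And>m. mhd_weak_solution 1 (\<lambda>_. 0) (\<lambda>_. 0) (v m) (b m) \<and> L1_holder (1 - \<epsilon>) 1 (v m) \<and> L1_holder (1 - \<epsilon>) 1 (b m) \<and>
    integrable (spacetime 1) (\<lambda>p. \<rho> m (fst p)) \<and> integral\<^sup>L (spacetime 1) (\<lambda>p. \<rho> m (fst p)) \<le> 1/32 \<and>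
    (AE p in spacetime 1. norm (v m (fst p) (snd p) - (real m / 2 * fst p * wave (axis 2 1) 0 (snd p)) *\<^sub>R axis 1 1) \<le> \<rho> m (fst p))"
    unfolding choice_iff by (elim exE, intro that) (erule spec)
  define cl where "cl m = ae_equal 1 `` {(v m, b m)}" for m :: nat
  have "m' < m + 1" if "cl m = cl m'" for m m'
  proof -
    have "((v m, b m), (v m', b m')) \<in> ae_equal 1"
      using that unfolding cl_def by (rule eq_equiv_class[OF _ equiv_ae_equal]) simp
    then have "AE p in spacetime 1. v m (fst p) (snd p) = v m' (fst p) (snd p)"
      by (auto simp: ae_equal_def case_prod_unfold elim: eventually_mono)
    then have "real m' < real m + 1"
      by (rule seeds_far_apart[where v = "v m" and v' = "v m'" and \<rho> = "\<rho> m" and \<rho>' = "\<rho> m'", rotated 6];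
          use sol[of m] sol[of m'] in blast)
    then show ?thesis by linarith
  qed
  from this this[OF sym] have "inj cl" by (intro injI) (metis add.commute antisym less_Suc_eq_le plus_1_eq_Suc)
  then have "infinite (range cl)" by (simp add: finite_image_iff)
  moreover have "range cl \<subseteq> ?S // ae_equal 1"
    using sol by (auto simp: cl_def intro!: quotientI)
  ultimately have "infinite (?S // ae_equal 1)" using finite_subset by blast
  then show ?thesis
    using smooth div mean by (intro exI[of _ 1] conjI exI[of _ "\<lambda>_. 0"]) auto
qed

end
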